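(* Let $d\ge 2$, $N\ge 2$, $\alpha\in(0,2)$, and $m_1,\dots,m_N>0$. Let $x\in\mathcal X=H^1((0,1),\bar\Lambda)$ be a one-collision solution of $M\ddot x=\nabla U(x)$, with colliding cluster $\mathbf k$ and associated variables $(\rho,s,\tau)$, and suppose that $x$ is asymptotic to a central configuration $s_0$ of the cluster, i.e. $\lim_{\tau\to+\infty}s(\tau)=s_0$. Let $\mu_1$ be the smallest eigenvalue of $\nabla^2U_{|\mathcal E}(s_0)$ on $T_{s_0}\mathcal E$. If $$\mu_1<-\frac{(2-\alpha)^2}{8}\,U(s_0),$$ then the collision Morse index $m_c$ of the action at $(\rho,s)$ is infinite.
   Context: System. $M=\operatorname{diag}[m_1,\dots,m_N]$ (mass $m_i$ acting on $x_i\in\mathbb R^d$), $U(x)=\sum_{i<j}U_{ij}(x_i-x_j)$ with $U_{ij}(x_i-x_j)=m_im_j|x_i-x_j|^{-\alpha}$. $\Delta=\{x\in\mathbb R^{Nd}:\exists i\neq j,\ x_i=x_j\}$, $\Lambda=\{x\in\mathbb R^{Nd}\setminus\Delta:\sum_i m_ix_i=0\}$, and $\bar\Lambda=\{x\in\mathbb R^{Nd}:\sum_i m_ix_i=0\}$. For configurations $y$ we write $|y|^2=\langle My,y\rangle=I(y)$ (mass-weighted norm); $\mathcal A_N(x)=\frac12\int_0^1|\dot x|^2dt+\int_0^1U(x)\,dt$. One-collision solution: a map $x\in C([0,1],\mathbb R^{Nd})\cap C^2((0,1),\mathbb R^{Nd})$ with $x(t)\in\Delta$ for $t\in[0,1]$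 only when $t=1$, solving $M\ddot x=\nabla U(x)$ pointwise in the time interval before the collision, with $\mathcal A_N(x)<+\infty$. Colliding cluster: a subset $\mathbf k\subset\{1,\dots,N\}$ with $x_i(1)=x_j(1)$ for all $i\ne j$ in $\mathbf k$ and $x_i(1)\neq x_j(1)$ for $i\in\mathbf k$, $j\notin\mathbf k$. Relabel so that $\mathbf k=\{1,\dots,k\}$, and let $\bar x=(x_1,\dots,x_k)$ be the colliding components, positions being measured from the centre of mass of the cluster, so that $r=|\bar x|$ satisfies $r(t)\ne0$ for $t\in[0,1)$ and $r(t)\to0$ as $t\to1$. The bodies $\bar x_{k+1},\dots,\bar x_N$ (positions measured from the same point) are kept fixed as given functions of $t$. From here on $U$, $M$, $I$, $\Delta$, $\Lambda$ refer to the $k$ bodies of the cluster. $\mathcal E=\{y\in\Lambda: I(y)=1\}$, and $T_s\mathcal E=\{v:\sum_i m_iv_i=0,\ \langle Ms,v\rangle=0\}$. A central configuration is a critical point of $U$ restricted to $\mathcal E$. For $s\in\mathcal E$ and $v\in T_s\mathcal E$, $\nabla^2U_{|\mathcal E}(s)(v,v)=\nabla^2U(s)(v,v)+\alpha U(s)\langle Mv,v\rangle$; its eigenvalues are taken with respect to the mass-weighted inner product. Variables: $r=|\bar x|$, $s=\bar x/|\bar x|\in\mathcal E$, new time $\tau$ defined by $dt=r^{(2+\alpha)/2}d\tau$ with $\tau=0$ at $t=0$ (so $t\to1$ corresponds to $\tau\to+\infty$), $\rho=r^{(2-\alpha)/4}$, $\beta=\frac{2(2+\alpha)}{2-\alpha}$;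 primes denote $d/d\tau$. Set $W(t,y)=\frac12\sum_{i=1}^k\sum_{j=k+1}^N\frac{m_im_j}{|\bar x_j(t)-y_i|^{\alpha}}$ for $y\in\mathbb R^{kd}$ (so $W=0$ if $k=N$). The restricted action is, up to an additive constant, $$\mathcal A(\rho,s)=\int_0^{+\infty}\tfrac12\Big(\tfrac{4}{2-\alpha}\Big)^2(\rho')^2+\rho^2\Big(\tfrac12|s'|^2+U(s)+\rho^{\frac{4\alpha}{2-\alpha}}W\Big(\int_0^\tau\rho^\beta,\rho^{\frac4{2-\alpha}}s\Big)\Big)d\tau,$$ and its second derivative in $s$ along compactly supported $v$ with $v(\tau)\in T_{s(\tau)}\mathcal E$ is $$\frac{\partial^2\mathcal A}{\partial s^2}(\rho,s)(v,v)=\int_0^{+\infty}\rho^2\big[|v'|^2+\nabla^2U_{|\mathcal E}(s)(v,v)\big]+\rho^{2\frac{6+\alpha}{2-\alpha}}\frac{\partial^2W}{\partial x^2}\Big(\int_0^\tau\rho^\beta,\rho^{\frac4{2-\alpha}}s\Big)(v,v)\,d\tau.$$ Collision Morse index $m_c$ at $(\rho,s)$: the supremum of all integers $m$ for which there exist $m$ linearly independent $C_0^\infty(\mathbb R^+)$ functions $\psi_1,\dots,\psi_m$ with $\psi_i(\tau)\in T_{s(\tau)}\mathcal E$ such that $\frac{\partial^2\mathcal A}{\partial s^2}(\rho,s)(v,v)<0$ for all nonzero $v\in\operatorname{span}\{\psi_1,\dots,\psi_m\}$. *)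

theory Defs
  imports "HOL-Analysis.Analysis" "HOL-Library.Extended_Nat"
begin

text \<open>
  A configuration of the bodies \<open>'n\<close> in \<open>real ^ 'd\<close> is a vector of type \<open>real ^ 'd ^ 'n\<close>. The
  configurations of a cluster \<open>K\<close> are those that vanish outside \<open>K\<close>, so no relabelling of the bodies
  is needed. The notions below take the set \<open>K\<close> of bodies as a parameter; the full system is
  \<open>K = UNIV\<close>.
\<close>

type_synonym ('d, 'n) config = "real ^ 'd ^ 'n"

definition mass_mult :: "('n \<Rightarrow> real) \<Rightarrow> ('d, 'n) config \<Rightarrow> ('d::finite, 'n::finite) config" where
  "mass_mult m y = (\<chi> i. m i *\<^sub>R y $ i)"

definition mass_inner :: "('n \<Rightarrow> real) \<Rightarrow> ('d::finite, 'n::finite) config \<Rightarrow> ('d, 'n) config \<Rightarrow> real" where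
  "mass_inner m u v = mass_mult m u \<bullet> v"

definition inertia :: "('n \<Rightarrow> real) \<Rightarrow> ('d::finite, 'n::finite) config \<Rightarrow> real" where
  "inertia m y = mass_inner m y y"

definition mass_norm :: "('n \<Rightarrow> real) \<Rightarrow> ('d::finite, 'n::finite) config \<Rightarrow> real" where
  "mass_norm m y = sqrt (inertia m y)"

text \<open>
  The factor \<open>1/2\<close> turns the sum over ordered pairs into the sum over \<open>i < j\<close>. On collisions the
  colliding pairs contribute \<open>0\<close> (since \<open>0 powr a = 0\<close>) instead of infinity.
\<close>

definition potential :: "('n \<Rightarrow> real) \<Rightarrow> real \<Rightarrow> 'n set \<Rightarrow> ('d::finite, 'n::finite) config \<Rightarrow> real" where
  "potential m \<alpha> K y =
     1/2 * (\<Sum>i\<in>K. \<Sum>j\<in>K - {i}. m i * m j * norm (y $ i - y $ j) powr (- \<alpha>))"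

definition collision_set :: "'n set \<Rightarrow> ('d::finite, 'n::finite) config set" where
  "collision_set K = {y. \<exists>i\<in>K. \<exists>j\<in>K. i \<noteq> j \<and> y $ i = y $ j}"

definition centred_space :: "('n \<Rightarrow> real) \<Rightarrow> 'n set \<Rightarrow> ('d::finite, 'n::finite) config set" where
  "centred_space m K = {y. (\<forall>i. i \<notin> K \<longrightarrow> y $ i = 0) \<and> (\<Sum>i\<in>K. m i *\<^sub>R y $ i) = 0}"

definition ellipsoid :: "('n \<Rightarrow> real) \<Rightarrow> 'n set \<Rightarrow> ('d::finite, 'n::finite) config set" where
  "ellipsoid m K = {y \<in> centred_space m K - collision_set K. inertia m y = 1}"

definition tangent_space ::
  "('n \<Rightarrow> real) \<Rightarrow> 'n set \<Rightarrow> ('d::finite, 'n::finite) config \<Rightarrow> ('d, 'n) config set" where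
  "tangent_space m K s = {v \<in> centred_space m K. mass_inner m s v = 0}"

definition hessian ::
  "('a::real_normed_vector \<Rightarrow> real) \<Rightarrow> 'a \<Rightarrow> 'a \<Rightarrow> 'a \<Rightarrow> real" where
  "hessian f x u v =
     frechet_derivative (\<lambda>y. frechet_derivative f (at y) u) (at x) v"

definition central_configuration ::
  "('n \<Rightarrow> real) \<Rightarrow> real \<Rightarrow> 'n set \<Rightarrow> ('d::finite, 'n::finite) config \<Rightarrow> bool" where
  "central_configuration m \<alpha> K s \<longleftrightarrow>
     s \<in> ellipsoid m K \<and>
     (\<forall>v\<in>tangent_space m K s. frechet_derivative (potential m \<alpha> K) (at s) v = 0)"

definition restricted_hessian ::
  "('n \<Rightarrow> real) \<Rightarrow> real \<Rightarrow> 'n set \<Rightarrow> ('d::finite, 'n::finite) config \<Rightarrow>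
     ('d, 'n) config \<Rightarrow> ('d, 'n) config \<Rightarrow> real" where
  "restricted_hessian m \<alpha> K s u v =
     hessian (potential m \<alpha> K) s u v + \<alpha> * potential m \<alpha> K s * mass_inner m u v"

definition restricted_eigenvalue ::
  "('n \<Rightarrow> real) \<Rightarrow> real \<Rightarrow> 'n set \<Rightarrow> ('d::finite, 'n::finite) config \<Rightarrow> real \<Rightarrow> bool" where
  "restricted_eigenvalue m \<alpha> K s \<mu> \<longleftrightarrow>
     (\<exists>v\<in>tangent_space m K s. v \<noteq> 0 \<and>
        (\<forall>w\<in>tangent_space m K s. restricted_hessian m \<alpha> K s v w = \<mu> * mass_inner m v w))"

definition smallest_restricted_eigenvalue ::
  "('n \<Rightarrow> real) \<Rightarrow> real \<Rightarrow> 'n set \<Rightarrow> ('d::finite, 'n::finite) config \<Rightarrow> real \<Rightarrow> bool" where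
  "smallest_restricted_eigenvalue m \<alpha> K s \<mu> \<longleftrightarrow>
     restricted_eigenvalue m \<alpha> K s \<mu> \<and> (\<forall>\<nu>. restricted_eigenvalue m \<alpha> K s \<nu> \<longrightarrow> \<mu> \<le> \<nu>)"

definition smooth :: "(real \<Rightarrow> 'a::real_normed_vector) \<Rightarrow> bool" where
  "smooth f \<longleftrightarrow>
     (\<exists>D :: nat \<Rightarrow> real \<Rightarrow> 'a. D 0 = f \<and>
        (\<forall>n t. (D n has_vector_derivative D (Suc n) t) (at t)))"

text \<open>
  Smooth functions with compact support in the open set \<open>S\<close>, extended by \<open>0\<close> to the real line.
\<close>

definition test_function :: "real set \<Rightarrow> (real \<Rightarrow> 'a::real_normed_vector) \<Rightarrow> bool" where
  "test_function S \<phi> \<longleftrightarrow>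
     smooth \<phi> \<and> (\<exists>C. compact C \<and> C \<subseteq> S \<and> (\<forall>t. t \<notin> C \<longrightarrow> \<phi> t = 0))"

definition square_integrable :: "real set \<Rightarrow> (real \<Rightarrow> 'a::euclidean_space) \<Rightarrow> bool" where
  "square_integrable S f \<longleftrightarrow>
     set_borel_measurable lborel S f \<and> set_integrable lborel S (\<lambda>t. (norm (f t))\<^sup>2)"

definition H1_path :: "'a::euclidean_space set \<Rightarrow> (real \<Rightarrow> 'a) \<Rightarrow> bool" where
  "H1_path V x \<longleftrightarrow>
     (AE t in lborel. t \<in> {0<..<1} \<longrightarrow> x t \<in> V) \<and>
     square_integrable {0<..<1} x \<and>
     (\<exists>g. square_integrable {0<..<1} g \<and>
        (\<forall>\<phi> :: real \<Rightarrow> real. test_function {0<..<1} \<phi> \<longrightarrow>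
           (LINT t:{0<..<1}|lborel. deriv \<phi> t *\<^sub>R x t) =
             - (LINT t:{0<..<1}|lborel. \<phi> t *\<^sub>R g t)))"

definition action :: "('n \<Rightarrow> real) \<Rightarrow> real \<Rightarrow> (real \<Rightarrow> ('d::finite, 'n::finite) config) \<Rightarrow> ennreal" where
  "action m \<alpha> x =
     (\<integral>\<^sup>+t\<in>{0<..<1}. ennreal (1/2 * (mass_norm m (vector_derivative x (at t)))\<^sup>2) \<partial>lborel) +
     (\<integral>\<^sup>+t\<in>{0<..<1}. ennreal (potential m \<alpha> UNIV (x t)) \<partial>lborel)"

definition one_collision_solution ::
  "('n \<Rightarrow> real) \<Rightarrow> real \<Rightarrow> (real \<Rightarrow> ('d::finite, 'n::finite) config) \<Rightarrow> bool" where
  "one_collision_solution m \<alpha> x \<longleftrightarrow>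
     continuous_on {0..1} x \<and>
     (\<forall>t\<in>{0..1}. x t \<in> collision_set UNIV \<longleftrightarrow> t = 1) \<and>
     (\<exists>v a. continuous_on {0<..<1} a \<and>
        (\<forall>t\<in>{0<..<1}. (x has_vector_derivative v t) (at t) \<and>
           (v has_vector_derivative a t) (at t) \<and>
           GDERIV (potential m \<alpha> UNIV) (x t) :> mass_mult m (a t))) \<and>
     action m \<alpha> x < \<infinity>"

text \<open>
  A cluster has at least two bodies: for a single body \<open>r\<close> would vanish identically.
\<close>

definition colliding_cluster :: "(real \<Rightarrow> ('d::finite, 'n::finite) config) \<Rightarrow> 'n set \<Rightarrow> bool" where
  "colliding_cluster x K \<longleftrightarrow>
     2 \<le> card K \<and>
     (\<forall>i\<in>K. \<forall>j\<in>K. x 1 $ i = x 1 $ j) \<and>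
     (\<forall>i\<in>K. \<forall>j. j \<notin> K \<longrightarrow> x 1 $ i \<noteq> x 1 $ j)"

definition centre_of_mass ::
  "('n \<Rightarrow> real) \<Rightarrow> 'n set \<Rightarrow> ('d::finite, 'n::finite) config \<Rightarrow> real ^ 'd" where
  "centre_of_mass m K y = (\<Sum>i\<in>K. m i *\<^sub>R y $ i) /\<^sub>R (\<Sum>i\<in>K. m i)"

text \<open>
  \<open>relative_path\<close> gives the positions of all bodies measured from the centre of mass of \<open>K\<close>;
  \<open>cluster_path\<close> keeps only the bodies of \<open>K\<close>.
\<close>

definition relative_path ::
  "('n \<Rightarrow> real) \<Rightarrow> 'n set \<Rightarrow> (real \<Rightarrow> ('d::finite, 'n::finite) config) \<Rightarrow> real \<Rightarrow> ('d, 'n) config" where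
  "relative_path m K x t = (\<chi> i. x t $ i - centre_of_mass m K (x t))"

definition cluster_path ::
  "('n \<Rightarrow> real) \<Rightarrow> 'n set \<Rightarrow> (real \<Rightarrow> ('d::finite, 'n::finite) config) \<Rightarrow> real \<Rightarrow> ('d, 'n) config" where
  "cluster_path m K x t = (\<chi> i. if i \<in> K then relative_path m K x t $ i else 0)"

definition cluster_radius ::
  "('n \<Rightarrow> real) \<Rightarrow> 'n set \<Rightarrow> (real \<Rightarrow> ('d::finite, 'n::finite) config) \<Rightarrow> real \<Rightarrow> real" where
  "cluster_radius m K x t = mass_norm m (cluster_path m K x t)"

text \<open>
  The new time \<open>\<tau>\<close> as a function of \<open>t\<close>, that is \<open>d\<tau> = r powr (- (2 + \<alpha>) / 2) dt\<close>, and its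
  inverse, from which the variables \<open>\<rho>\<close> and \<open>s\<close> are obtained as functions of \<open>\<tau>\<close>.
\<close>

definition new_time ::
  "('n \<Rightarrow> real) \<Rightarrow> real \<Rightarrow> 'n set \<Rightarrow> (real \<Rightarrow> ('d::finite, 'n::finite) config) \<Rightarrow> real \<Rightarrow> real" where
  "new_time m \<alpha> K x t = integral {0..t} (\<lambda>u. cluster_radius m K x u powr (- (2 + \<alpha>) / 2))"

definition old_time ::
  "('n \<Rightarrow> real) \<Rightarrow> real \<Rightarrow> 'n set \<Rightarrow> (real \<Rightarrow> ('d::finite, 'n::finite) config) \<Rightarrow> real \<Rightarrow> real" where
  "old_time m \<alpha> K x = inv_into {0..<1} (new_time m \<alpha> K x)"

definition rho_var ::
  "('n \<Rightarrow> real) \<Rightarrow> real \<Rightarrow> 'n set \<Rightarrow> (real \<Rightarrow> ('d::finite, 'n::finite) config) \<Rightarrow> real \<Rightarrow> real" where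
  "rho_var m \<alpha> K x \<tau> = cluster_radius m K x (old_time m \<alpha> K x \<tau>) powr ((2 - \<alpha>) / 4)"

definition s_var ::
  "('n \<Rightarrow> real) \<Rightarrow> real \<Rightarrow> 'n set \<Rightarrow> (real \<Rightarrow> ('d::finite, 'n::finite) config) \<Rightarrow> real \<Rightarrow> ('d, 'n) config" where
  "s_var m \<alpha> K x \<tau> =
     cluster_path m K x (old_time m \<alpha> K x \<tau>) /\<^sub>R cluster_radius m K x (old_time m \<alpha> K x \<tau>)"

text \<open>
  The potential of the bodies outside \<open>K\<close>, whose motion is given by \<open>q\<close>.
\<close>

definition external_potential ::
  "('n \<Rightarrow> real) \<Rightarrow> real \<Rightarrow> 'n set \<Rightarrow> (real \<Rightarrow> ('d::finite, 'n::finite) config) \<Rightarrow>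
     real \<Rightarrow> ('d, 'n) config \<Rightarrow> real" where
  "external_potential m \<alpha> K q t y =
     1/2 * (\<Sum>i\<in>K. \<Sum>j\<in>- K. m i * m j / norm (q t $ j - y $ i) powr \<alpha>)"

text \<open>
  The second derivative in \<open>s\<close> of the action
  \<open>\<integral> 1/2 (4/(2-\<alpha>))\<^sup>2 (\<rho>')\<^sup>2 + \<rho>\<^sup>2 (1/2 |s'|\<^sup>2 + U(s) + \<rho> powr (4\<alpha>/(2-\<alpha>)) W) d\<tau>\<close>
  along a compactly supported \<open>v\<close> tangent along \<open>s\<close>; the integral of \<open>\<rho> powr \<beta>\<close>, with
  \<open>\<beta> = 2(2+\<alpha>)/(2-\<alpha>)\<close>, is the original time, and \<open>\<rho> powr (4/(2-\<alpha>)) s\<close> is the cluster path.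
\<close>

definition second_variation ::
  "('n \<Rightarrow> real) \<Rightarrow> real \<Rightarrow> 'n set \<Rightarrow> (real \<Rightarrow> ('d::finite, 'n::finite) config) \<Rightarrow>
     (real \<Rightarrow> real) \<Rightarrow> (real \<Rightarrow> ('d, 'n) config) \<Rightarrow> (real \<Rightarrow> ('d, 'n) config) \<Rightarrow> real" where
  "second_variation m \<alpha> K q \<rho> s v =
     (LINT \<tau>:{0..}|lborel.
        (\<rho> \<tau>)\<^sup>2 * ((mass_norm m (vector_derivative v (at \<tau>)))\<^sup>2 +
                    restricted_hessian m \<alpha> K (s \<tau>) (v \<tau>) (v \<tau>)) +
        \<rho> \<tau> powr (2 * ((6 + \<alpha>) / (2 - \<alpha>))) *
          hessian
            (external_potential m \<alpha> K q
               (integral {0..\<tau>} (\<lambda>\<sigma>. \<rho> \<sigma> powr (2 * (2 + \<alpha>) / (2 - \<alpha>)))))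
            (\<rho> \<tau> powr (4 / (2 - \<alpha>)) *\<^sub>R s \<tau>) (v \<tau>) (v \<tau>))"

definition collision_morse_index ::
  "('n \<Rightarrow> real) \<Rightarrow> real \<Rightarrow> 'n set \<Rightarrow> (real \<Rightarrow> ('d::finite, 'n::finite) config) \<Rightarrow>
     (real \<Rightarrow> real) \<Rightarrow> (real \<Rightarrow> ('d, 'n) config) \<Rightarrow> enat" where
  "collision_morse_index m \<alpha> K q \<rho> s =
     Sup {enat k | k. \<exists>\<psi> :: nat \<Rightarrow> real \<Rightarrow> ('d, 'n) config.
       (\<forall>i<k. test_function {0<..} (\<psi> i) \<and> (\<forall>\<tau>>0. \<psi> i \<tau> \<in> tangent_space m K (s \<tau>))) \<and>
       (\<forall>c :: nat \<Rightarrow> real. (\<lambda>\<tau>. \<Sum>i<k. c i *\<^sub>R \<psi> i \<tau>) = (\<lambda>\<tau>. 0) \<longrightarrow> (\<forall>i<k. c i = 0)) \<and>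
       (\<forall>c :: nat \<Rightarrow> real. (\<lambda>\<tau>. \<Sum>i<k. c i *\<^sub>R \<psi> i \<tau>) \<noteq> (\<lambda>\<tau>. 0) \<longrightarrow>
          second_variation m \<alpha> K q \<rho> s (\<lambda>\<tau>. \<Sum>i<k. c i *\<^sub>R \<psi> i \<tau>) < 0)}"

end

theory Submission
  imports Defs
begin

text \<open>
  The second variation is computed on fields \<open>v = (\<omega> / \<rho>) E\<close>, where \<open>\<omega>\<close> is a scalar function of compact
  support and \<open>E\<close> is the projection to the tangent space at \<open>s(\<tau>)\<close> of a fixed eigenvector \<open>e\<close> of
  the restricted Hessian at \<open>s0\<close> with eigenvalue \<open>\<mu>1\<close>. Its integrand is a quadratic form in \<open>(\<omega>, \<omega>')\<close>.
  If \<open>s' \<rightarrow> 0\<close> and \<open>\<rho>' / \<rho> \<rightarrow> - \<kappa>\<close> with \<open>\<kappa> = (2 - \<alpha>) / 4 * sqrt (2 U(s0))\<close>, then the coefficients of this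
  form converge, for a unit vector \<open>e\<close>, to those of \<open>\<omega>'\<^sup>2 + 2 \<kappa> \<omega> \<omega>' + (\<kappa>\<^sup>2 + \<mu>1) \<omega>\<^sup>2\<close>. The mixed term
  integrates to \<open>0\<close>, and \<open>\<kappa>\<^sup>2 + \<mu>1 < 0\<close> is exactly the hypothesis on \<open>\<mu>1\<close>, since
  \<open>\<kappa>\<^sup>2 = (2 - \<alpha>)\<^sup>2 / 8 * U(s0)\<close>. So every sufficiently stretched bump \<open>\<omega>\<close>, placed late enough, gives a
  negative direction, and bumps with disjoint supports span negative spaces of any dimension
  (\<open>quad_eventually_le\<close>, \<open>profile_form_bump_negative\<close>, \<open>morse_index_ge\<close>).

  The two limits come from the energy of the cluster. Only the bounded forces of the bodies outside
  the cluster change that energy, and the velocities are square integrable because the action is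
  finite, so the energy \<open>h\<close> is bounded (\<open>energy_bound\<close>). With primes for derivatives in
  the new time and \<open>p = r' / r\<close>, conservation of energy reads
  \<open>p\<^sup>2 + |s'|\<^sup>2 = 2 U(s) + 2 r powr \<alpha> h\<close> (\<open>s_rate_norm\<close>), and the Lagrange-Jacobi identity reads
  \<open>p' = (1 - \<alpha>/2) (2 U(s) - p\<^sup>2) + o(1)\<close> (\<open>deriv_p\<close>). The two together bound
  \<open>p'\<close> from below, so \<open>r\<close> cannot vanish in a finite new time, and the collision takes place at infinite
  new time (\<open>\<Theta>_unbounded\<close>). As \<open>U(s) \<rightarrow> U(s0)\<close>, the limiting equation for \<open>p\<close> has the stable
  equilibrium \<open>sqrt (2 U(s0))\<close> and the unstable one \<open>- sqrt (2 U(s0))\<close>; a solution that leaves the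
  unstable one would make \<open>r\<close> grow, so \<open>p \<rightarrow> - sqrt (2 U(s0))\<close> (\<open>tendsto_unstable_equilibrium\<close>,
  \<open>p_tendsto\<close>), and then \<open>s' \<rightarrow> 0\<close> by the energy identity (\<open>s_rate_tendsto\<close>).

  The fields have to be infinitely differentiable. This follows from the equation of motion, which
  improves the differentiability of \<open>x\<close> step by step (\<open>times_differentiable_x_v\<close>), and likewise from the
  differential equation of the time change (\<open>times_differentiable_\<theta>\<close>).
\<close>

section \<open>The mass inner product\<close>

lemma bounded_linear_mass_mult: "bounded_linear (mass_mult m)"
  unfolding linear_conv_bounded_linear[symmetric] mass_mult_def
  by (rule linearI) (simp_all add: vec_eq_iff algebra_simps)

lemma bounded_bilinear_mass_inner: "bounded_bilinear (mass_inner m)"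
  unfolding mass_inner_def[abs_def]
  by (rule bounded_bilinear.comp[OF bounded_bilinear_inner bounded_linear_mass_mult
        bounded_linear_ident])

lemmas mass_inner_simps =
  bounded_bilinear.add_left[OF bounded_bilinear_mass_inner]
  bounded_bilinear.add_right[OF bounded_bilinear_mass_inner]
  bounded_bilinear.diff_left[OF bounded_bilinear_mass_inner]
  bounded_bilinear.diff_right[OF bounded_bilinear_mass_inner]
  bounded_bilinear.minus_left[OF bounded_bilinear_mass_inner]
  bounded_bilinear.minus_right[OF bounded_bilinear_mass_inner]
  bounded_bilinear.scaleR_left[OF bounded_bilinear_mass_inner]
  bounded_bilinear.scaleR_right[OF bounded_bilinear_mass_inner]
  bounded_bilinear.zero_left[OF bounded_bilinear_mass_inner]
  bounded_bilinear.zero_right[OF bounded_bilinear_mass_inner]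

lemmas tendsto_mass_inner [tendsto_intros] = bounded_bilinear.tendsto[OF bounded_bilinear_mass_inner]
lemmas continuous_on_mass_inner [continuous_intros] =
  bounded_bilinear.continuous_on[OF bounded_bilinear_mass_inner]

lemma mass_inner_sum: "mass_inner m u v = (\<Sum>i\<in>UNIV. m i * (u $ i \<bullet> v $ i))"
  unfolding mass_inner_def mass_mult_def by (subst inner_vec_def) simp

lemma mass_inner_commute: "mass_inner m u v = mass_inner m v u"
  by (simp add: mass_inner_sum inner_commute)

lemma mass_inner_nonneg: "(\<And>i. 0 < m i) \<Longrightarrow> 0 \<le> mass_inner m v v"
  unfolding mass_inner_sum by (intro sum_nonneg mult_nonneg_nonneg) (auto intro: less_imp_le)

lemma mass_norm_power2: "(\<And>i. 0 < m i) \<Longrightarrow> (mass_norm m v)\<^sup>2 = mass_inner m v v"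
  by (simp add: mass_norm_def inertia_def mass_inner_nonneg)

lemma norm_le_mass_inner:
  fixes m :: "'n::finite \<Rightarrow> real"
  assumes "\<And>i. 0 < m i"
  shows "\<exists>C>0. \<forall>v :: real ^ 'd::finite ^ 'n. (norm v)\<^sup>2 \<le> C * mass_inner m v v"
proof (intro exI conjI allI)
  define \<mu> where "\<mu> = Min (range m)"
  have \<mu>: "0 < \<mu>" "\<And>i. \<mu> \<le> m i"
    using assms by (auto simp: \<mu>_def Min_gr_iff)
  show "0 < 1 / \<mu>" using \<mu> by simp
  fix v :: "real ^ 'd ^ 'n"
  have "\<mu> * (norm v)\<^sup>2 = (\<Sum>i\<in>UNIV. \<mu> * (v $ i \<bullet> v $ i))"
    by (simp add: power2_norm_eq_inner inner_vec_def sum_distrib_left)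
  also have "\<dots> \<le> mass_inner m v v"
    unfolding mass_inner_sum by (intro sum_mono mult_right_mono \<mu>) simp
  finally show "(norm v)\<^sup>2 \<le> 1 / \<mu> * mass_inner m v v"
    using \<mu> by (simp add: field_simps)
qed

lemma mass_inner_pos:
  fixes v :: "real ^ 'd::finite ^ 'n::finite"
  assumes "\<And>i. 0 < m i" "v \<noteq> 0"
  shows "0 < mass_inner m v v"
proof -
  obtain C where "0 < C" "(norm v)\<^sup>2 \<le> C * mass_inner m v v"
    using norm_le_mass_inner[of m] assms(1) by blast
  moreover have "0 < (norm v)\<^sup>2" using assms(2) by simp
  ultimately show ?thesis by (metis order_less_le_trans zero_less_mult_pos)
qed

lemma centred_space_scaleR: "u \<in> centred_space m K \<Longrightarrow> c *\<^sub>R u \<in> centred_space m K"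
proof -
  have "(\<Sum>i\<in>K. m i *\<^sub>R (c *\<^sub>R u) $ i) = c *\<^sub>R (\<Sum>i\<in>K. m i *\<^sub>R u $ i)"
    by (simp add: scaleR_sum_right mult.commute)
  then show "u \<in> centred_space m K \<Longrightarrow> c *\<^sub>R u \<in> centred_space m K"
    by (simp add: centred_space_def)
qed

lemma centred_space_diff:
  "u \<in> centred_space m K \<Longrightarrow> z \<in> centred_space m K \<Longrightarrow> u - z \<in> centred_space m K"
  by (simp add: centred_space_def scaleR_diff_right sum_subtractf)

lemma tangent_space_scaleR: "u \<in> tangent_space m K q \<Longrightarrow> c *\<^sub>R u \<in> tangent_space m K q"
  by (simp add: tangent_space_def centred_space_scaleR mass_inner_simps)

section \<open>Derivatives of sums of powers of distances\<close>

lemma norm_powr_eq_inner_powr: "norm z powr p = (z \<bullet> z) powr (p / 2)"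
proof (cases "z = 0")
  case False
  then have "norm z > 0" by simp
  then show ?thesis
    by (simp add: power2_norm_eq_inner[symmetric] powr_powr flip: powr_numeral)
qed simp

lemma has_derivative_norm_powr:
  fixes z :: "'a::euclidean_space"
  assumes "z \<noteq> 0"
  shows "((\<lambda>z. norm z powr p) has_derivative (\<lambda>h. p * norm z powr (p - 2) * (z \<bullet> h))) (at z)"
proof -
  have pos: "0 < z \<bullet> z" using assms by simp
  have "((\<lambda>x. x powr (p / 2)) has_derivative (*) (p / 2 * (z \<bullet> z) powr (p / 2 - 1))) (at (z \<bullet> z))"
    using has_real_derivative_powr[OF pos, of "p / 2"] unfolding has_field_derivative_def .
  moreover have "((\<lambda>z. z \<bullet> z) has_derivative (\<lambda>h. 2 * (z \<bullet> h))) (at z)"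
    by (auto intro!: derivative_eq_intros simp: inner_commute)
  ultimately have "((\<lambda>z. (z \<bullet> z) powr (p / 2)) has_derivative
      (\<lambda>h. p / 2 * (z \<bullet> z) powr (p / 2 - 1) * (2 * (z \<bullet> h)))) (at z)"
    by (rule has_derivative_compose[rotated])
  moreover have "(z \<bullet> z) powr (p / 2 - 1) = norm z powr (p - 2)"
    by (simp add: norm_powr_eq_inner_powr diff_divide_distrib)
  ultimately show ?thesis by (simp add: norm_powr_eq_inner_powr mult.assoc)
qed

text \<open>The second derivative of \<open>z \<mapsto> norm z powr p\<close> at \<open>z \<noteq> 0\<close>.\<close>

definition powr_hess :: "real \<Rightarrow> 'a::real_inner \<Rightarrow> 'a \<Rightarrow> 'a \<Rightarrow> real" where
  "powr_hess p z a b =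
     p * ((p - 2) * norm z powr (p - 4) * (z \<bullet> b) * (z \<bullet> a) + norm z powr (p - 2) * (b \<bullet> a))"

lemma powr_hess_bound:
  fixes z a :: "'a::real_inner"
  assumes "z \<noteq> 0"
  shows "\<bar>powr_hess p z a a\<bar> \<le> \<bar>p\<bar> * (\<bar>p - 2\<bar> + 1) * norm z powr (p - 2) * (norm a)\<^sup>2"
proof -
  have z: "norm z powr (p - 4) * (norm z)\<^sup>2 = norm z powr (p - 2)"
    using assms by (simp flip: powr_numeral powr_add)
  have "\<bar>p - 2\<bar> * norm z powr (p - 4) * (\<bar>z \<bullet> a\<bar> * \<bar>z \<bullet> a\<bar>)
      \<le> \<bar>p - 2\<bar> * norm z powr (p - 4) * ((norm z * norm a) * (norm z * norm a))"
    by (intro mult_left_mono mult_mono Cauchy_Schwarz_ineq2) auto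
  then have "\<bar>(p - 2) * norm z powr (p - 4) * (z \<bullet> a) * (z \<bullet> a)\<bar>
      \<le> \<bar>p - 2\<bar> * norm z powr (p - 4) * ((norm z)\<^sup>2 * (norm a)\<^sup>2)"
    by (simp only: abs_mult powr_ge_zero abs_of_nonneg power2_eq_square mult_ac)
  also have "\<dots> = \<bar>p - 2\<bar> * norm z powr (p - 2) * (norm a)\<^sup>2"
    by (simp flip: z)
  finally have "\<bar>(p - 2) * norm z powr (p - 4) * (z \<bullet> a) * (z \<bullet> a) + norm z powr (p - 2) * (a \<bullet> a)\<bar>
      \<le> \<bar>p - 2\<bar> * norm z powr (p - 2) * (norm a)\<^sup>2 + norm z powr (p - 2) * (norm a)\<^sup>2"
    by (intro order_trans[OF abs_triangle_ineq] add_mono) (simp_all add: power2_norm_eq_inner)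
  also have "\<dots> = (\<bar>p - 2\<bar> + 1) * norm z powr (p - 2) * (norm a)\<^sup>2" by (simp add: algebra_simps)
  finally show ?thesis
    unfolding powr_hess_def abs_mult[of p] mult.assoc by (intro mult_left_mono) (auto simp: mult_ac)
qed

lemma continuous_on_powr_hess:
  fixes z a b :: "real \<Rightarrow> 'b::euclidean_space"
  assumes "continuous_on S z" "continuous_on S a" "continuous_on S b" "\<And>t. t \<in> S \<Longrightarrow> z t \<noteq> 0"
  shows "continuous_on S (\<lambda>t. powr_hess q (z t) (a t) (b t))"
  unfolding powr_hess_def using assms by (intro continuous_intros) auto

lemma tendsto_powr_hess:
  fixes z a b :: "'c \<Rightarrow> 'b::euclidean_space"
  assumes "(z \<longlongrightarrow> z0) F" "(a \<longlongrightarrow> a0) F" "(b \<longlongrightarrow> b0) F" "z0 \<noteq> 0"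
  shows "((\<lambda>t. powr_hess q (z t) (a t) (b t)) \<longlongrightarrow> powr_hess q z0 a0 b0) F"
  unfolding powr_hess_def using assms by (intro tendsto_intros) auto

lemma has_derivative_sum_norm_powr:
  fixes L :: "'i \<Rightarrow> 'a::euclidean_space \<Rightarrow> 'b::euclidean_space"
  assumes "\<And>a. bounded_linear (L a)" "\<And>a. a \<in> A \<Longrightarrow> L a y + b a \<noteq> 0"
  shows "((\<lambda>y. \<Sum>a\<in>A. c a * norm (L a y + b a) powr p) has_derivative
    (\<lambda>u. \<Sum>a\<in>A. c a * (p * norm (L a y + b a) powr (p - 2) * ((L a y + b a) \<bullet> L a u)))) (at y)"
proof (rule has_derivative_sum)
  fix a assume "a \<in> A"
  have "((\<lambda>y. L a y + b a) has_derivative L a) (at y)"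
    using bounded_linear.has_derivative[OF assms(1) has_derivative_ident]
    by (auto intro!: derivative_eq_intros)
  from has_derivative_compose[OF this has_derivative_norm_powr[OF assms(2)[OF \<open>a \<in> A\<close>]]]
  show "((\<lambda>y. c a * norm (L a y + b a) powr p) has_derivative
     (\<lambda>u. c a * (p * norm (L a y + b a) powr (p - 2) * ((L a y + b a) \<bullet> L a u)))) (at y)"
    by (rule has_derivative_mult_right)
qed

text \<open>The potentials of the system are sums of powers of norms of affine functions.\<close>

lemma hessian_sum_norm_powr:
  fixes L :: "'i \<Rightarrow> 'a::euclidean_space \<Rightarrow> 'b::euclidean_space"
  assumes "\<And>a. bounded_linear (L a)" "\<And>a. a \<in> A \<Longrightarrow> L a y + b a \<noteq> 0" "finite A"
  shows "hessian (\<lambda>y. \<Sum>a\<in>A. c a * norm (L a y + b a) powr p) y u v =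
    (\<Sum>a\<in>A. c a * powr_hess p (L a y + b a) (L a u) (L a v))"
proof -
  define S where "S = (\<Inter>a\<in>A. {y. L a y + b a \<noteq> 0})"
  have cont: "continuous_on UNIV (\<lambda>y. L a y + b a)" for a
    by (intro continuous_intros linear_continuous_on assms)
  have "open S"
    unfolding S_def by (intro open_INT assms(3) ballI open_Collect_neq cont continuous_intros)
  have "y \<in> S" using assms(2) by (auto simp: S_def)
  define F where "F y = (\<Sum>a\<in>A. c a * (p * norm (L a y + b a) powr (p - 2) *
      ((L a y + b a) \<bullet> L a u)))" for y
  have F: "frechet_derivative (\<lambda>y. \<Sum>a\<in>A. c a * norm (L a y + b a) powr p) (at y) u = F y"
    if "y \<in> S" for y
    unfolding F_def
    by (subst frechet_derivative_at[OF has_derivative_sum_norm_powr, symmetric])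
      (use that assms(1) in \<open>auto simp: S_def\<close>)
  have "(F has_derivative (\<lambda>v. \<Sum>a\<in>A. c a * powr_hess p (L a y + b a) (L a u) (L a v))) (at y)"
    unfolding F_def[abs_def]
  proof (rule has_derivative_sum)
    fix a assume "a \<in> A"
    have z: "((\<lambda>y. L a y + b a) has_derivative L a) (at y)"
      using bounded_linear.has_derivative[OF assms(1) has_derivative_ident]
      by (auto intro!: derivative_eq_intros)
    have "((\<lambda>y. norm (L a y + b a) powr (p - 2) * ((L a y + b a) \<bullet> L a u)) has_derivative
       (\<lambda>v. norm (L a y + b a) powr (p - 2) * (L a v \<bullet> L a u) +
         (p - 2) * norm (L a y + b a) powr (p - 2 - 2) * ((L a y + b a) \<bullet> L a v) *
         ((L a y + b a) \<bullet> L a u))) (at y)"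
      by (rule has_derivative_mult has_derivative_inner_left z
          has_derivative_compose[OF z has_derivative_norm_powr] assms(2) \<open>a \<in> A\<close>)+
    then have "((\<lambda>y. c a * (p * (norm (L a y + b a) powr (p - 2) * ((L a y + b a) \<bullet> L a u))))
        has_derivative (\<lambda>v. c a * (p * (norm (L a y + b a) powr (p - 2) * (L a v \<bullet> L a u) +
         (p - 2) * norm (L a y + b a) powr (p - 2 - 2) * ((L a y + b a) \<bullet> L a v) *
         ((L a y + b a) \<bullet> L a u))))) (at y)"
      by (intro has_derivative_mult_right)
    then show "((\<lambda>y. c a * (p * norm (L a y + b a) powr (p - 2) * ((L a y + b a) \<bullet> L a u)))
        has_derivative (\<lambda>v. c a * powr_hess p (L a y + b a) (L a u) (L a v))) (at y)"
      by (simp add: powr_hess_def mult.assoc add.commute)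
  qed
  then have "((\<lambda>y. frechet_derivative (\<lambda>y. \<Sum>a\<in>A. c a * norm (L a y + b a) powr p) (at y) u)
      has_derivative (\<lambda>v. \<Sum>a\<in>A. c a * powr_hess p (L a y + b a) (L a u) (L a v))) (at y)"
    by (rule has_derivative_transform_within_open[OF _ \<open>open S\<close> \<open>y \<in> S\<close>]) (simp add: F)
  from frechet_derivative_at[OF this, symmetric] show ?thesis unfolding hessian_def by simp
qed

section \<open>The potential of a set of bodies\<close>

lemma not_collisionD:
  "y \<notin> collision_set K \<Longrightarrow> i \<in> K \<Longrightarrow> j \<in> K \<Longrightarrow> i \<noteq> j \<Longrightarrow> y $ i \<noteq> y $ j"
  by (auto simp: collision_set_def)

text \<open>The derivative of the potential in the direction \<open>u\<close>, at a configuration \<open>y\<close> without collisions.\<close>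

definition potential_deriv :: "('n \<Rightarrow> real) \<Rightarrow> real \<Rightarrow> 'n set \<Rightarrow> ('d::finite, 'n::finite) config \<Rightarrow>
    ('d, 'n) config \<Rightarrow> real" where
  "potential_deriv m \<alpha> K y u = - (\<alpha> / 2) * (\<Sum>i\<in>K. \<Sum>j\<in>K - {i}.
     m i * m j * norm (y $ i - y $ j) powr (- \<alpha> - 2) * ((y $ i - y $ j) \<bullet> (u $ i - u $ j)))"

lemma potential_sum_pairs:
  "potential m \<alpha> K y = (\<Sum>(i, j)\<in>Sigma K (\<lambda>i. K - {i}).
     (m i * m j / 2) * norm (y $ i - y $ j) powr (- \<alpha>))"
  unfolding potential_def by (simp add: sum.Sigma[symmetric] sum_distrib_left)

lemma bounded_linear_component_diff:
  "bounded_linear (\<lambda>y :: real ^ 'd::finite ^ 'n::finite. y $ i - y $ j)"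
  by (intro bounded_linear_sub bounded_linear_vec_nth)

lemma has_derivative_potential:
  fixes y :: "('d::finite, 'n::finite) config"
  assumes "y \<notin> collision_set K"
  shows "(potential m \<alpha> K has_derivative potential_deriv m \<alpha> K y) (at y)"
proof -
  have "((\<lambda>y :: ('d, 'n) config. \<Sum>a\<in>Sigma K (\<lambda>i. K - {i}). (m (fst a) * m (snd a) / 2) *
      norm ((y $ fst a - y $ snd a) + 0) powr (- \<alpha>)) has_derivative
    (\<lambda>u. \<Sum>a\<in>Sigma K (\<lambda>i. K - {i}). (m (fst a) * m (snd a) / 2) *
      (- \<alpha> * norm ((y $ fst a - y $ snd a) + 0) powr (- \<alpha> - 2) *
        (((y $ fst a - y $ snd a) + 0) \<bullet> (u $ fst a - u $ snd a))))) (at y)"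
    by (rule has_derivative_sum_norm_powr)
      (use assms bounded_linear_component_diff in \<open>auto dest: not_collisionD\<close>)
  moreover have "(\<lambda>y :: ('d, 'n) config. \<Sum>a\<in>Sigma K (\<lambda>i. K - {i}). (m (fst a) * m (snd a) / 2) *
      norm ((y $ fst a - y $ snd a) + 0) powr (- \<alpha>)) = potential m \<alpha> K"
    by (simp add: potential_sum_pairs fun_eq_iff case_prod_unfold)
  moreover have "(\<lambda>u. \<Sum>a\<in>Sigma K (\<lambda>i. K - {i}). (m (fst a) * m (snd a) / 2) *
      (- \<alpha> * norm ((y $ fst a - y $ snd a) + 0) powr (- \<alpha> - 2) *
        (((y $ fst a - y $ snd a) + 0) \<bullet> (u $ fst a - u $ snd a)))) = potential_deriv m \<alpha> K y"
    by (simp add: potential_deriv_def fun_eq_iff sum.Sigma case_prod_unfold sum_distrib_left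
        sum_negf mult_ac)
  ultimately show ?thesis by simp
qed

lemma hessian_potential:
  fixes y :: "('d::finite, 'n::finite) config"
  assumes "y \<notin> collision_set K"
  shows "hessian (potential m \<alpha> K) y u v = (\<Sum>i\<in>K. \<Sum>j\<in>K - {i}.
    (m i * m j / 2) * powr_hess (- \<alpha>) (y $ i - y $ j) (u $ i - u $ j) (v $ i - v $ j))"
proof -
  have "hessian (\<lambda>y :: ('d, 'n) config. \<Sum>a\<in>Sigma K (\<lambda>i. K - {i}). (m (fst a) * m (snd a) / 2) *
      norm ((y $ fst a - y $ snd a) + 0) powr (- \<alpha>)) y u v =
    (\<Sum>a\<in>Sigma K (\<lambda>i. K - {i}). (m (fst a) * m (snd a) / 2) *
      powr_hess (- \<alpha>) ((y $ fst a - y $ snd a) + 0) (u $ fst a - u $ snd a) (v $ fst a - v $ snd a))"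
    by (rule hessian_sum_norm_powr)
      (use assms bounded_linear_component_diff in \<open>auto dest: not_collisionD\<close>)
  moreover have "(\<lambda>y :: ('d, 'n) config. \<Sum>a\<in>Sigma K (\<lambda>i. K - {i}). (m (fst a) * m (snd a) / 2) *
      norm ((y $ fst a - y $ snd a) + 0) powr (- \<alpha>)) = potential m \<alpha> K"
    by (simp add: potential_sum_pairs fun_eq_iff case_prod_unfold)
  ultimately show ?thesis by (simp add: sum.Sigma case_prod_unfold)
qed

lemma hessian_external_potential:
  fixes y :: "('d::finite, 'n::finite) config"
  assumes "\<And>i j. i \<in> K \<Longrightarrow> j \<notin> K \<Longrightarrow> q t $ j \<noteq> y $ i"
  shows "hessian (external_potential m \<alpha> K q t) y u v = (\<Sum>i\<in>K. \<Sum>j\<in>- K.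
    (m i * m j / 2) * powr_hess (- \<alpha>) (q t $ j - y $ i) (u $ i) (v $ i))"
proof -
  have "hessian (\<lambda>y :: ('d, 'n) config. \<Sum>a\<in>K \<times> - K. (m (fst a) * m (snd a) / 2) *
      norm (- (y $ fst a) + q t $ snd a) powr (- \<alpha>)) y u v =
    (\<Sum>a\<in>K \<times> - K. (m (fst a) * m (snd a) / 2) *
      powr_hess (- \<alpha>) (- (y $ fst a) + q t $ snd a) (- (u $ fst a)) (- (v $ fst a)))"
    by (rule hessian_sum_norm_powr)
      (use assms in \<open>auto intro!: bounded_linear_minus bounded_linear_vec_nth\<close>)
  moreover have "(\<lambda>y :: ('d, 'n) config. \<Sum>a\<in>K \<times> - K. (m (fst a) * m (snd a) / 2) *
      norm (- (y $ fst a) + q t $ snd a) powr (- \<alpha>)) = external_potential m \<alpha> K q t"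
    unfolding external_potential_def sum.cartesian_product sum_distrib_left case_prod_unfold
    by (intro ext sum.cong refl) (simp add: powr_minus_divide)
  ultimately show ?thesis
    by (simp add: sum.cartesian_product case_prod_unfold powr_hess_def add.commute)
qed

text \<open>The potential is homogeneous of degree \<open>- \<alpha>\<close>.\<close>

lemma potential_scaleR:
  assumes "0 < c"
  shows "potential m \<alpha> K (c *\<^sub>R y) = c powr (- \<alpha>) * potential m \<alpha> K y"
proof -
  have "norm (c *\<^sub>R y $ i - c *\<^sub>R y $ j) = c * norm (y $ i - y $ j)" for i j
    using assms by (simp flip: scaleR_diff_right)
  then show ?thesis
    unfolding potential_def using assms
    by (simp add: powr_mult sum_distrib_left mult_ac)
qed

text \<open>The identity of Euler for homogeneous functions.\<close>

lemma potential_deriv_self: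
  assumes "y \<notin> collision_set K"
  shows "potential_deriv m \<alpha> K y y = - \<alpha> * potential m \<alpha> K y"
proof -
  have "norm (y $ i - y $ j) powr (- \<alpha> - 2) * ((y $ i - y $ j) \<bullet> (y $ i - y $ j)) =
      norm (y $ i - y $ j) powr (- \<alpha>)" if "i \<in> K" "j \<in> K - {i}" for i j
  proof -
    have "norm (y $ i - y $ j) > 0" using that assms by (auto simp: collision_set_def)
    then show ?thesis by (simp add: power2_norm_eq_inner[symmetric] flip: powr_numeral powr_add)
  qed
  then show ?thesis
    unfolding potential_def potential_deriv_def
    by (simp add: sum_distrib_left mult.assoc)
qed

lemma potential_pos:
  fixes y :: "('d::finite, 'n::finite) config"
  assumes "\<And>i. 0 < m i" "2 \<le> card K" "y \<notin> collision_set K"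
  shows "0 < potential m \<alpha> K y"
proof -
  obtain i j where ij: "i \<in> K" "j \<in> K" "i \<noteq> j"
    using assms(2) by (metis card_2_iff' obtain_subset_with_card_n subset_eq)
  have nn: "0 \<le> m i * m j * norm (y $ i - y $ j) powr (- \<alpha>)" for i j
    using assms(1) by (simp add: less_imp_le)
  have "0 < (\<Sum>j\<in>K - {i}. m i * m j * norm (y $ i - y $ j) powr (- \<alpha>))"
    using ij assms(1) not_collisionD[OF assms(3), of i j] by (intro sum_pos2[of _ j] nn) auto
  then have "0 < (\<Sum>i\<in>K. \<Sum>j\<in>K - {i}. m i * m j * norm (y $ i - y $ j) powr (- \<alpha>))"
    using ij by (intro sum_pos2[of K i] sum_nonneg nn) auto
  then show ?thesis by (simp add: potential_def)
qed

section \<open>Paths that can be differentiated repeatedly\<close>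

text \<open>
  \<open>times_differentiable n S f\<close> says that \<open>f\<close> is \<open>n\<close> times differentiable at the points of \<open>S\<close>.
  Continuity of the last derivative is not required; this makes no difference once the property
  holds for every \<open>n\<close>, and it makes the level \<open>0\<close> of every induction trivial.
\<close>

primrec times_differentiable ::
    "nat \<Rightarrow> real set \<Rightarrow> (real \<Rightarrow> 'a::real_normed_vector) \<Rightarrow> bool" where
  "times_differentiable 0 S f \<longleftrightarrow> True"
| "times_differentiable (Suc n) S f \<longleftrightarrow>
     (\<forall>t\<in>S. (f has_vector_derivative vector_derivative f (at t)) (at t)) \<and>
     times_differentiable n S (\<lambda>t. vector_derivative f (at t))"

lemma vector_derivative_eq_on_open:
  assumes "open S" "t \<in> S" "\<And>t. t \<in> S \<Longrightarrow> f t = g t"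
  shows "vector_derivative f (at t) = vector_derivative g (at t)"
proof -
  have "(f has_vector_derivative d) (at t) \<longleftrightarrow> (g has_vector_derivative d) (at t)" for d
    using assms has_vector_derivative_transform_within_open[of f d t S g]
      has_vector_derivative_transform_within_open[of g d t S f] by auto
  then show ?thesis by (simp add: vector_derivative_def)
qed

lemma times_differentiable_cong:
  assumes "open S" "\<And>t. t \<in> S \<Longrightarrow> f t = g t" "times_differentiable n S f"
  shows "times_differentiable n S g"
  using assms(2,3)
proof (induction n arbitrary: f g)
  case (Suc n)
  have eq: "vector_derivative f (at t) = vector_derivative g (at t)" if "t \<in> S" for t
    using vector_derivative_eq_on_open[OF assms(1) that] Suc.prems(1) by blast
  have "(g has_vector_derivative vector_derivative g (at t)) (at t)" if "t \<in> S" for t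
    using has_vector_derivative_transform_within_open[OF _ assms(1) that, of f] Suc.prems eq that
    by auto
  with Suc.IH[OF eq] Suc.prems(2) show ?case by auto
qed simp

lemma times_differentiable_SucI:
  assumes "open S" "\<And>t. t \<in> S \<Longrightarrow> (f has_vector_derivative f' t) (at t)"
    "times_differentiable n S f'"
  shows "times_differentiable (Suc n) S f"
proof -
  have eq: "vector_derivative f (at t) = f' t" if "t \<in> S" for t
    using assms(2)[OF that] by (simp add: vector_derivative_at)
  moreover have "times_differentiable n S (\<lambda>t. vector_derivative f (at t))"
    by (rule times_differentiable_cong[OF assms(1) _ assms(3)]) (simp add: eq)
  ultimately show ?thesis using assms(2) by simp
qed

lemma times_differentiable_down: "times_differentiable (Suc n) S f \<Longrightarrow> times_differentiable n S f"
  by (induction n arbitrary: f) auto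

lemma times_differentiable_const: "open S \<Longrightarrow> times_differentiable n S (\<lambda>t. c)"
  by (induction n arbitrary: c) (auto intro!: times_differentiable_SucI[where f' = "\<lambda>t. 0"])

lemma times_differentiable_ident: "open S \<Longrightarrow> times_differentiable n S (\<lambda>t. t)"
  by (cases n)
    (auto intro!: times_differentiable_SucI[where f' = "\<lambda>t. 1"] times_differentiable_const
      derivative_eq_intros)

lemma times_differentiable_linear:
  assumes "bounded_linear L" "open S" "times_differentiable n S f"
  shows "times_differentiable n S (\<lambda>t. L (f t))"
  using assms(3)
proof (induction n arbitrary: f)
  case (Suc n)
  show ?case
    by (rule times_differentiable_SucI[OF assms(2)
          bounded_linear.has_vector_derivative[OF assms(1)] Suc.IH])
      (use Suc.prems in auto)
qed simp

lemma times_differentiable_add: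
  assumes "open S" "times_differentiable n S f" "times_differentiable n S g"
  shows "times_differentiable n S (\<lambda>t. f t + g t)"
  using assms(2,3)
proof (induction n arbitrary: f g)
  case (Suc n)
  show ?case
    by (rule times_differentiable_SucI[OF assms(1) has_vector_derivative_add Suc.IH])
      (use Suc.prems in auto)
qed simp

lemma times_differentiable_minus:
  "open S \<Longrightarrow> times_differentiable n S f \<Longrightarrow> times_differentiable n S (\<lambda>t. - f t)"
  by (rule times_differentiable_linear[OF bounded_linear_minus[OF bounded_linear_ident]])

lemma times_differentiable_diff:
  assumes "open S" "times_differentiable n S f" "times_differentiable n S g"
  shows "times_differentiable n S (\<lambda>t. f t - g t)"
  using times_differentiable_add[OF assms(1,2) times_differentiable_minus[OF assms(1,3)]] by simp

lemma times_differentiable_sum: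
  assumes "open S" "\<And>a. a \<in> A \<Longrightarrow> times_differentiable n S (f a)"
  shows "times_differentiable n S (\<lambda>t. \<Sum>a\<in>A. f a t)"
  using assms(2)
  by (induction A rule: infinite_finite_induct)
    (auto intro: times_differentiable_const times_differentiable_add assms(1))

lemma times_differentiable_bilinear:
  assumes "bounded_bilinear B" "open S" "times_differentiable n S f" "times_differentiable n S g"
  shows "times_differentiable n S (\<lambda>t. B (f t) (g t))"
  using assms(3,4)
proof (induction n arbitrary: f g)
  case (Suc n)
  show ?case
    by (rule times_differentiable_SucI[OF assms(2)
          bounded_bilinear.has_vector_derivative[OF assms(1),
            where f' = "vector_derivative f (at t)" and g' = "vector_derivative g (at t)" for t]
          times_differentiable_add[OF assms(2) Suc.IH Suc.IH]])
      (use Suc.prems Suc.prems[THEN times_differentiable_down] in auto)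
qed simp

lemmas times_differentiable_mult = times_differentiable_bilinear[OF bounded_bilinear_mult]
lemmas times_differentiable_scaleR = times_differentiable_bilinear[OF bounded_bilinear_scaleR]
lemmas times_differentiable_inner = times_differentiable_bilinear[OF bounded_bilinear_inner]

lemma times_differentiable_powr:
  fixes f :: "real \<Rightarrow> real"
  assumes "open S" "times_differentiable n S f" "\<And>t. t \<in> S \<Longrightarrow> 0 < f t"
  shows "times_differentiable n S (\<lambda>t. f t powr p)"
  using assms(2)
proof (induction n arbitrary: p)
  case (Suc n)
  have "((\<lambda>t. f t powr p) has_vector_derivative
          p * (f t powr (p - 1) * vector_derivative f (at t))) (at t)" if "t \<in> S" for t
  proof -
    have "(f has_real_derivative vector_derivative f (at t)) (at t)"
      using Suc.prems that by (simp add: has_real_derivative_iff_has_vector_derivative)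
    then show ?thesis
      unfolding has_real_derivative_iff_has_vector_derivative[symmetric]
      using assms(3)[OF that] by (auto intro!: derivative_eq_intros)
  qed
  moreover have "times_differentiable n S
      (\<lambda>t. p * (f t powr (p - 1) * vector_derivative f (at t)))"
    using Suc times_differentiable_down[OF Suc.prems]
    by (intro times_differentiable_mult times_differentiable_const assms(1)) auto
  ultimately show ?case by (rule times_differentiable_SucI[OF assms(1)])
qed simp

lemma times_differentiable_norm_powr:
  fixes z :: "real \<Rightarrow> 'a::real_inner"
  assumes "open S" "times_differentiable n S z" "\<And>t. t \<in> S \<Longrightarrow> z t \<noteq> 0"
  shows "times_differentiable n S (\<lambda>t. norm (z t) powr p)"
proof -
  have "times_differentiable n S (\<lambda>t. (z t \<bullet> z t) powr (p / 2))"
    using assms by (intro times_differentiable_powr times_differentiable_inner) auto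
  moreover have "(z t \<bullet> z t) powr (p / 2) = norm (z t) powr p" if "t \<in> S" for t
  proof -
    have "norm (z t) > 0" using assms(3)[OF that] by simp
    then show ?thesis
      by (simp add: power2_norm_eq_inner[symmetric] powr_powr flip: powr_numeral)
  qed
  ultimately show ?thesis by (rule times_differentiable_cong[OF assms(1), rotated])
qed

lemma times_differentiable_compose:
  fixes \<theta> :: "real \<Rightarrow> real"
  assumes "open S" "\<And>t. t \<in> S \<Longrightarrow> \<theta> t \<in> T"
    and "times_differentiable n S \<theta>" "times_differentiable n T f"
  shows "times_differentiable n S (\<lambda>t. f (\<theta> t))"
  using assms(3,4)
proof (induction n arbitrary: f)
  case (Suc n)
  have "((\<lambda>t. f (\<theta> t)) has_vector_derivative
      (vector_derivative \<theta> (at t) *\<^sub>R vector_derivative f (at (\<theta> t)))) (at t)" if "t \<in> S" for t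
    using vector_diff_chain_at[of \<theta> "vector_derivative \<theta> (at t)" t f] Suc.prems assms(2)[OF that] that
    by (auto simp: o_def)
  moreover have "times_differentiable n S
      (\<lambda>t. vector_derivative \<theta> (at t) *\<^sub>R vector_derivative f (at (\<theta> t)))"
    using Suc.prems times_differentiable_down[OF Suc.prems(1)]
    by (intro times_differentiable_scaleR Suc.IH[of "\<lambda>t. vector_derivative f (at t)"] assms(1)) auto
  ultimately show ?case by (rule times_differentiable_SucI[OF assms(1)])
qed simp

lemma times_differentiable_Un:
  "times_differentiable n S f \<Longrightarrow> times_differentiable n T f \<Longrightarrow> times_differentiable n (S \<union> T) f"
  by (induction n arbitrary: f) auto

text \<open>The iterated derivatives serve as the sequence that the definition of \<open>smooth\<close> asks for.\<close>

lemma smooth_if_times_differentiable: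
  assumes "\<And>n. times_differentiable n UNIV f"
  shows "smooth f"
proof -
  define D where "D n = ((\<lambda>g t. vector_derivative g (at t)) ^^ n) f" for n
  have "times_differentiable k UNIV (D n)" for n k
  proof (induction n arbitrary: k)
    case (Suc n)
    from Suc.IH[of "Suc k"] show ?case by (simp add: D_def)
  qed (simp add: D_def assms)
  then have "(D n has_vector_derivative D (Suc n) t) (at t)" for n t
    using times_differentiable.simps(2)[of 0 UNIV "D n"] by (simp add: D_def)
  moreover have "D 0 = f" by (simp add: D_def)
  ultimately show ?thesis unfolding smooth_def by blast
qed

lemma times_differentiable_vec:
  fixes f :: "real \<Rightarrow> 'a::euclidean_space"
  assumes "open S" "\<And>b. b \<in> Basis \<Longrightarrow> times_differentiable n S (\<lambda>t. f t \<bullet> b)"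
  shows "times_differentiable n S f"
proof -
  have "times_differentiable n S (\<lambda>t. \<Sum>b\<in>Basis. (f t \<bullet> b) *\<^sub>R b)"
    using assms by (intro times_differentiable_sum times_differentiable_scaleR
        times_differentiable_const) auto
  then show ?thesis by (simp add: euclidean_representation)
qed

lemma continuous_on_times_differentiable:
  assumes "times_differentiable (Suc n) S f"
  shows "continuous_on S f"
  by (rule continuous_at_imp_continuous_on)
    (use assms in \<open>auto intro: has_vector_derivative_continuous\<close>)

section \<open>A smooth bump function\<close>

text \<open>
  The functions \<open>t powr (- k) exp (- 1 / t)\<close>, continued by \<open>0\<close> to \<open>t \<le> 0\<close>; the derivative of each is
  a combination of two others, so all of them are smooth.
\<close>

definition flat_exp :: "nat \<Rightarrow> real \<Rightarrow> real" where
  "flat_exp k t = (if 0 < t then inverse t ^ k * exp (- inverse t) else 0)"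

lemma flat_exp_tendsto_0: "(flat_exp k \<longlongrightarrow> 0) (at 0)"
proof -
  have "((\<lambda>t::real. inverse t ^ k * exp (- inverse t)) \<longlongrightarrow> 0) (at_right 0)"
  proof -
    have "((\<lambda>u::real. u ^ k / exp u) \<longlongrightarrow> 0) at_top" by (rule tendsto_power_div_exp_0)
    then have "((\<lambda>t::real. inverse t ^ k / exp (inverse t)) \<longlongrightarrow> 0) (at_right 0)"
      using filterlim_compose filterlim_inverse_at_top_right by blast
    then show ?thesis by (simp add: exp_minus divide_inverse)
  qed
  then have "(flat_exp k \<longlongrightarrow> 0) (at_right 0)"
    by (rule Lim_transform_eventually)
      (auto simp: flat_exp_def eventually_at_right_less intro: eventually_mono[OF eventually_at_right_less])
  moreover have "(flat_exp k \<longlongrightarrow> 0) (at_left 0)"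
    by (rule Lim_transform_eventually[OF tendsto_const])
      (auto simp: flat_exp_def eventually_at_filter)
  ultimately show ?thesis by (simp add: filterlim_split_at)
qed

lemma flat_exp_deriv:
  "(flat_exp k has_real_derivative flat_exp (k + 2) t - real k * flat_exp (k + 1) t) (at t)"
proof (cases t "0::real" rule: linorder_cases)
  case less
  have "((\<lambda>t. 0) has_real_derivative 0) (at t)" by simp
  then have "(flat_exp k has_real_derivative 0) (at t)"
    by (rule has_field_derivative_transform_within_open[of _ _ _ "{..<0}"])
      (use less in \<open>auto simp: flat_exp_def\<close>)
  then show ?thesis using less by (simp add: flat_exp_def)
next
  case equal
  have "((\<lambda>h. (flat_exp k (0 + h) - flat_exp k 0) / h) \<longlongrightarrow> 0) (at 0)"
    by (rule Lim_transform_eventually[OF flat_exp_tendsto_0[of "Suc k"]])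
      (auto simp: flat_exp_def eventually_at_filter divide_inverse)
  then show ?thesis unfolding DERIV_def using equal by (simp add: flat_exp_def)
next
  case greater
  have "((\<lambda>t. inverse t ^ k * exp (- inverse t)) has_real_derivative
      flat_exp (k + 2) t - real k * flat_exp (k + 1) t) (at t)"
  proof (cases k)
    case (Suc j)
    have "((\<lambda>t. inverse t ^ k) has_real_derivative
        real k * (inverse t ^ j * - (inverse t * inverse t))) (at t)"
      using DERIV_power_Suc[OF DERIV_inverse'[OF DERIV_ident], of t j] greater
      by (simp add: Suc algebra_simps)
    moreover have "((\<lambda>t. exp (- inverse t)) has_real_derivative
        exp (- inverse t) * (inverse t * inverse t)) (at t)"
      using greater by (auto intro!: derivative_eq_intros)
    ultimately have "((\<lambda>t. inverse t ^ k * exp (- inverse t)) has_real_derivative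
        real k * (inverse t ^ j * - (inverse t * inverse t)) * exp (- inverse t) +
        exp (- inverse t) * (inverse t * inverse t) * inverse t ^ k) (at t)"
      by (rule DERIV_mult)
    then show ?thesis
      by (rule DERIV_cong) (use greater Suc in \<open>simp add: flat_exp_def algebra_simps\<close>)
  qed (use greater in \<open>auto intro!: derivative_eq_intros simp: flat_exp_def power2_eq_square\<close>)
  then show ?thesis
    by (rule has_field_derivative_transform_within_open[of _ _ _ "{0<..}"])
      (use greater in \<open>auto simp: flat_exp_def\<close>)
qed

lemma times_differentiable_flat_exp: "times_differentiable n UNIV (flat_exp k)"
proof (induction n arbitrary: k)
  case (Suc n)
  show ?case
    by (rule times_differentiable_SucI[OF open_UNIV
          flat_exp_deriv[unfolded has_real_derivative_iff_has_vector_derivative]])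
      (intro times_differentiable_diff times_differentiable_mult times_differentiable_const
        open_UNIV Suc.IH)
qed simp

text \<open>A smooth function that is positive exactly on the open unit interval.\<close>

definition bump :: "real \<Rightarrow> real" where
  "bump t = flat_exp 0 t * flat_exp 0 (1 - t)"

lemma bump_pos: "0 < t \<Longrightarrow> t < 1 \<Longrightarrow> 0 < bump t"
  by (simp add: bump_def flat_exp_def)

lemma bump_eq_0: "t \<notin> {0<..<1} \<Longrightarrow> bump t = 0"
  by (auto simp: bump_def flat_exp_def)

lemma times_differentiable_bump: "times_differentiable n UNIV bump"
  unfolding bump_def[abs_def]
  by (intro times_differentiable_mult times_differentiable_flat_exp open_UNIV
      times_differentiable_compose[where T = UNIV and f = "flat_exp 0"]
      times_differentiable_diff times_differentiable_const times_differentiable_ident) auto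

text \<open>The derivative of \<open>bump\<close>.\<close>

definition bump' :: "real \<Rightarrow> real" where
  "bump' t = flat_exp 2 t * flat_exp 0 (1 - t) - flat_exp 0 t * flat_exp 2 (1 - t)"

lemma deriv_bump: "(bump has_real_derivative bump' t) (at t)"
proof -
  have d: "(flat_exp 0 has_real_derivative flat_exp 2 t) (at t)" for t
    using flat_exp_deriv[of 0 t] by (simp add: numeral_2_eq_2)
  have "((\<lambda>t. flat_exp 0 (1 - t)) has_real_derivative flat_exp 2 (1 - t) * (- 1)) (at t)"
    by (rule DERIV_chain2[OF d]) (auto intro!: derivative_eq_intros)
  from DERIV_mult[OF d this] show ?thesis
    unfolding bump_def[abs_def] by (rule DERIV_cong) (simp add: bump'_def)
qed

lemma bump'_eq_0: "t \<notin> {0<..<1} \<Longrightarrow> bump' t = 0"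
  by (auto simp: bump'_def flat_exp_def)

lemma continuous_bump: "continuous_on S bump" "continuous_on S bump'"
proof -
  have f: "continuous_on UNIV (flat_exp k)" for k
    by (rule continuous_on_times_differentiable[OF times_differentiable_flat_exp])
  have "continuous_on S (\<lambda>t. flat_exp k t)" "continuous_on S (\<lambda>t. flat_exp k (1 - t))" for k
    by (rule continuous_on_compose2[OF f] continuous_intros subset_UNIV)+
  then show "continuous_on S bump" "continuous_on S bump'"
    unfolding bump_def[abs_def] bump'_def[abs_def] by (auto intro!: continuous_intros)
qed

lemma bump_square_pos: "0 < integral {0..1} (\<lambda>u. (bump u)\<^sup>2)"
proof -
  have "integral {0..1} (\<lambda>u. (bump u)\<^sup>2) \<noteq> 0"
    using integral_eq_0_iff[of 0 1 "\<lambda>u. (bump u)\<^sup>2"] bump_pos[of "1/2"]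
    by (force intro!: continuous_intros continuous_bump)
  moreover have "0 \<le> integral {0..1} (\<lambda>u. (bump u)\<^sup>2)"
    by (intro integral_nonneg integrable_continuous_interval continuous_intros continuous_bump) simp
  ultimately show ?thesis by simp
qed

lemma bump_bump'_integral: "((\<lambda>u. bump u * bump' u) has_integral 0) {0..1}"
proof -
  have "((\<lambda>u. (bump u)\<^sup>2 / 2) has_real_derivative bump u * bump' u) (at u)" for u
    using deriv_bump[of u] by (auto intro!: derivative_eq_intros)
  then have "((\<lambda>u. bump u * bump' u) has_integral (bump 1)\<^sup>2 / 2 - (bump 0)\<^sup>2 / 2) {0..1}"
    by (intro fundamental_theorem_of_calculus)
      (auto simp flip: has_real_derivative_iff_has_vector_derivative
        intro: has_field_derivative_at_within)
  then show ?thesis by (simp add: bump_eq_0)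
qed

text \<open>
  Translates of the bump function by distinct integers have disjoint supports, so that forms in
  their linear combinations are diagonal.
\<close>

lemma disjoint_translates:
  assumes "i \<noteq> k" "f = bump \<or> f = bump'" "g = bump \<or> g = bump'"
  shows "f (u - real i) * g (u - real k) = 0"
proof (cases "u - real i \<in> {0<..<1} \<and> u - real k \<in> {0<..<1}")
  case True
  then have "\<bar>real i - real k\<bar> < 1" by auto
  with \<open>i \<noteq> k\<close> show ?thesis by linarith
next
  case False
  have "f z = 0" "g z = 0" if "z \<notin> {0<..<1}" for z
    using assms(2,3) bump_eq_0[OF that] bump'_eq_0[OF that] by auto
  with False show ?thesis by (auto simp del: greaterThanLessThan_iff)
qed

lemma sum_mult_disjoint:
  fixes f g :: "nat \<Rightarrow> real"
  assumes "\<And>i k. i \<noteq> k \<Longrightarrow> f i * g k = 0"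
  shows "(\<Sum>i<n. c i * f i) * (\<Sum>i<n. c i * g i) = (\<Sum>i<n. (c i)\<^sup>2 * (f i * g i))"
proof -
  have "(\<Sum>i<n. c i * f i) * (\<Sum>k<n. c k * g k) = (\<Sum>i<n. \<Sum>k<n. c i * c k * (f i * g k))"
    unfolding sum_product by (intro sum.cong refl) (simp add: mult.assoc mult.left_commute)
  also have "\<dots> = (\<Sum>i<n. \<Sum>k<n. if k = i then (c i)\<^sup>2 * (f i * g i) else 0)"
    by (intro sum.cong refl) (auto simp: power2_eq_square assms)
  finally show ?thesis by simp
qed

text \<open>
  A quadratic form in the value \<open>\<omega>\<close> and the slope \<open>\<omega>'\<close> of a scalar profile; for \<open>\<delta> > 0\<close> it is negative
  on nonzero constants. Its integral is then negative on a bump that is stretched by a large factor \<open>L\<close>;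
  the mixed term does not contribute.
\<close>

definition profile_form :: "real \<Rightarrow> real \<Rightarrow> real \<Rightarrow> real \<Rightarrow> real" where
  "profile_form \<kappa> \<delta> \<omega> \<omega>' = 2 * \<omega>'\<^sup>2 + 2 * \<kappa> * (\<omega> * \<omega>') - \<delta> / 2 * \<omega>\<^sup>2"

lemma profile_form_bump_negative:
  assumes "0 < \<delta>"
  shows "\<exists>L\<ge>1. \<exists>I<0. \<forall>t. has_bochner_integral lborel
    (\<lambda>\<tau>. profile_form \<kappa> \<delta> (bump (t + \<tau> / L)) (bump' (t + \<tau> / L) / L)) I"
proof -
  define B where "B = integral {0..1} (\<lambda>u. (bump u)\<^sup>2)"
  define A where "A = integral {0..1} (\<lambda>u. (bump' u)\<^sup>2)"
  \<comment> \<open>Stretching divides the ratio of the integrals of \<open>\<omega>'\<^sup>2\<close> and \<open>\<omega>\<^sup>2\<close> by \<open>L\<^sup>2\<close>.\<close>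
  define L where "L = 1 + 4 * A / (\<delta> * B)"
  have "0 < B" unfolding B_def by (rule bump_square_pos)
  have "0 \<le> A" unfolding A_def
    by (intro integral_nonneg integrable_continuous_interval continuous_intros continuous_bump) simp
  then have L: "1 \<le> L" using \<open>0 < B\<close> assms by (simp add: L_def)
  define \<gamma> where "\<gamma> u = profile_form \<kappa> \<delta> (bump u) (bump' u / L)" for u
  have cont: "continuous_on {0..1} \<gamma>"
    unfolding \<gamma>_def[abs_def] profile_form_def
    using L by (intro continuous_intros continuous_bump) auto
  have "((\<lambda>u. 2 / L\<^sup>2 * (bump' u)\<^sup>2 + 2 * \<kappa> / L * (bump u * bump' u) - \<delta> / 2 * (bump u)\<^sup>2) has_integral
      2 / L\<^sup>2 * A + 2 * \<kappa> / L * 0 - \<delta> / 2 * B) {0..1}"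
    unfolding A_def B_def
    by (intro has_integral_diff has_integral_add has_integral_mult_right bump_bump'_integral
        integrable_integral integrable_continuous_interval continuous_intros continuous_bump)
  moreover have "(\<lambda>u. 2 / L\<^sup>2 * (bump' u)\<^sup>2 + 2 * \<kappa> / L * (bump u * bump' u) - \<delta> / 2 * (bump u)\<^sup>2) = \<gamma>"
    using L by (simp add: fun_eq_iff \<gamma>_def profile_form_def power_divide)
  ultimately have int: "integral {0..1} \<gamma> = 2 / L\<^sup>2 * A - \<delta> / 2 * B"
    by (simp add: integral_unique)
  have neg: "2 / L\<^sup>2 * A - \<delta> / 2 * B < 0"
  proof -
    have "4 * A / (\<delta> * B) < L" by (simp add: L_def)
    also have "L \<le> L\<^sup>2" using L by (simp add: power2_eq_square)
    finally show ?thesis using L \<open>0 < B\<close> assms by (simp add: field_simps)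
  qed
  have si: "set_integrable lborel {0..1} \<gamma>" by (rule borel_integrable_atLeastAtMost'[OF cont])
  have "indicator {0..1} u *\<^sub>R \<gamma> u = \<gamma> u" for u
  proof (cases "u \<in> {0..1}")
    case False
    then have "u \<notin> {0<..<1}" by auto
    then show ?thesis by (simp add: \<gamma>_def profile_form_def bump_eq_0 bump'_eq_0)
  qed simp
  then have "(\<lambda>u. indicator {0..1} u *\<^sub>R \<gamma> u) = \<gamma>" by (rule ext)
  with si set_borel_integral_eq_integral(2)[OF si]
  have hb: "has_bochner_integral lborel \<gamma> (integral {0..1} \<gamma>)"
    unfolding has_bochner_integral_iff set_integrable_def set_lebesgue_integral_def by metis
  have "has_bochner_integral lborel (\<lambda>\<tau>. \<gamma> (t + (1 / L) * \<tau>)) (integral {0..1} \<gamma> /\<^sub>R \<bar>1 / L\<bar>)" for t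
    using lborel_has_bochner_integral_real_affine_iff[of "1 / L" \<gamma> "integral {0..1} \<gamma>" t] hb L by simp
  moreover have "integral {0..1} \<gamma> /\<^sub>R \<bar>1 / L\<bar> < 0"
    using neg L unfolding int by (simp add: mult_pos_neg)
  ultimately show ?thesis using L unfolding \<gamma>_def by (intro exI[of _ L]) auto
qed

section \<open>A perturbed scalar saddle\<close>

text \<open>A function that crosses the level \<open>c\<close> only upwards stays above \<open>c\<close>.\<close>

lemma barrier:
  fixes p :: "real \<Rightarrow> real"
  assumes deriv: "\<And>t. a \<le> t \<Longrightarrow> (p has_real_derivative p' t) (at t)"
    and up: "\<And>t. a \<le> t \<Longrightarrow> p t = c \<Longrightarrow> 0 < p' t"
    and "c \<le> p a" "a \<le> t"
  shows "c \<le> p t"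
proof (rule ccontr)
  assume "\<not> c \<le> p t"
  then have pt: "p t < c" by simp
  have cont: "continuous_on {a..t} p"
    using deriv by (intro DERIV_continuous_on[of _ _ p']) (auto intro: DERIV_subset)
  \<comment> \<open>At the last time at which \<open>p\<close> reaches \<open>c\<close>, it would have to increase.\<close>
  define S where "S = {a..t} \<inter> p -` {c..}"
  have "closed S"
    unfolding S_def by (intro continuous_closed_preimage cont closed_atLeastAtMost closed_atLeast)
  moreover have "bounded S" by (rule bounded_subset[of "{a..t}"]) (auto simp: S_def)
  ultimately have "compact S" by (simp add: compact_eq_bounded_closed)
  moreover have "a \<in> S" using assms by (auto simp: S_def)
  ultimately obtain \<sigma> where \<sigma>: "\<sigma> \<in> S" "\<And>u. u \<in> S \<Longrightarrow> u \<le> \<sigma>"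
    using compact_attains_sup[of S] by blast
  have "\<exists>\<xi>. \<sigma> \<le> \<xi> \<and> \<xi> \<le> t \<and> p \<xi> = c"
    by (rule IVT2') (use \<sigma> pt in \<open>auto simp: S_def intro: continuous_on_subset[OF cont]\<close>)
  then obtain \<xi> where \<xi>: "\<sigma> \<le> \<xi>" "\<xi> \<le> t" "p \<xi> = c" by blast
  moreover from \<xi> \<sigma>(1) have "\<xi> \<in> S" by (auto simp: S_def)
  ultimately have "\<xi> = \<sigma>" using \<sigma>(2)[of \<xi>] by linarith
  with \<xi> \<sigma> have "p \<sigma> = c" "a \<le> \<sigma>" "\<sigma> < t"
    using pt by (auto simp: S_def order_less_le)
  then obtain d where d: "0 < d" "\<And>h. 0 < h \<Longrightarrow> h < d \<Longrightarrow> p \<sigma> < p (\<sigma> + h)"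
    using DERIV_pos_inc_right[OF deriv up] by blast
  define h where "h = min (d / 2) (t - \<sigma>)"
  have "0 < h" "h < d" "\<sigma> + h \<le> t" using d \<open>\<sigma> < t\<close> by (auto simp: h_def)
  with d(2)[of h] \<open>p \<sigma> = c\<close> \<open>a \<le> \<sigma>\<close> have "\<sigma> + h \<in> S" by (auto simp: S_def)
  with \<sigma>(2) \<open>0 < h\<close> show False by force
qed

text \<open>
  The equation \<open>p' = c (b\<^sup>2 - p\<^sup>2)\<close> has the unstable equilibrium \<open>- b\<close> and the stable one \<open>b\<close>.
  A solution of a vanishing perturbation that leaves the neighbourhood of \<open>- b\<close> is driven to \<open>b\<close>, so
  its primitive \<open>L\<close> cannot tend to \<open>- \<infinity>\<close>.
\<close>

lemma tendsto_unstable_equilibrium: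
  fixes p L \<eta> \<eta>' :: "real \<Rightarrow> real"
  assumes "0 < b" "0 < c"
    and p: "\<And>t. a \<le> t \<Longrightarrow> (p has_real_derivative c * (b\<^sup>2 - (p t)\<^sup>2) + \<eta> t) (at t)"
    and L: "\<And>t. a \<le> t \<Longrightarrow> (L has_real_derivative p t) (at t)"
    and L_lim: "filterlim L at_bot at_top"
    and \<eta>: "(\<eta> \<longlongrightarrow> 0) at_top" and \<eta>': "(\<eta>' \<longlongrightarrow> 0) at_top"
    and bound: "\<And>t. a \<le> t \<Longrightarrow> (p t)\<^sup>2 \<le> b\<^sup>2 + \<eta>' t"
  shows "(p \<longlongrightarrow> - b) at_top"
proof (rule tendstoI)
  fix \<epsilon> :: real assume "0 < \<epsilon>"
  define e where "e = min (\<epsilon> / 2) (b / 2)"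
  have e: "0 < e" "e \<le> b / 2" "e < \<epsilon>" using \<open>0 < \<epsilon>\<close> \<open>0 < b\<close> by (auto simp: e_def)
  define \<delta> where "\<delta> = c * e * b / 2"
  have "0 < \<delta>" using e assms by (simp add: \<delta>_def)
  have "eventually (\<lambda>t. \<bar>\<eta> t\<bar> < \<delta>) at_top"
    using tendstoD[OF \<eta> \<open>0 < \<delta>\<close>] by simp
  moreover have "eventually (\<lambda>t. \<bar>\<eta>' t\<bar> < b * e) at_top"
    using tendstoD[OF \<eta>', of "b * e"] e assms by simp
  ultimately have "eventually (\<lambda>t. \<bar>\<eta> t\<bar> < \<delta> \<and> \<bar>\<eta>' t\<bar> < b * e \<and> a \<le> t) at_top"
    using eventually_ge_at_top[of a] by eventually_elim auto
  then obtain T where T: "\<And>t. T \<le> t \<Longrightarrow> \<bar>\<eta> t\<bar> < \<delta> \<and> \<bar>\<eta>' t\<bar> < b * e \<and> a \<le> t"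
    unfolding eventually_at_top_linorder by blast
  have growth: "\<delta> \<le> c * (b\<^sup>2 - (p t)\<^sup>2) + \<eta> t"
    and growth_pos: "0 < c * (b\<^sup>2 - (p t)\<^sup>2) + \<eta> t" if "T \<le> t" "\<bar>p t\<bar> \<le> b - e" for t
  proof -
    have "(p t)\<^sup>2 \<le> (b - e)\<^sup>2" using that(2) by (metis abs_ge_zero power2_abs power_mono)
    also have "(b - e)\<^sup>2 \<le> b\<^sup>2 - e * b"
      using mult_left_mono[OF e(2), of e] e by (simp add: power2_eq_square algebra_simps)
    finally have "e * b \<le> b\<^sup>2 - (p t)\<^sup>2" by simp
    then have "c * (e * b) \<le> c * (b\<^sup>2 - (p t)\<^sup>2)" using \<open>0 < c\<close> by (intro mult_left_mono) auto
    moreover have "c * (e * b) = 2 * \<delta>" by (simp add: \<delta>_def)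
    moreover have "- \<delta> < \<eta> t" using T[OF that(1)] by auto
    ultimately show "\<delta> \<le> c * (b\<^sup>2 - (p t)\<^sup>2) + \<eta> t" by linarith
    then show "0 < c * (b\<^sup>2 - (p t)\<^sup>2) + \<eta> t" using \<open>0 < \<delta>\<close> by linarith
  qed
  have stays: "l \<le> p t" if "T \<le> u" "l \<le> p u" "\<bar>l\<bar> \<le> b - e" "u \<le> t" for l u t
    by (rule barrier[where a = u and p = p, OF p growth_pos]) (use that T in auto)
  have upper: "p t < - b + e" if t: "T \<le> t" for t
  proof (rule ccontr)
    assume "\<not> p t < - b + e"
    then have low: "- b + e \<le> p u" if "t \<le> u" for u
      using stays[of t "- b + e" u] t e that by auto
    have "\<exists>u\<ge>t. b - e \<le> p u"
    proof (rule ccontr)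
      assume "\<not> (\<exists>u\<ge>t. b - e \<le> p u)"
      then have small: "\<bar>p u\<bar> \<le> b - e" if "t \<le> u" for u
        using low[OF that] that by (force simp: abs_le_iff)
      define u where "u = t + 2 * b / \<delta>"
      have "t < u" using \<open>0 < \<delta>\<close> \<open>0 < b\<close> by (simp add: u_def)
      have "\<exists>z>t. z < u \<and> p u - p t = (u - t) * (c * (b\<^sup>2 - (p z)\<^sup>2) + \<eta> z)"
        by (rule MVT2[OF \<open>t < u\<close>]) (use p T t in auto)
      then obtain z where z: "t < z" "p u - p t = (u - t) * (c * (b\<^sup>2 - (p z)\<^sup>2) + \<eta> z)"
        by blast
      have "(u - t) * \<delta> \<le> p u - p t"
        unfolding z(2) using growth[of z] small[of z] z t \<open>t < u\<close> by (intro mult_left_mono) auto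
      moreover have "(u - t) * \<delta> = 2 * b" using \<open>0 < \<delta>\<close> by (simp add: u_def)
      ultimately show False using small[of u] small[of t] \<open>t < u\<close> e by (auto simp: abs_le_iff)
    qed
    then obtain u where u: "t \<le> u" "b - e \<le> p u" by blast
    have "L u \<le> L w" if "u \<le> w" for w
    proof (rule DERIV_nonneg_imp_nondecreasing[OF that])
      fix z assume "u \<le> z" "z \<le> w"
      then have "b - e \<le> p z" using stays[of u "b - e" z] u t e by auto
      then show "\<exists>y. (L has_real_derivative y) (at z) \<and> 0 \<le> y"
        using L[of z] T[of z] \<open>u \<le> z\<close> u t e by (intro exI[of _ "p z"]) auto
    qed
    moreover
    have "eventually (\<lambda>w. L w < L u) at_top"
      using L_lim by (simp add: filterlim_at_bot_dense)
    then have "eventually (\<lambda>w. L w < L u \<and> u \<le> w) at_top"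
      using eventually_ge_at_top[of u] by eventually_elim auto
    then obtain w where w: "L w < L u" "u \<le> w"
      using eventually_happens'[OF trivial_limit_at_top_linorder] by blast
    ultimately show False by fastforce
  qed
  \<comment> \<open>The bound on \<open>p\<^sup>2\<close> excludes values far below \<open>- b\<close>.\<close>
  have lower: "- b - e < p t" if t: "T \<le> t" for t
  proof (rule ccontr)
    assume "\<not> - b - e < p t"
    then have "(b + e)\<^sup>2 \<le> (- p t)\<^sup>2" using e \<open>0 < b\<close> by (intro power_mono) auto
    with bound[of t] T[OF t] have "(b + e)\<^sup>2 < b\<^sup>2 + b * e" by auto
    then have "b * e + e * e < 0" by (simp add: power2_eq_square algebra_simps)
    moreover have "0 < b * e" "0 \<le> e * e" using e \<open>0 < b\<close> by auto
    ultimately show False by linarith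
  qed
  show "eventually (\<lambda>t. dist (p t) (- b) < \<epsilon>) at_top"
    unfolding eventually_at_top_linorder
  proof (intro exI[of _ T] allI impI)
    fix t assume "T \<le> t"
    with upper[of t] lower[of t] e show "dist (p t) (- b) < \<epsilon>" by (auto simp: dist_real_def)
  qed
qed

section \<open>The motion of a colliding cluster\<close>

text \<open>The positions of the bodies of \<open>K\<close> relative to their centre of mass.\<close>

definition centred_part ::
  "('n \<Rightarrow> real) \<Rightarrow> 'n set \<Rightarrow> ('d::finite, 'n::finite) config \<Rightarrow> ('d, 'n) config" where
  "centred_part m K y = (\<chi> i. if i \<in> K then y $ i - centre_of_mass m K y else 0)"

lemma bounded_linear_centred_part: "bounded_linear (centred_part m K)"
  unfolding linear_conv_bounded_linear[symmetric] centred_part_def centre_of_mass_def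
  by (rule linearI)
    (simp_all add: vec_eq_iff sum.distrib sum_distrib_left algebra_simps)

lemma centred_part_in_centred_space:
  fixes m :: "'n::finite \<Rightarrow> real"
  assumes "\<And>i. 0 < m i"
  shows "centred_part m K y \<in> centred_space m K"
proof (cases "K = {}")
  case False
  have "(\<Sum>i\<in>K. m i) > 0" using False assms by (intro sum_pos) auto
  then have "(\<Sum>i\<in>K. m i) *\<^sub>R centre_of_mass m K y = (\<Sum>i\<in>K. m i *\<^sub>R y $ i)"
    by (simp add: centre_of_mass_def)
  then have "(\<Sum>i\<in>K. m i *\<^sub>R (y $ i - centre_of_mass m K y)) = 0"
    by (simp add: scaleR_diff_right sum_subtractf scaleR_sum_left)
  then show ?thesis by (simp add: centred_space_def centred_part_def)
qed (simp add: centred_space_def centred_part_def)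

lemma mass_inner_centred_part:
  assumes "z \<in> centred_space m K"
  shows "mass_inner m (centred_part m K u) z = mass_inner m u z"
proof -
  have outside: "z $ i = 0" if "i \<notin> K" for i using assms that by (simp add: centred_space_def)
  have "mass_inner m (centred_part m K u) z =
      (\<Sum>i\<in>UNIV. m i * (u $ i \<bullet> z $ i) - centre_of_mass m K u \<bullet> (m i *\<^sub>R z $ i))"
    unfolding mass_inner_sum
    by (intro sum.cong refl) (auto simp: centred_part_def outside inner_diff_left algebra_simps)
  also have "\<dots> = mass_inner m u z - centre_of_mass m K u \<bullet> (\<Sum>i\<in>UNIV. m i *\<^sub>R z $ i)"
    by (simp add: mass_inner_sum sum_subtractf inner_sum_right)
  also have "(\<Sum>i\<in>UNIV. m i *\<^sub>R z $ i) = (\<Sum>i\<in>K. m i *\<^sub>R z $ i)"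
    by (rule sum.mono_neutral_right) (auto simp: outside)
  also have "\<dots> = 0" using assms by (simp add: centred_space_def)
  finally show ?thesis by simp
qed

lemma centred_part_diff:
  "i \<in> K \<Longrightarrow> j \<in> K \<Longrightarrow> centred_part m K y $ i - centred_part m K y $ j = y $ i - y $ j"
  by (simp add: centred_part_def)

lemma potential_deriv_centred_part:
  "potential_deriv m \<alpha> K (centred_part m K y) u = potential_deriv m \<alpha> K y u"
  unfolding potential_deriv_def by (simp add: centred_part_diff)

lemma collision_centred_part: "centred_part m K y \<in> collision_set K \<longleftrightarrow> y \<in> collision_set K"
  unfolding collision_set_def by (auto simp: centred_part_def)

text \<open>
  The power of the forces that the bodies outside \<open>K\<close> exert on those of \<open>K\<close>, when the latter move
  with velocity \<open>u\<close>.
\<close>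

definition external_power ::
  "('n \<Rightarrow> real) \<Rightarrow> real \<Rightarrow> 'n set \<Rightarrow> ('d::finite, 'n::finite) config \<Rightarrow> ('d, 'n) config \<Rightarrow> real" where
  "external_power m \<alpha> K y u = - \<alpha> * (\<Sum>i\<in>K. \<Sum>j\<in>- K.
     m i * m j * norm (y $ i - y $ j) powr (- \<alpha> - 2) * ((y $ i - y $ j) \<bullet> u $ i))"

text \<open>
  On displacements of the cluster alone, the forces of the whole system split into internal and
  external ones.
\<close>

lemma potential_deriv_split:
  fixes y :: "('d::finite, 'n::finite) config"
  assumes "\<And>i. i \<notin> K \<Longrightarrow> u $ i = 0"
  shows "potential_deriv m \<alpha> UNIV y u = potential_deriv m \<alpha> K y u + external_power m \<alpha> K y u"
proof -
  define g where "g i j = m i * m j * norm (y $ i - y $ j) powr (- \<alpha> - 2) *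
    ((y $ i - y $ j) \<bullet> (u $ i - u $ j))" for i j
  have drop: "(\<Sum>j\<in>A - {i}. g i j) = (\<Sum>j\<in>A. g i j)" for i A
    by (rule sum.mono_neutral_left) (auto simp: g_def)
  have U: "(\<Sum>i\<in>UNIV. f i) = (\<Sum>i\<in>K. f i) + (\<Sum>i\<in>- K. f i)" for f :: "'n \<Rightarrow> real"
    using sum.union_disjoint[of K "- K" f] by simp
  have sym: "g i j = g j i" for i j
  proof -
    have "(y $ i - y $ j) \<bullet> (u $ i - u $ j) = (y $ j - y $ i) \<bullet> (u $ j - u $ i)"
      by (metis inner_minus_left inner_minus_right minus_diff_eq minus_minus)
    then show ?thesis by (simp add: g_def norm_minus_commute mult.commute)
  qed
  have "(\<Sum>i\<in>- K. \<Sum>j\<in>K. g i j) = (\<Sum>i\<in>K. \<Sum>j\<in>- K. g i j)"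
    by (subst sum.swap) (simp add: sym)
  moreover have "(\<Sum>i\<in>- K. \<Sum>j\<in>- K. g i j) = 0"
    by (intro sum.neutral ballI) (simp add: g_def assms)
  ultimately have "(\<Sum>i\<in>UNIV. \<Sum>j\<in>UNIV. g i j) =
      (\<Sum>i\<in>K. \<Sum>j\<in>K. g i j) + 2 * (\<Sum>i\<in>K. \<Sum>j\<in>- K. g i j)"
    unfolding U by (simp add: sum.distrib)
  moreover have "(\<Sum>i\<in>K. \<Sum>j\<in>- K. g i j) = (\<Sum>i\<in>K. \<Sum>j\<in>- K.
     m i * m j * norm (y $ i - y $ j) powr (- \<alpha> - 2) * ((y $ i - y $ j) \<bullet> u $ i))"
    by (intro sum.cong refl) (simp add: g_def assms)
  ultimately show ?thesis
    unfolding potential_deriv_def external_power_def g_def[symmetric] drop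
    by (simp add: algebra_simps)
qed

text \<open>
  A one-collision solution \<open>x\<close> with velocity \<open>v\<close>, acceleration \<open>a\<close> and colliding cluster \<open>K\<close>.
\<close>

locale cluster_collision =
  fixes m :: "'n::finite \<Rightarrow> real" and \<alpha> :: real
    and x v a :: "real \<Rightarrow> real ^ 'd::finite ^ 'n" and K :: "'n set"
  assumes mass_pos: "\<And>i. 0 < m i"
    and alpha: "0 < \<alpha>" "\<alpha> < 2"
    and continuous_x: "continuous_on {0..1} x"
    and no_collision: "\<And>t. 0 \<le> t \<Longrightarrow> t < 1 \<Longrightarrow> x t \<notin> collision_set UNIV"
    and deriv_x: "\<And>t. 0 < t \<Longrightarrow> t < 1 \<Longrightarrow> (x has_vector_derivative v t) (at t)"
    and deriv_v: "\<And>t. 0 < t \<Longrightarrow> t < 1 \<Longrightarrow> (v has_vector_derivative a t) (at t)"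
    and newton: "\<And>t. 0 < t \<Longrightarrow> t < 1 \<Longrightarrow> GDERIV (potential m \<alpha> UNIV) (x t) :> mass_mult m (a t)"
    and finite_action: "action m \<alpha> x < \<infinity>"
    and cluster: "colliding_cluster x K"
begin

abbreviation U :: "(real ^ 'd ^ 'n) \<Rightarrow> real" where "U \<equiv> potential m \<alpha> K"
abbreviation ip :: "(real ^ 'd ^ 'n) \<Rightarrow> (real ^ 'd ^ 'n) \<Rightarrow> real" where "ip \<equiv> mass_inner m"

text \<open>
  The motion \<open>y\<close> of the cluster relative to its centre of mass, its velocity \<open>w\<close> and its radius \<open>r\<close>.
\<close>

definition y :: "real \<Rightarrow> real ^ 'd ^ 'n" where "y t = centred_part m K (x t)"
definition w :: "real \<Rightarrow> real ^ 'd ^ 'n" where "w t = centred_part m K (v t)"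
definition r :: "real \<Rightarrow> real" where "r t = cluster_radius m K x t"

lemma cluster_path_eq: "cluster_path m K x t = y t"
  by (simp add: cluster_path_def y_def centred_part_def relative_path_def vec_eq_iff)

lemma r_power2: "(r t)\<^sup>2 = ip (y t) (y t)"
  by (simp add: r_def cluster_radius_def cluster_path_eq mass_norm_power2 mass_pos)

lemma r_nonneg: "0 \<le> r t"
  by (simp add: r_def cluster_radius_def mass_norm_def inertia_def mass_inner_nonneg mass_pos)

lemma two_bodies: "\<exists>i\<in>K. \<exists>j\<in>K. i \<noteq> j"
  using cluster unfolding colliding_cluster_def
  by (metis card_2_iff' obtain_subset_with_card_n subset_eq)

lemma y_no_collision:
  assumes "0 \<le> t" "t < 1"
  shows "y t \<notin> collision_set K"
  using no_collision[OF assms] unfolding y_def collision_centred_part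
  by (auto simp: collision_set_def)

lemma y_nonzero: "0 \<le> t \<Longrightarrow> t < 1 \<Longrightarrow> y t \<noteq> 0"
  using y_no_collision[of t] two_bodies by (force simp: collision_set_def)

lemma r_pos: "0 \<le> t \<Longrightarrow> t < 1 \<Longrightarrow> 0 < r t"
  using mass_inner_pos[of m, OF mass_pos y_nonzero, of t] r_nonneg[of t] r_power2[of t]
  by (cases "r t = 0") auto

lemma r_1: "r 1 = 0"
proof -
  have nonempty: "K \<noteq> {}" using two_bodies by auto
  then obtain k where k: "k \<in> K" by auto
  have eq: "x 1 $ i = x 1 $ k" if "i \<in> K" for i
    using cluster k that unfolding colliding_cluster_def by blast
  have "(\<Sum>i\<in>K. m i) > 0" using nonempty mass_pos by (intro sum_pos) auto
  moreover have "(\<Sum>i\<in>K. m i *\<^sub>R x 1 $ i) = (\<Sum>i\<in>K. m i) *\<^sub>R x 1 $ k"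
    by (simp add: eq scaleR_sum_left)
  ultimately have "y 1 = 0" by (simp add: y_def centred_part_def vec_eq_iff centre_of_mass_def eq)
  then have "(r 1)\<^sup>2 = 0" by (simp add: r_power2 mass_inner_simps)
  then show ?thesis by simp
qed

lemma r_eq: "r t = sqrt (ip (y t) (y t))"
  using r_power2[of t] r_nonneg[of t] by (metis real_sqrt_unique)

lemma continuous_y: "continuous_on {0..1} y"
  unfolding y_def[abs_def]
  by (rule bounded_linear.continuous_on[OF bounded_linear_centred_part continuous_x])

lemma continuous_r: "continuous_on {0..1} r"
  unfolding r_eq[abs_def] by (intro continuous_intros continuous_y)

lemma deriv_y: "0 < t \<Longrightarrow> t < 1 \<Longrightarrow> (y has_vector_derivative w t) (at t)"
  unfolding y_def[abs_def] w_def
  by (rule bounded_linear.has_vector_derivative[OF bounded_linear_centred_part deriv_x])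

lemma deriv_w: "0 < t \<Longrightarrow> t < 1 \<Longrightarrow> (w has_vector_derivative centred_part m K (a t)) (at t)"
  unfolding w_def[abs_def]
  by (rule bounded_linear.has_vector_derivative[OF bounded_linear_centred_part deriv_v])

lemma centred: "y t \<in> centred_space m K" "w t \<in> centred_space m K"
  unfolding y_def w_def by (rule centred_part_in_centred_space[OF mass_pos])+

text \<open>The equation of motion, tested against a displacement.\<close>

lemma newton_weak:
  assumes "0 < t" "t < 1"
  shows "ip (a t) u = potential_deriv m \<alpha> UNIV (x t) u"
proof -
  have "(potential m \<alpha> UNIV has_derivative (\<lambda>h. h \<bullet> mass_mult m (a t))) (at (x t))"
    using newton[OF assms] by (simp add: gderiv_def)
  from has_derivative_unique[OF this has_derivative_potential] no_collision[of t] assms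
  have "(\<lambda>h. h \<bullet> mass_mult m (a t)) = potential_deriv m \<alpha> UNIV (x t)" by simp
  then show ?thesis by (metis inner_commute mass_inner_def)
qed

text \<open>
  The acceleration of the centre of mass drops out against displacements that preserve this centre.
\<close>

lemma newton_cluster:
  assumes "0 < t" "t < 1" "u \<in> centred_space m K"
  shows "ip (centred_part m K (a t)) u =
    potential_deriv m \<alpha> K (y t) u + external_power m \<alpha> K (x t) u"
  using assms
  by (subst mass_inner_centred_part)
    (auto simp: newton_weak y_def potential_deriv_centred_part centred_space_def
      intro: potential_deriv_split)

lemma has_real_derivative_ip:
  assumes "(f has_vector_derivative f') (at t)" "(g has_vector_derivative g') (at t)"
  shows "((\<lambda>t. ip (f t) (g t)) has_real_derivative ip (f t) g' + ip f' (g t)) (at t)"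
  using bounded_bilinear.has_vector_derivative[OF bounded_bilinear_mass_inner assms]
  by (simp add: has_real_derivative_iff_has_vector_derivative)

text \<open>The energy of the cluster; only the bodies outside the cluster change it.\<close>

definition h :: "real \<Rightarrow> real" where "h t = ip (w t) (w t) / 2 - U (y t)"

lemma deriv_h:
  assumes "0 < t" "t < 1"
  shows "(h has_real_derivative external_power m \<alpha> K (x t) (w t)) (at t)"
proof -
  have "((\<lambda>t. U (y t)) has_real_derivative potential_deriv m \<alpha> K (y t) (w t)) (at t)"
  proof -
    have lin: "potential_deriv m \<alpha> K (y t) (s *\<^sub>R w t) = s * potential_deriv m \<alpha> K (y t) (w t)" for s
      by (simp add: potential_deriv_def sum_distrib_left mult_ac flip: scaleR_diff_right)
    have "((\<lambda>t. U (y t)) has_derivative (\<lambda>s. potential_deriv m \<alpha> K (y t) (s *\<^sub>R w t))) (at t)"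
      using has_derivative_compose[OF deriv_y[OF assms, unfolded has_vector_derivative_def]
          has_derivative_potential[OF y_no_collision]] assms by simp
    then show ?thesis by (simp add: has_field_derivative_def lin mult_commute_abs)
  qed
  moreover have "((\<lambda>t. ip (w t) (w t) / 2) has_real_derivative ip (centred_part m K (a t)) (w t)) (at t)"
    using has_real_derivative_ip[OF deriv_w deriv_w, of t] assms
    by (auto intro!: derivative_eq_intros simp: mass_inner_commute)
  ultimately show ?thesis
    unfolding h_def[abs_def]
    by (rule DERIV_cong[OF DERIV_diff[rotated]])
      (use newton_cluster[OF assms centred(2)] in simp)
qed

text \<open>Half the derivative of \<open>r\<^sup>2\<close>; the next lemma is the Lagrange-Jacobi identity.\<close>

definition j :: "real \<Rightarrow> real" where "j t = ip (y t) (w t)"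

lemma deriv_j:
  assumes "0 < t" "t < 1"
  shows "(j has_real_derivative ip (w t) (w t) - \<alpha> * U (y t) + external_power m \<alpha> K (x t) (y t)) (at t)"
  unfolding j_def[abs_def]
  using has_real_derivative_ip[OF deriv_y deriv_w, of t] assms
    newton_cluster[OF assms centred(1), of t] potential_deriv_self[OF y_no_collision, of t]
  by (auto simp: mass_inner_commute elim!: DERIV_cong)

lemma deriv_r:
  assumes "0 < t" "t < 1"
  shows "(r has_real_derivative j t / r t) (at t)"
proof -
  have pos: "0 < ip (y t) (y t)" using r_pos[of t] assms by (simp flip: r_power2)
  have "((\<lambda>t. ip (y t) (y t)) has_real_derivative 2 * j t) (at t)"
    using has_real_derivative_ip[OF deriv_y deriv_y, of t] assms
    by (auto simp: j_def mass_inner_commute elim!: DERIV_cong)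
  from DERIV_chain2[OF DERIV_real_sqrt[OF pos] this] show ?thesis
    unfolding r_eq[abs_def] by (rule DERIV_cong) (simp add: field_simps)
qed

lemma deriv_r_powr:
  assumes "0 < t" "t < 1"
  shows "((\<lambda>t. r t powr q) has_real_derivative q * r t powr (q - 2) * j t) (at t)"
proof -
  have pos: "0 < r t" using r_pos[of t] assms by simp
  have eq: "q * r t powr (q - 1) * (j t / r t) = q * r t powr (q - 2) * j t"
    using pos by (simp add: powr_diff field_simps power2_eq_square)
  show ?thesis
    using DERIV_chain2[OF has_real_derivative_powr[OF pos] deriv_r[OF assms], of q]
    unfolding eq .
qed

text \<open>The bodies outside the cluster stay away from it, up to and including the collision.\<close>

lemma external_distance:
  "\<exists>d>0. \<forall>t\<in>{0..1}. \<forall>i\<in>K. \<forall>k\<in>- K. d \<le> norm (x t $ i - x t $ k)"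
proof -
  have "\<exists>d>0. \<forall>t\<in>{0..1}. d \<le> norm (x t $ i - x t $ k)" if "i \<in> K" "k \<notin> K" for i k
  proof -
    have "continuous_on {0..1} (\<lambda>t. norm (x t $ i - x t $ k))"
      by (intro continuous_intros continuous_x)
    then obtain t0 where t0: "t0 \<in> {0..1}"
        "\<And>t. t \<in> {0..1} \<Longrightarrow> norm (x t0 $ i - x t0 $ k) \<le> norm (x t $ i - x t $ k)"
      using continuous_attains_inf[of "{0..1::real}"] by force
    have "x t0 $ i \<noteq> x t0 $ k"
    proof (cases "t0 = 1")
      case True
      then show ?thesis using cluster that unfolding colliding_cluster_def by blast
    next
      case False
      then show ?thesis
        using not_collisionD[OF no_collision[of t0], of i k] t0 that by force
    qed
    with t0 show ?thesis by (intro exI[of _ "norm (x t0 $ i - x t0 $ k)"]) auto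
  qed
  then obtain D where D: "\<And>i k. i \<in> K \<Longrightarrow> k \<notin> K \<Longrightarrow>
      0 < D i k \<and> (\<forall>t\<in>{0..1}. D i k \<le> norm (x t $ i - x t $ k))"
    by metis
  define d where "d = Min (insert 1 ((\<lambda>(i, k). D i k) ` (K \<times> - K)))"
  have "0 < d" using D by (auto simp: d_def)
  moreover have "d \<le> D i k" if "i \<in> K" "k \<notin> K" for i k
    unfolding d_def using that by (intro Min_le) auto
  ultimately show ?thesis
    using D by (intro exI[of _ d]) (fastforce intro: order_trans)
qed

lemma external_power_bound:
  "\<exists>C\<ge>0. \<forall>t\<in>{0..1}. \<forall>u. \<bar>external_power m \<alpha> K (x t) u\<bar> \<le> C * norm u"
proof -
  obtain d where d: "0 < d"
    "\<And>t i k. 0 \<le> t \<Longrightarrow> t \<le> 1 \<Longrightarrow> i \<in> K \<Longrightarrow> k \<notin> K \<Longrightarrow> d \<le> norm (x t $ i - x t $ k)"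
    using external_distance by force
  define C where "C = \<alpha> * (\<Sum>i\<in>K. \<Sum>k\<in>- K. m i * m k * d powr (- \<alpha> - 1))"
  have m0: "0 \<le> m i" for i using mass_pos[of i] by simp
  show ?thesis
  proof (intro exI[of _ C] conjI ballI allI)
    show "0 \<le> C" unfolding C_def using alpha m0 by (intro mult_nonneg_nonneg sum_nonneg) auto
    fix t :: real and u :: "real ^ 'd ^ 'n" assume "t \<in> {0..1}"
    then have t: "0 \<le> t" "t \<le> 1" by auto
    have term_bound: "\<bar>m i * m k * norm (x t $ i - x t $ k) powr (- \<alpha> - 2) * ((x t $ i - x t $ k) \<bullet> u $ i)\<bar>
        \<le> m i * m k * d powr (- \<alpha> - 1) * norm u" if "i \<in> K" "k \<in> - K" for i k
    proof -
      let ?z = "x t $ i - x t $ k"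
      have dz: "d \<le> norm ?z" using d(2)[OF t] that by auto
      then have z: "0 < norm ?z" using d(1) by linarith
      have "norm ?z powr (- \<alpha> - 2) * \<bar>?z \<bullet> u $ i\<bar> \<le> norm ?z powr (- \<alpha> - 2) * (norm ?z * norm u)"
        by (intro mult_left_mono order_trans[OF Cauchy_Schwarz_ineq2] mult_mono Finite_Cartesian_Product.norm_nth_le) auto
      also have "\<dots> = norm ?z powr (- \<alpha> - 1) * norm u"
      proof -
        have exponent: "- \<alpha> - 1 = (- \<alpha> - 2) + 1" by simp
        show ?thesis unfolding exponent powr_add using z by simp
      qed
      also have "\<dots> \<le> d powr (- \<alpha> - 1) * norm u"
        using d(1) dz alpha by (intro mult_right_mono powr_mono2') auto
      finally have "(m i * m k) * (norm ?z powr (- \<alpha> - 2) * \<bar>?z \<bullet> u $ i\<bar>)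
          \<le> (m i * m k) * (d powr (- \<alpha> - 1) * norm u)"
        using m0 by (intro mult_left_mono) auto
      then show ?thesis using m0[of i] m0[of k] by (simp add: abs_mult mult_ac)
    qed
    have "\<bar>\<Sum>i\<in>K. \<Sum>k\<in>- K. m i * m k * norm (x t $ i - x t $ k) powr (- \<alpha> - 2) *
        ((x t $ i - x t $ k) \<bullet> u $ i)\<bar> \<le> (\<Sum>i\<in>K. \<Sum>k\<in>- K. m i * m k * d powr (- \<alpha> - 1) * norm u)"
      by (intro order_trans[OF sum_abs] sum_mono term_bound)
    from mult_left_mono[OF this, of \<alpha>] show "\<bar>external_power m \<alpha> K (x t) u\<bar> \<le> C * norm u"
      using alpha by (simp add: external_power_def C_def abs_mult sum_distrib_right mult.assoc)
  qed
qed

text \<open>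
  The velocities are square integrable, so the energy of the cluster stays bounded. Estimates near the
  collision are made on \<open>[1/2, 1)\<close>, because \<open>x\<close> need not be differentiable at \<open>0\<close>.
\<close>

lemma energy_bound: "\<exists>H. \<forall>t\<in>{1/2..<1}. \<bar>h t\<bar> \<le> H"
proof -
  obtain C where C: "0 \<le> C"
    "\<And>t u. 0 \<le> t \<Longrightarrow> t \<le> 1 \<Longrightarrow> \<bar>external_power m \<alpha> K (x t) u\<bar> \<le> C * norm u"
    using external_power_bound by force
  obtain B where B: "0 < B" "\<And>u :: real ^ 'd ^ 'n. norm (centred_part m K u) \<le> norm u * B"
    using bounded_linear.pos_bounded[OF bounded_linear_centred_part] by blast
  obtain M where M: "0 < M" "\<And>u :: real ^ 'd ^ 'n. (norm u)\<^sup>2 \<le> M * ip u u"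
    using norm_le_mass_inner[of m, OF mass_pos] by blast
  define q where "q t = ip (v t) (v t) / 2" for t
  define E where "E = (\<integral>\<^sup>+t\<in>{0<..<1}. ennreal (q t) \<partial>lborel)"
  have q0: "0 \<le> q t" for t by (simp add: q_def mass_inner_nonneg mass_pos)
  have "E \<le> action m \<alpha> x"
  proof -
    have "E = (\<integral>\<^sup>+t\<in>{0<..<1}. ennreal (1/2 * (mass_norm m (vector_derivative x (at t)))\<^sup>2) \<partial>lborel)"
      unfolding E_def
      by (rule nn_integral_cong)
        (auto simp: q_def vector_derivative_at[OF deriv_x] mass_norm_power2 mass_pos
          indicator_def)
    then show ?thesis unfolding action_def by simp
  qed
  then have E: "E < \<infinity>" using finite_action by (rule le_less_trans)
  have cont_q: "continuous_on {1/2..t} q" if "t < 1" for t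
  proof -
    have "continuous_on {1/2..t} v"
      by (rule continuous_at_imp_continuous_on) (use that in \<open>auto intro!: has_vector_derivative_continuous[OF deriv_v]\<close>)
    then show ?thesis unfolding q_def[abs_def] by (intro continuous_intros) auto
  qed
  have int_q: "integral {1/2..t} q \<le> enn2real E" if "1/2 \<le> t" "t < 1" for t
  proof -
    have si: "set_integrable lborel {1/2..t} q"
      by (intro borel_integrable_atLeastAtMost' cont_q that)
    have "ennreal (integral {1/2..t} q) = ennreal (LINT u:{1/2..t}|lborel. q u)"
      by (simp add: set_borel_integral_eq_integral[OF si])
    also have "\<dots> = (\<integral>\<^sup>+u. ennreal (indicator {1/2..t} u *\<^sub>R q u) \<partial>lborel)"
      unfolding set_lebesgue_integral_def
      using si by (intro nn_integral_eq_integral[symmetric]) (auto simp: set_integrable_def q0)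
    also have "\<dots> \<le> E"
      unfolding E_def using that by (intro nn_integral_mono) (auto simp: indicator_def)
    finally show ?thesis using E by (metis enn2real_ennreal enn2real_mono infinity_ennreal_def
          integral_nonneg cont_q integrable_continuous_interval q0 that(2))
  qed
  \<comment> \<open>Bounds the derivative of \<open>h\<close>, since \<open>c \<le> 1 + c\<^sup>2\<close> for the norm \<open>c\<close> of the velocity.\<close>
  define A where "A = C * B"
  define g where "g t = A * (1 + 2 * M * q t)" for t
  have A0: "0 \<le> A" using B(1) C(1) by (simp add: A_def)
  have h'_bound: "\<bar>external_power m \<alpha> K (x t) (w t)\<bar> \<le> g t" if "0 < t" "t < 1" for t
  proof -
    have "norm (v t) \<le> 1 + (norm (v t))\<^sup>2"
      using sum_squares_bound[of 1 "norm (v t)"] by (simp add: power2_eq_square)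
        (smt (verit) norm_ge_zero mult_nonneg_nonneg)
    also have "\<dots> \<le> 1 + 2 * M * q t" using M(2)[of "v t"] by (simp add: q_def)
    finally have "norm (v t) * B \<le> (1 + 2 * M * q t) * B" using B(1) by (intro mult_right_mono) auto
    then have "norm (w t) \<le> (1 + 2 * M * q t) * B" using B(2)[of "v t"] by (simp add: w_def)
    from order_trans[OF C(2) mult_left_mono[OF this C(1)], of t] that
    show ?thesis by (simp add: g_def A_def mult_ac)
  qed
  have "\<bar>h t\<bar> \<le> \<bar>h (1/2)\<bar> + A * (1 + 2 * M * enn2real E)" if "1/2 \<le> t" "t < 1" for t
  proof -
    have ftc: "((\<lambda>t. external_power m \<alpha> K (x t) (w t)) has_integral h t - h (1/2)) {1/2..t}"
    proof (rule fundamental_theorem_of_calculus[OF that(1)])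
      fix u assume "u \<in> {1/2..t}"
      then have "0 < u" "u < 1" using that by auto
      from deriv_h[OF this]
      show "(h has_vector_derivative external_power m \<alpha> K (x u) (w u)) (at u within {1/2..t})"
        unfolding has_real_derivative_iff_has_vector_derivative
        by (rule has_vector_derivative_at_within)
    qed
    have "g integrable_on {1/2..t}"
      unfolding g_def[abs_def] using cont_q[OF that(2)]
      by (intro integrable_continuous_interval continuous_intros)
    then have "norm (integral {1/2..t} (\<lambda>t. external_power m \<alpha> K (x t) (w t))) \<le> integral {1/2..t} g"
      using has_integral_integrable[OF ftc] h'_bound that
      by (intro integral_norm_bound_integral) auto
    then have "norm (h t - h (1/2)) \<le> integral {1/2..t} g"
      unfolding integral_unique[OF ftc] .
    also have "integral {1/2..t} g = A * ((t - 1/2) + 2 * M * integral {1/2..t} q)"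
      using cont_q[OF that(2)] that unfolding g_def[abs_def]
      by (simp add: integral_add integrable_continuous_interval continuous_intros)
    also have "\<dots> \<le> A * (1 + 2 * M * enn2real E)"
      using A0 M(1) int_q[OF that] that by (intro mult_left_mono add_mono) auto
    finally show ?thesis by auto
  qed
  then show ?thesis by (intro exI) auto
qed

section \<open>Blow-up coordinates and the new time\<close>

text \<open>
  The functions below are functions of the original time \<open>t\<close>. With \<open>d\<tau> = dt / D\<close>, \<open>p\<close> is the
  logarithmic derivative of \<open>r\<close> with respect to \<open>\<tau>\<close>, and \<open>p_rate\<close>, \<open>s_rate\<close> are the derivatives of
  \<open>p\<close> and of the normalised configuration \<open>s\<close> with respect to \<open>\<tau>\<close>.
\<close>

definition D :: "real \<Rightarrow> real" where "D t = r t powr (1 + \<alpha> / 2)"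
definition p :: "real \<Rightarrow> real" where "p t = j t * r t powr (\<alpha> / 2 - 1)"
definition s :: "real \<Rightarrow> real ^ 'd ^ 'n" where "s t = y t /\<^sub>R r t"
definition s_rate :: "real \<Rightarrow> real ^ 'd ^ 'n" where
  "s_rate t = r t powr (\<alpha> / 2) *\<^sub>R w t - p t *\<^sub>R s t"
definition p_rate :: "real \<Rightarrow> real" where
  "p_rate t = (1 - \<alpha> / 2) * (2 * U (s t) - (p t)\<^sup>2) + 2 * r t powr \<alpha> * h t +
     r t powr \<alpha> * external_power m \<alpha> K (x t) (y t)"

lemma D_pos: "0 \<le> t \<Longrightarrow> t < 1 \<Longrightarrow> 0 < D t"
  using r_pos[of t] by (simp add: D_def)

lemma U_s:
  assumes "0 \<le> t" "t < 1"
  shows "U (s t) = r t powr \<alpha> * U (y t)"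
  using r_pos[OF assms] by (simp add: s_def potential_scaleR powr_minus inverse_powr)

lemma s_unit:
  assumes "0 \<le> t" "t < 1"
  shows "ip (s t) (s t) = 1"
  using r_pos[OF assms] r_power2[of t, symmetric]
  by (simp add: s_def mass_inner_simps power2_eq_square field_simps)

lemma s_in_ellipsoid:
  assumes "0 \<le> t" "t < 1"
  shows "s t \<in> centred_space m K" "s t \<notin> collision_set K"
proof -
  have "(\<Sum>i\<in>K. m i *\<^sub>R s t $ i) = (\<Sum>i\<in>K. m i *\<^sub>R y t $ i) /\<^sub>R r t"
    by (simp add: s_def scaleR_sum_right mult.commute)
  then show "s t \<in> centred_space m K" "s t \<notin> collision_set K"
    using centred(1)[of t] y_no_collision[OF assms] r_pos[OF assms]
    by (auto simp: s_def centred_space_def collision_set_def)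
qed

text \<open>All the powers of \<open>r\<close> that occur, in terms of \<open>r powr (\<alpha> / 2)\<close>.\<close>

lemma r_powrs:
  assumes "0 \<le> t" "t < 1"
  shows "D t = r t powr (\<alpha> / 2) * r t" "r t powr (\<alpha> / 2 - 1) = r t powr (\<alpha> / 2) / r t"
    "r t powr (\<alpha> / 2 - 1 - 2) = r t powr (\<alpha> / 2) / r t ^ 3"
    "r t powr \<alpha> = r t powr (\<alpha> / 2) * r t powr (\<alpha> / 2)"
proof -
  have pos: "0 < r t" using r_pos[OF assms] .
  show "D t = r t powr (\<alpha> / 2) * r t"
    unfolding D_def powr_add using pos by (simp add: mult.commute)
  show "r t powr (\<alpha> / 2 - 1) = r t powr (\<alpha> / 2) / r t"
    unfolding powr_diff using pos by simp
  show "r t powr (\<alpha> / 2 - 1 - 2) = r t powr (\<alpha> / 2) / r t ^ 3"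
    unfolding powr_diff using pos by (simp add: power2_eq_square power3_eq_cube)
  show "r t powr \<alpha> = r t powr (\<alpha> / 2) * r t powr (\<alpha> / 2)"
    unfolding powr_add[symmetric] by simp
qed

lemma deriv_ln_r:
  assumes "0 < t" "t < 1"
  shows "((\<lambda>t. ln (r t)) has_real_derivative p t / D t) (at t)"
proof -
  have pos: "0 < r t" "0 < r t powr (\<alpha> / 2)" using r_pos[of t] assms by auto
  have "((\<lambda>t. ln (r t)) has_real_derivative 1 / r t * (j t / r t)) (at t)"
    using DERIV_chain2[OF DERIV_ln_divide[OF pos(1)] deriv_r[OF assms]] .
  then show ?thesis
    unfolding p_def r_powrs[OF less_imp_le[OF assms(1)] assms(2)]
    by (rule DERIV_cong) (use pos in \<open>simp add: field_simps\<close>)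
qed

lemma deriv_p:
  assumes "0 < t" "t < 1"
  shows "(p has_real_derivative p_rate t / D t) (at t)"
proof -
  have pos: "0 < r t" "0 < r t powr (\<alpha> / 2)" using r_pos[of t] assms by auto
  define R where "R = r t powr (\<alpha> / 2)"
  have eq: "(ip (w t) (w t) - \<alpha> * U (y t) + external_power m \<alpha> K (x t) (y t)) * r t powr (\<alpha> / 2 - 1) +
      (\<alpha> / 2 - 1) * r t powr (\<alpha> / 2 - 1 - 2) * j t * j t = p_rate t / D t"
    using pos unfolding p_rate_def p_def h_def U_s[OF less_imp_le[OF assms(1)] assms(2)]
      r_powrs[OF less_imp_le[OF assms(1)] assms(2)] R_def[symmetric]
    by (simp add: field_simps power2_eq_square power3_eq_cube)
  show ?thesis
    using DERIV_mult[OF deriv_j[OF assms] deriv_r_powr[OF assms, of "\<alpha> / 2 - 1"]]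
    unfolding p_def[abs_def] eq .
qed

lemma deriv_s:
  assumes "0 < t" "t < 1"
  shows "(s has_vector_derivative s_rate t /\<^sub>R D t) (at t)"
proof -
  have pos: "0 < r t" "0 < r t powr (\<alpha> / 2)" using r_pos[of t] assms by auto
  have "((\<lambda>t. inverse (r t)) has_real_derivative - (j t / r t ^ 3)) (at t)"
    using DERIV_inverse_fun[OF deriv_r[OF assms]] pos
    by (auto simp: field_simps power2_eq_square power3_eq_cube elim!: DERIV_cong)
  from has_vector_derivative_scaleR[OF this deriv_y[OF assms]]
  have "(s has_vector_derivative inverse (r t) *\<^sub>R w t + (- (j t / r t ^ 3)) *\<^sub>R y t) (at t)"
    by (simp add: s_def[abs_def])
  moreover have "s_rate t /\<^sub>R D t = inverse (r t) *\<^sub>R w t + (- (j t / r t ^ 3)) *\<^sub>R y t"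
    using pos unfolding s_rate_def p_def s_def r_powrs[OF less_imp_le[OF assms(1)] assms(2)]
    by (simp add: scaleR_diff_right field_simps power3_eq_cube)
  ultimately show ?thesis by simp
qed

text \<open>The conservation of energy, in the new coordinates.\<close>

lemma s_rate_norm:
  assumes "0 < t" "t < 1"
  shows "ip (s_rate t) (s_rate t) = 2 * U (s t) + 2 * r t powr \<alpha> * h t - (p t)\<^sup>2"
proof -
  have pos: "0 < r t" "0 < r t powr (\<alpha> / 2)" using r_pos[of t] assms by auto
  have sw: "ip (w t) (s t) = j t / r t"
    by (simp add: s_def j_def mass_inner_simps divide_inverse mass_inner_commute)
  have p: "p t = r t powr (\<alpha> / 2) * (j t / r t)"
    using assms by (simp add: p_def r_powrs)
  have "ip (s_rate t) (s_rate t) = (r t powr (\<alpha> / 2))\<^sup>2 * ip (w t) (w t)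
      - 2 * p t * (r t powr (\<alpha> / 2) * ip (w t) (s t)) + (p t)\<^sup>2 * ip (s t) (s t)"
    by (simp add: s_rate_def mass_inner_simps mass_inner_commute[of m "s t" "w t"]
        power2_eq_square algebra_simps)
  also have "\<dots> = r t powr \<alpha> * ip (w t) (w t) - (p t)\<^sup>2"
    unfolding sw p[symmetric] s_unit[OF less_imp_le[OF assms(1)] assms(2)]
      r_powrs(4)[OF less_imp_le[OF assms(1)] assms(2)]
    by (simp add: power2_eq_square)
  also have "r t powr \<alpha> * ip (w t) (w t) = 2 * U (s t) + 2 * r t powr \<alpha> * h t"
    using assms by (simp add: U_s h_def algebra_simps)
  finally show ?thesis by simp
qed

lemma perturbation_bound:
  "\<exists>C\<ge>0. \<forall>t\<in>{1/2..<1}. \<bar>h t\<bar> \<le> C \<and> \<bar>external_power m \<alpha> K (x t) (y t)\<bar> \<le> C"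
proof -
  obtain H where H: "\<forall>t\<in>{1/2..<1}. \<bar>h t\<bar> \<le> H" using energy_bound by blast
  obtain C where C: "0 \<le> C" "\<forall>t\<in>{0..1}. \<forall>u. \<bar>external_power m \<alpha> K (x t) u\<bar> \<le> C * norm u"
    using external_power_bound by blast
  have "compact (y ` {0..1})" by (intro compact_continuous_image continuous_y) auto
  then obtain B where B: "\<forall>t\<in>{0..1}. norm (y t) \<le> B"
    using compact_imp_bounded bounded_iff by (metis (mono_tags, lifting) imageI)
  have "\<bar>external_power m \<alpha> K (x t) (y t)\<bar> \<le> C * B" if "t \<in> {1/2..<1}" for t
  proof -
    have t: "t \<in> {0..1}" using that by auto
    have "\<bar>external_power m \<alpha> K (x t) (y t)\<bar> \<le> C * norm (y t)" using C(2) t by blast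
    also have "\<dots> \<le> C * B" using C(1) B t by (intro mult_left_mono) auto
    finally show ?thesis .
  qed
  with H show ?thesis
    by (intro exI[of _ "max 0 (max H (C * B))"]) (auto simp: le_max_iff_disj)
qed

text \<open>
  By the energy identity, \<open>p_rate\<close> is \<open>(1 - \<alpha> / 2)\<close> times the square of \<open>s_rate\<close>, up to bounded terms.
\<close>

lemma p_rate_lower: "\<exists>C\<ge>0. \<forall>t\<in>{1/2..<1}. - C \<le> p_rate t"
proof -
  obtain C where C: "0 \<le> C"
    "\<forall>t\<in>{1/2..<1}. \<bar>h t\<bar> \<le> C \<and> \<bar>external_power m \<alpha> K (x t) (y t)\<bar> \<le> C"
    using perturbation_bound by blast
  have "compact (r ` {0..1})" by (intro compact_continuous_image continuous_r) auto
  then obtain B where B: "\<forall>t\<in>{0..1}. \<bar>r t\<bar> \<le> B"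
    using compact_imp_bounded bounded_iff by (metis (mono_tags, lifting) imageI real_norm_def)
  define A where "A = B powr \<alpha> * C"
  have "- (3 * A) \<le> p_rate t" if "t \<in> {1/2..<1}" for t
  proof -
    have t: "0 < t" "t < 1" "t \<in> {0..1}" using that by auto
    have "r t \<le> B" using B t(3) abs_le_D1 by blast
    then have "r t powr \<alpha> \<le> B powr \<alpha>"
      using r_nonneg[of t] alpha by (intro powr_mono2) auto
    then have b: "\<bar>r t powr \<alpha> * h t\<bar> \<le> A" "\<bar>r t powr \<alpha> * external_power m \<alpha> K (x t) (y t)\<bar> \<le> A"
      using C that unfolding abs_mult A_def by (auto intro!: mult_mono)
    have energy: "2 * U (s t) - (p t)\<^sup>2 = ip (s_rate t) (s_rate t) - 2 * r t powr \<alpha> * h t"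
      using s_rate_norm[OF t(1,2)] by simp
    have "p_rate t = (1 - \<alpha> / 2) * ip (s_rate t) (s_rate t) + \<alpha> * (r t powr \<alpha> * h t) +
        r t powr \<alpha> * external_power m \<alpha> K (x t) (y t)"
      unfolding p_rate_def energy by (simp add: algebra_simps)
    moreover have "0 \<le> (1 - \<alpha> / 2) * ip (s_rate t) (s_rate t)"
      using alpha by (intro mult_nonneg_nonneg mass_inner_nonneg mass_pos) auto
    moreover have "\<bar>\<alpha> * (r t powr \<alpha> * h t)\<bar> \<le> 2 * A"
      using b(1) alpha unfolding abs_mult[of \<alpha>] by (intro mult_mono) auto
    ultimately show ?thesis using b(2) by linarith
  qed
  moreover have "0 \<le> 3 * A" using C(1) by (simp add: A_def)
  ultimately show ?thesis by blast
qed

text \<open>The new time as a function of the original one, and its inverse.\<close>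

definition \<Theta> :: "real \<Rightarrow> real" where "\<Theta> = new_time m \<alpha> K x"
definition \<theta> :: "real \<Rightarrow> real" where "\<theta> = old_time m \<alpha> K x"

lemma \<Theta>_eq: "\<Theta> t = integral {0..t} (\<lambda>u. 1 / D u)"
proof -
  have "r u powr (- (2 + \<alpha>) / 2) = 1 / D u" for u
    using powr_minus_divide[of "r u" "1 + \<alpha> / 2"] by (simp add: D_def diff_divide_distrib)
  then show ?thesis by (simp add: \<Theta>_def new_time_def flip: r_def)
qed

lemma continuous_inv_D: "b < 1 \<Longrightarrow> continuous_on {0..b} (\<lambda>u. 1 / D u)"
  using r_pos D_pos unfolding D_def
  by (intro continuous_intros continuous_on_subset[OF continuous_r]) force+

lemma continuous_\<Theta>: "b < 1 \<Longrightarrow> continuous_on {0..b} \<Theta>"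
  unfolding \<Theta>_eq[abs_def]
  by (intro indefinite_integral_continuous_1 integrable_continuous_interval continuous_inv_D)

lemma deriv_\<Theta>:
  assumes "0 < t" "t < 1"
  shows "(\<Theta> has_real_derivative 1 / D t) (at t)"
proof -
  define b where "b = (1 + t) / 2"
  have b: "b < 1" "t < b" using assms by (auto simp: b_def)
  have "(\<Theta> has_real_derivative 1 / D t) (at t within {0..b})"
    unfolding \<Theta>_eq[abs_def]
    using b assms by (intro integral_has_real_derivative continuous_inv_D) auto
  moreover have "at t within {0..b} = at t"
    using b assms by (intro at_within_interior) auto
  ultimately show ?thesis by simp
qed

lemma \<Theta>_less:
  assumes "0 \<le> t" "t < t'" "t' < 1"
  shows "\<Theta> t < \<Theta> t'"
proof (rule DERIV_pos_imp_increasing_open[OF assms(2)])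
  show "continuous_on {t..t'} \<Theta>"
    by (rule continuous_on_subset[OF continuous_\<Theta>[OF assms(3)]]) (use assms in auto)
  fix u assume "t < u" "u < t'"
  then show "\<exists>z. (\<Theta> has_real_derivative z) (at u) \<and> 0 < z"
    using deriv_\<Theta>[of u] D_pos[of u] assms by (intro exI[of _ "1 / D u"]) auto
qed

lemma \<Theta>_0: "\<Theta> 0 = 0" by (simp add: \<Theta>_eq)

text \<open>
  The collision takes place at infinite new time: otherwise \<open>p\<close>, whose derivative is bounded below,
  would be bounded below, and then also its primitive \<open>ln r\<close>.
\<close>

lemma \<Theta>_unbounded: "\<exists>t. 0 \<le> t \<and> t < 1 \<and> B < \<Theta> t"
proof (rule ccontr)
  assume "\<not> ?thesis"
  then have B: "\<Theta> t \<le> B" if "0 \<le> t" "t < 1" for t using that by force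
  obtain C where C: "0 \<le> C" "\<forall>t\<in>{1/2..<1}. - C \<le> p_rate t" using p_rate_lower by blast
  define Q where "Q = max 0 (C * B - C * \<Theta> (1/2) - p (1/2))"
  have p_low: "- Q \<le> p t" if t: "1/2 \<le> t" "t < 1" for t
  proof -
    have "p (1/2) + C * \<Theta> (1/2) \<le> p t + C * \<Theta> t"
    proof (rule DERIV_nonneg_imp_nondecreasing[OF t(1)])
      fix u assume u: "1/2 \<le> u" "u \<le> t"
      have "((\<lambda>t. p t + C * \<Theta> t) has_real_derivative p_rate u / D u + C * (1 / D u)) (at u)"
        using u t by (intro DERIV_add DERIV_cmult deriv_p deriv_\<Theta>) auto
      moreover have "0 \<le> p_rate u / D u + C * (1 / D u)"
      proof -
        have "- C \<le> p_rate u" "0 < D u" using C(2) u t D_pos[of u] by auto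
        then show ?thesis by (simp add: field_simps)
      qed
      ultimately show "\<exists>z. ((\<lambda>t. p t + C * \<Theta> t) has_real_derivative z) (at u) \<and> 0 \<le> z" by blast
    qed
    moreover have "C * \<Theta> t \<le> C * B" using C(1) B t by (intro mult_left_mono) auto
    ultimately show ?thesis by (simp add: Q_def)
  qed
  define Z where "Z = exp (ln (r (1/2)) + Q * \<Theta> (1/2) - Q * B)"
  have r_low: "Z \<le> r t" if t: "1/2 \<le> t" "t < 1" for t
  proof -
    have "ln (r (1/2)) + Q * \<Theta> (1/2) \<le> ln (r t) + Q * \<Theta> t"
    proof (rule DERIV_nonneg_imp_nondecreasing[OF t(1)])
      fix u assume u: "1/2 \<le> u" "u \<le> t"
      have "((\<lambda>t. ln (r t) + Q * \<Theta> t) has_real_derivative p u / D u + Q * (1 / D u)) (at u)"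
        using u t by (intro DERIV_add DERIV_cmult deriv_ln_r deriv_\<Theta>) auto
      moreover have "0 \<le> p u / D u + Q * (1 / D u)"
      proof -
        have "- Q \<le> p u" "0 < D u" using p_low[of u] u t D_pos[of u] by auto
        then show ?thesis by (simp add: field_simps)
      qed
      ultimately show "\<exists>z. ((\<lambda>t. ln (r t) + Q * \<Theta> t) has_real_derivative z) (at u) \<and> 0 \<le> z" by blast
    qed
    moreover have "Q * \<Theta> t \<le> Q * B" using B t by (intro mult_left_mono) (auto simp: Q_def)
    ultimately have "ln (r (1/2)) + Q * \<Theta> (1/2) - Q * B \<le> ln (r t)" by simp
    then have "Z \<le> exp (ln (r t))" unfolding Z_def by simp
    then show ?thesis using r_pos[of t] t by simp
  qed
  have "(r \<longlongrightarrow> r 1) (at 1 within {0..1})"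
    using continuous_r by (simp add: continuous_on_def)
  then have "(r \<longlongrightarrow> 0) (at_left 1)"
    by (simp add: r_1 at_within_Icc_at_left)
  moreover have "eventually (\<lambda>t. Z \<le> r t) (at_left 1)"
    using eventually_at_left_real[of "1/2" "1::real"]
    by (auto elim!: eventually_mono intro: r_low)
  ultimately have "Z \<le> 0" by (rule tendsto_lowerbound) auto
  then show False by (simp add: Z_def)
qed

lemma \<theta>_\<Theta>:
  assumes "0 \<le> t" "t < 1"
  shows "\<theta> (\<Theta> t) = t"
proof -
  have "inj_on \<Theta> {0..<1}"
    by (rule linorder_inj_onI') (use \<Theta>_less in force)
  then show ?thesis
    unfolding \<theta>_def old_time_def \<Theta>_def[symmetric] using assms by (intro inv_into_f_f) auto
qed

lemma \<Theta>_surj: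
  assumes "0 \<le> \<tau>"
  shows "\<exists>t. 0 \<le> t \<and> t < 1 \<and> \<Theta> t = \<tau>"
proof -
  obtain b where b: "0 \<le> b" "b < 1" "\<tau> < \<Theta> b" using \<Theta>_unbounded by blast
  obtain t where "0 \<le> t" "t \<le> b" "\<Theta> t = \<tau>"
    using IVT'[of \<Theta> 0 \<tau> b] continuous_\<Theta>[OF b(2)] b assms by (auto simp: \<Theta>_0)
  with b show ?thesis by (intro exI[of _ t]) auto
qed

lemma \<theta>_range:
  assumes "0 \<le> \<tau>"
  shows "0 \<le> \<theta> \<tau>" "\<theta> \<tau> < 1" "\<Theta> (\<theta> \<tau>) = \<tau>"
  using \<Theta>_surj[OF assms] \<theta>_\<Theta> by auto

lemma \<theta>_pos: "0 < \<tau> \<Longrightarrow> 0 < \<theta> \<tau>"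
  using \<theta>_range[of \<tau>] \<Theta>_0 by (metis less_eq_real_def)

lemma \<theta>_interior: "0 < \<tau> \<Longrightarrow> 0 < \<theta> \<tau>" "0 < \<tau> \<Longrightarrow> \<theta> \<tau> < 1"
  using \<theta>_pos \<theta>_range(2) by auto

lemma \<theta>_mem: "0 < \<tau> \<Longrightarrow> \<theta> \<tau> \<in> {0<..<1}"
  using \<theta>_interior by auto

lemma \<theta>_0: "\<theta> 0 = 0"
  using \<theta>_\<Theta>[of 0] by (simp add: \<Theta>_0)

lemma \<theta>_mono:
  assumes "0 \<le> \<sigma>" "\<sigma> \<le> \<tau>"
  shows "\<theta> \<sigma> \<le> \<theta> \<tau>"
proof (rule ccontr)
  assume "\<not> \<theta> \<sigma> \<le> \<theta> \<tau>"
  then have "\<Theta> (\<theta> \<tau>) < \<Theta> (\<theta> \<sigma>)" using \<theta>_range[of \<tau>] \<theta>_range[of \<sigma>] assms by (intro \<Theta>_less) auto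
  then show False using \<theta>_range[of \<tau>] \<theta>_range[of \<sigma>] assms by simp
qed

lemma continuous_\<theta>: "continuous_on {0..b} \<theta>"
proof (cases "0 \<le> b")
  case True
  have "continuous_on (\<Theta> ` {0..\<theta> b}) \<theta>"
    using \<theta>_range[OF True] by (intro continuous_on_inv continuous_\<Theta>) (auto intro: \<theta>_\<Theta>)
  moreover have "{0..b} \<subseteq> \<Theta> ` {0..\<theta> b}"
  proof
    fix \<tau> assume "\<tau> \<in> {0..b}"
    then show "\<tau> \<in> \<Theta> ` {0..\<theta> b}"
      using \<theta>_range[of \<tau>] \<theta>_mono[of \<tau> b] by (intro image_eqI[of _ _ "\<theta> \<tau>"]) auto
  qed
  ultimately show ?thesis by (rule continuous_on_subset)
qed simp

lemma deriv_\<theta>: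
  assumes "0 < \<tau>"
  shows "(\<theta> has_real_derivative D (\<theta> \<tau>)) (at \<tau>)"
proof -
  have t: "0 < \<theta> \<tau>" "\<theta> \<tau> < 1" using \<theta>_pos[OF assms] \<theta>_range[of \<tau>] assms by auto
  have "isCont \<theta> \<tau>"
    using continuous_on_interior[OF continuous_\<theta>[of "\<tau> + 1"], of \<tau>] assms by simp
  with t have "(\<theta> has_real_derivative inverse (1 / D (\<theta> \<tau>))) (at \<tau>)"
    using D_pos[of "\<theta> \<tau>"] assms
    by (intro DERIV_inverse_function[where f = \<Theta> and a = 0 and b = "\<tau> + 1"] deriv_\<Theta>)
      (auto intro: \<theta>_range)
  then show ?thesis by simp
qed

lemma deriv_p_\<theta>:
  assumes "0 < \<tau>"
  shows "((\<lambda>\<tau>. p (\<theta> \<tau>)) has_real_derivative p_rate (\<theta> \<tau>)) (at \<tau>)"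
  using DERIV_chain2[OF deriv_p deriv_\<theta>[OF assms]] \<theta>_interior[OF assms] D_pos[of "\<theta> \<tau>"]
  by simp

lemma deriv_ln_r_\<theta>:
  assumes "0 < \<tau>"
  shows "((\<lambda>\<tau>. ln (r (\<theta> \<tau>))) has_real_derivative p (\<theta> \<tau>)) (at \<tau>)"
  using DERIV_chain2[OF deriv_ln_r deriv_\<theta>[OF assms]] \<theta>_interior[OF assms] D_pos[of "\<theta> \<tau>"]
  by simp

lemma \<theta>_tendsto: "(\<theta> \<longlongrightarrow> 1) at_top"
proof (rule tendstoI)
  fix e :: real assume "0 < e"
  define t where "t = max 0 (1 - e / 2)"
  have t: "0 \<le> t" "t < 1" "1 - e < t" using \<open>0 < e\<close> by (auto simp: t_def)
  have "0 \<le> \<Theta> t" using \<Theta>_less[of 0 t] t \<Theta>_0 by (cases "t = 0") auto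
  then have "t \<le> \<theta> \<tau> \<and> \<theta> \<tau> < 1" if "\<Theta> t \<le> \<tau>" for \<tau>
    using \<theta>_mono[of "\<Theta> t" \<tau>] \<theta>_\<Theta>[of t] \<theta>_range[of \<tau>] t that by auto
  then show "eventually (\<lambda>\<tau>. dist (\<theta> \<tau>) 1 < e) at_top"
    unfolding eventually_at_top_linorder using t
    by (intro exI[of _ "\<Theta> t"]) (force simp: dist_real_def)
qed

lemma r_\<theta>_tendsto: "((\<lambda>\<tau>. r (\<theta> \<tau>)) \<longlongrightarrow> 0) at_top"
proof -
  have "((\<lambda>\<tau>. r (\<theta> \<tau>)) \<longlongrightarrow> r 1) at_top"
  proof (rule continuous_on_tendsto_compose[OF continuous_r \<theta>_tendsto])
    show "eventually (\<lambda>\<tau>. \<theta> \<tau> \<in> {0..1}) at_top"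
      using eventually_ge_at_top[of 0] by eventually_elim (use \<theta>_range in force)
  qed simp
  then show ?thesis by (simp add: r_1)
qed

lemma ln_r_\<theta>_at_bot: "filterlim (\<lambda>\<tau>. ln (r (\<theta> \<tau>))) at_bot at_top"
proof (rule filterlim_compose[OF ln_at_0])
  have "eventually (\<lambda>\<tau>. 0 < r (\<theta> \<tau>)) at_top"
    using eventually_ge_at_top[of 0] by eventually_elim (use \<theta>_range r_pos in force)
  then show "filterlim (\<lambda>\<tau>. r (\<theta> \<tau>)) (at_right 0) at_top"
    using r_\<theta>_tendsto by (auto simp: filterlim_at elim: eventually_mono)
qed

section \<open>Asymptotics at the collision\<close>

context
  fixes s0 :: "real ^ 'd ^ 'n"
  assumes s_lim: "((\<lambda>\<tau>. s (\<theta> \<tau>)) \<longlongrightarrow> s0) at_top" and s0: "s0 \<notin> collision_set K"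
begin

lemma U_lim: "((\<lambda>\<tau>. U (s (\<theta> \<tau>))) \<longlongrightarrow> U s0) at_top"
  using has_derivative_continuous[OF has_derivative_potential[OF s0]] s_lim
  by (rule isCont_tendsto_compose)

lemma U_s0_pos: "0 < U s0"
  by (rule potential_pos) (use s0 cluster mass_pos in \<open>auto simp: colliding_cluster_def\<close>)

text \<open>The terms with the energy and with the external forces vanish in the limit.\<close>

lemma perturbations_tendsto:
  "((\<lambda>\<tau>. r (\<theta> \<tau>) powr \<alpha> * h (\<theta> \<tau>)) \<longlongrightarrow> 0) at_top"
  "((\<lambda>\<tau>. r (\<theta> \<tau>) powr \<alpha> * external_power m \<alpha> K (x (\<theta> \<tau>)) (y (\<theta> \<tau>))) \<longlongrightarrow> 0) at_top"
proof -
  obtain C where C: "0 \<le> C"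
    "\<forall>t\<in>{1/2..<1}. \<bar>h t\<bar> \<le> C \<and> \<bar>external_power m \<alpha> K (x t) (y t)\<bar> \<le> C"
    using perturbation_bound by blast
  have "((\<lambda>\<tau>. r (\<theta> \<tau>) powr \<alpha>) \<longlongrightarrow> 0 powr \<alpha>) at_top"
    using r_\<theta>_tendsto alpha r_nonneg by (intro tendsto_powr2 tendsto_const) auto
  then have r0: "((\<lambda>\<tau>. r (\<theta> \<tau>) powr \<alpha>) \<longlongrightarrow> 0) at_top" by simp
  have ev: "eventually (\<lambda>\<tau>. \<theta> \<tau> \<in> {1/2..<1}) at_top"
    using order_tendstoD(1)[OF \<theta>_tendsto, of "1/2", simplified] eventually_ge_at_top[of 0]
    by eventually_elim (use \<theta>_range in force)
  have "eventually (\<lambda>\<tau>. norm (h (\<theta> \<tau>)) \<le> C) at_top"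
    "eventually (\<lambda>\<tau>. norm (external_power m \<alpha> K (x (\<theta> \<tau>)) (y (\<theta> \<tau>))) \<le> C) at_top"
    using ev by (eventually_elim, use C(2) in auto)+
  from this[THEN lim_null_mult_right_bounded[OF r0]]
  show "((\<lambda>\<tau>. r (\<theta> \<tau>) powr \<alpha> * h (\<theta> \<tau>)) \<longlongrightarrow> 0) at_top"
    "((\<lambda>\<tau>. r (\<theta> \<tau>) powr \<alpha> * external_power m \<alpha> K (x (\<theta> \<tau>)) (y (\<theta> \<tau>))) \<longlongrightarrow> 0) at_top"
    by simp_all
qed

text \<open>
  The perturbation \<open>\<eta>\<close> of the limiting equation collects the deviation of \<open>U(s)\<close> from \<open>U(s0)\<close>, the
  energy and the external forces; \<open>\<eta>'\<close> comes from the identity for \<open>p\<^sup>2 + |s'|\<^sup>2\<close>.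
\<close>

lemma p_tendsto: "((\<lambda>\<tau>. p (\<theta> \<tau>)) \<longlongrightarrow> - sqrt (2 * U s0)) at_top"
proof (rule tendsto_unstable_equilibrium[where L = "\<lambda>\<tau>. ln (r (\<theta> \<tau>))" and c = "1 - \<alpha> / 2" and a = 1
      and \<eta> = "\<lambda>\<tau>. (1 - \<alpha> / 2) * (2 * U (s (\<theta> \<tau>)) - 2 * U s0) + 2 * (r (\<theta> \<tau>) powr \<alpha> * h (\<theta> \<tau>)) +
        r (\<theta> \<tau>) powr \<alpha> * external_power m \<alpha> K (x (\<theta> \<tau>)) (y (\<theta> \<tau>))"
      and \<eta>' = "\<lambda>\<tau>. 2 * U (s (\<theta> \<tau>)) - 2 * U s0 + 2 * (r (\<theta> \<tau>) powr \<alpha> * h (\<theta> \<tau>))"])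
  have sq: "(sqrt (2 * U s0))\<^sup>2 = 2 * U s0" using U_s0_pos by simp
  show "0 < sqrt (2 * U s0)" "0 < 1 - \<alpha> / 2" using U_s0_pos alpha by auto
  show "filterlim (\<lambda>\<tau>. ln (r (\<theta> \<tau>))) at_bot at_top" by (rule ln_r_\<theta>_at_bot)
  fix \<tau> :: real assume "1 \<le> \<tau>"
  then have \<tau>: "0 < \<tau>" by simp
  show "((\<lambda>\<tau>. ln (r (\<theta> \<tau>))) has_real_derivative p (\<theta> \<tau>)) (at \<tau>)" by (rule deriv_ln_r_\<theta>[OF \<tau>])
  show "((\<lambda>\<tau>. p (\<theta> \<tau>)) has_real_derivative (1 - \<alpha> / 2) * ((sqrt (2 * U s0))\<^sup>2 - (p (\<theta> \<tau>))\<^sup>2) +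
      ((1 - \<alpha> / 2) * (2 * U (s (\<theta> \<tau>)) - 2 * U s0) + 2 * (r (\<theta> \<tau>) powr \<alpha> * h (\<theta> \<tau>)) +
        r (\<theta> \<tau>) powr \<alpha> * external_power m \<alpha> K (x (\<theta> \<tau>)) (y (\<theta> \<tau>)))) (at \<tau>)"
    using deriv_p_\<theta>[OF \<tau>] unfolding sq
    by (rule DERIV_cong) (simp add: p_rate_def algebra_simps)
  show "(p (\<theta> \<tau>))\<^sup>2 \<le> (sqrt (2 * U s0))\<^sup>2 +
      (2 * U (s (\<theta> \<tau>)) - 2 * U s0 + 2 * (r (\<theta> \<tau>) powr \<alpha> * h (\<theta> \<tau>)))"
    using s_rate_norm[OF \<theta>_interior[OF \<tau>]] mass_inner_nonneg[of m "s_rate (\<theta> \<tau>)", OF mass_pos]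
    unfolding sq by simp
next
  note lims = tendsto_diff[OF tendsto_mult_left[OF U_lim, of 2] tendsto_const[of "2 * U s0"]]
  show "((\<lambda>\<tau>. (1 - \<alpha> / 2) * (2 * U (s (\<theta> \<tau>)) - 2 * U s0) + 2 * (r (\<theta> \<tau>) powr \<alpha> * h (\<theta> \<tau>)) +
        r (\<theta> \<tau>) powr \<alpha> * external_power m \<alpha> K (x (\<theta> \<tau>)) (y (\<theta> \<tau>))) \<longlongrightarrow> 0) at_top"
    using tendsto_add[OF tendsto_add[OF tendsto_mult_left[OF lims, of "1 - \<alpha> / 2"]
      tendsto_mult_left[OF perturbations_tendsto(1), of 2]] perturbations_tendsto(2)] by simp
  show "((\<lambda>\<tau>. 2 * U (s (\<theta> \<tau>)) - 2 * U s0 + 2 * (r (\<theta> \<tau>) powr \<alpha> * h (\<theta> \<tau>))) \<longlongrightarrow> 0) at_top"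
    using tendsto_add[OF lims tendsto_mult_left[OF perturbations_tendsto(1), of 2]] by simp
qed

text \<open>
  In the new time the shape of the cluster stops moving: the limit of \<open>p\<^sup>2\<close> exhausts the limit of
  \<open>p\<^sup>2 + |s'|\<^sup>2\<close>.
\<close>

lemma s_rate_tendsto: "((\<lambda>\<tau>. s_rate (\<theta> \<tau>)) \<longlongrightarrow> 0) at_top"
proof -
  have "((\<lambda>\<tau>. 2 * U (s (\<theta> \<tau>)) + 2 * (r (\<theta> \<tau>) powr \<alpha> * h (\<theta> \<tau>)) - (p (\<theta> \<tau>))\<^sup>2) \<longlongrightarrow>
      2 * U s0 + 2 * 0 - (- sqrt (2 * U s0))\<^sup>2) at_top"
    by (intro tendsto_intros U_lim perturbations_tendsto p_tendsto)
  then have lim: "((\<lambda>\<tau>. 2 * U (s (\<theta> \<tau>)) + 2 * (r (\<theta> \<tau>) powr \<alpha> * h (\<theta> \<tau>)) - (p (\<theta> \<tau>))\<^sup>2) \<longlongrightarrow> 0) at_top"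
    using U_s0_pos by simp
  have "((\<lambda>\<tau>. ip (s_rate (\<theta> \<tau>)) (s_rate (\<theta> \<tau>))) \<longlongrightarrow> 0) at_top"
    using lim
    by (rule Lim_transform_eventually)
      (auto simp: s_rate_norm \<theta>_interior mult.assoc intro: eventually_mono[OF eventually_gt_at_top[of 0]])
  moreover obtain C where C: "0 < C" "\<And>u :: real ^ 'd ^ 'n. (norm u)\<^sup>2 \<le> C * ip u u"
    using norm_le_mass_inner[of m, OF mass_pos] by blast
  ultimately have "((\<lambda>\<tau>. C * ip (s_rate (\<theta> \<tau>)) (s_rate (\<theta> \<tau>))) \<longlongrightarrow> 0) at_top"
    using tendsto_mult_left[of _ 0 at_top C] by force
  then have "((\<lambda>\<tau>. (norm (s_rate (\<theta> \<tau>)))\<^sup>2) \<longlongrightarrow> 0) at_top"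
    by (rule tendsto_sandwich[OF _ _ tendsto_const, rotated 2]) (auto simp: C)
  from tendsto_real_sqrt[OF this] show ?thesis by (simp add: tendsto_norm_zero_iff)
qed

end

section \<open>Smoothness of the motion\<close>

text \<open>The acceleration is a function of the positions that is smooth away from collisions.\<close>

lemma times_differentiable_a:
  assumes "times_differentiable n {0<..<1} x"
  shows "times_differentiable n {0<..<1} a"
proof -
  have "times_differentiable n {0<..<1} (\<lambda>t. potential_deriv m \<alpha> UNIV (x t) b)" for b
    unfolding potential_deriv_def
  proof (intro times_differentiable_mult times_differentiable_const times_differentiable_sum
      times_differentiable_norm_powr times_differentiable_inner open_greaterThanLessThan
      times_differentiable_linear[OF bounded_linear_component_diff _ assms])
    fix i k :: 'n and t assume "k \<in> UNIV - {i}" "t \<in> {0<..<1::real}"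
    then show "x t $ i - x t $ k \<noteq> 0"
      using not_collisionD[OF no_collision[of t], of i k] by auto
  qed
  moreover have "potential_deriv m \<alpha> UNIV (x t) b = mass_mult m (a t) \<bullet> b" if "t \<in> {0<..<1}" for t b
    using newton_weak[of t b] that by (simp add: mass_inner_def)
  ultimately have "times_differentiable n {0<..<1} (\<lambda>t. mass_mult m (a t) \<bullet> b)" for b
    by (rule times_differentiable_cong[OF open_greaterThanLessThan, rotated])
  then have "times_differentiable n {0<..<1} (\<lambda>t. mass_mult (\<lambda>i. 1 / m i) (mass_mult m (a t)))"
    by (rule times_differentiable_linear[OF bounded_linear_mass_mult open_greaterThanLessThan
          times_differentiable_vec[OF open_greaterThanLessThan]])
  moreover have "mass_mult (\<lambda>i. 1 / m i) (mass_mult m u) = u" for u :: "real ^ 'd ^ 'n"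
    using mass_pos by (simp add: mass_mult_def vec_eq_iff order_less_imp_not_eq2)
  ultimately show ?thesis by simp
qed

lemma times_differentiable_x_v:
  "times_differentiable n {0<..<1} x \<and> times_differentiable n {0<..<1} v"
proof (induction n)
  case (Suc n)
  then have "times_differentiable (Suc n) {0<..<1} x"
    by (intro times_differentiable_SucI[where f' = v]) (auto intro: deriv_x)
  moreover from Suc have "times_differentiable (Suc n) {0<..<1} v"
    by (intro times_differentiable_SucI[where f' = a] times_differentiable_a) (auto intro: deriv_v)
  ultimately show ?case ..
qed simp

lemma times_differentiable_y: "times_differentiable n {0<..<1} y"
  unfolding y_def[abs_def] using times_differentiable_x_v
  by (intro times_differentiable_linear[OF bounded_linear_centred_part]) auto

lemma times_differentiable_w: "times_differentiable n {0<..<1} w"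
  unfolding w_def[abs_def] using times_differentiable_x_v
  by (intro times_differentiable_linear[OF bounded_linear_centred_part]) auto

lemmas times_differentiable_ip = times_differentiable_bilinear[OF bounded_bilinear_mass_inner]

lemma times_differentiable_r_powr: "times_differentiable n {0<..<1} (\<lambda>t. r t powr q)"
proof -
  have pos: "0 < r t" if "t \<in> {0<..<1}" for t using r_pos[of t] that by simp
  have "times_differentiable n {0<..<1} (\<lambda>t. ip (y t) (y t) powr (q / 2))"
    using pos
    by (intro times_differentiable_powr times_differentiable_ip times_differentiable_y)
      (auto simp: order_less_imp_not_eq2 simp flip: r_power2)
  moreover have "ip (y t) (y t) powr (q / 2) = r t powr q" if "t \<in> {0<..<1}" for t
    using pos[OF that] by (simp add: powr_powr flip: r_power2 powr_numeral)
  ultimately show ?thesis by (rule times_differentiable_cong[OF open_greaterThanLessThan, rotated])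
qed

lemma times_differentiable_p: "times_differentiable n {0<..<1} p"
  unfolding p_def[abs_def] j_def[abs_def]
  by (intro times_differentiable_mult times_differentiable_ip times_differentiable_r_powr
      times_differentiable_y times_differentiable_w open_greaterThanLessThan)

lemma times_differentiable_s: "times_differentiable n {0<..<1} s"
proof -
  have "times_differentiable n {0<..<1} (\<lambda>t. r t powr (- 1) *\<^sub>R y t)"
    by (intro times_differentiable_scaleR times_differentiable_r_powr times_differentiable_y
        open_greaterThanLessThan)
  moreover have "r t powr (- 1) *\<^sub>R y t = s t" if "t \<in> {0<..<1}" for t
    using r_pos[of t] that by (simp add: s_def powr_minus)
  ultimately show ?thesis by (rule times_differentiable_cong[OF open_greaterThanLessThan, rotated])
qed

lemma times_differentiable_s_rate: "times_differentiable n {0<..<1} s_rate"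
  unfolding s_rate_def[abs_def]
  by (intro times_differentiable_diff times_differentiable_scaleR times_differentiable_r_powr
      times_differentiable_w times_differentiable_p times_differentiable_s open_greaterThanLessThan)

lemma times_differentiable_\<theta>: "times_differentiable n {0<..} \<theta>"
proof (induction n)
  case (Suc n)
  have "times_differentiable n {0<..} (\<lambda>\<tau>. D (\<theta> \<tau>))"
    by (rule times_differentiable_compose[OF open_greaterThan _ Suc.IH,
          where f = D and T = "{0<..<1}"])
      (use \<theta>_mem in \<open>auto simp: D_def[abs_def] intro: times_differentiable_r_powr\<close>)
  then show ?case
    by (intro times_differentiable_SucI[where f' = "\<lambda>\<tau>. D (\<theta> \<tau>)"])
      (auto intro: deriv_\<theta> simp flip: has_real_derivative_iff_has_vector_derivative)
qed simp

lemma times_differentiable_\<theta>_compose: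
  "times_differentiable n {0<..<1} f \<Longrightarrow> times_differentiable n {0<..} (\<lambda>\<tau>. f (\<theta> \<tau>))"
  by (rule times_differentiable_compose[OF open_greaterThan _ times_differentiable_\<theta>])
    (use \<theta>_mem in auto)

lemma continuous_\<theta>_compose:
  "(\<And>n. times_differentiable n {0<..<1} f) \<Longrightarrow> continuous_on {0<..} (\<lambda>\<tau>. f (\<theta> \<tau>))"
  by (rule continuous_on_times_differentiable[OF times_differentiable_\<theta>_compose])

section \<open>The second variation on tangent fields\<close>

abbreviation \<rho> :: "real \<Rightarrow> real" where "\<rho> \<equiv> rho_var m \<alpha> K x"

lemma \<rho>_eq: "\<rho> \<tau> = r (\<theta> \<tau>) powr ((2 - \<alpha>) / 4)"
  by (simp add: rho_var_def r_def \<theta>_def)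

lemma s_var_eq: "s_var m \<alpha> K x = (\<lambda>\<tau>. s (\<theta> \<tau>))"
  by (simp add: s_var_def fun_eq_iff s_def cluster_path_eq \<theta>_def r_def)

lemma r_\<theta>_pos: "0 \<le> \<tau> \<Longrightarrow> 0 < r (\<theta> \<tau>)"
  by (rule r_pos) (auto intro: \<theta>_range)

lemma \<rho>_pos: "0 \<le> \<tau> \<Longrightarrow> 0 < \<rho> \<tau>"
  using r_\<theta>_pos[of \<tau>] by (simp add: \<rho>_eq)

lemma times_differentiable_\<rho>_powr: "times_differentiable n {0<..} (\<lambda>\<tau>. \<rho> \<tau> powr q)"
  unfolding \<rho>_eq[abs_def] powr_powr
  by (rule times_differentiable_\<theta>_compose[OF times_differentiable_r_powr])

lemma deriv_\<rho>:
  assumes "0 < \<tau>"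
  shows "(\<rho> has_real_derivative (2 - \<alpha>) / 4 * p (\<theta> \<tau>) * \<rho> \<tau>) (at \<tau>)"
proof -
  have t: "0 < \<theta> \<tau>" "\<theta> \<tau> < 1" using \<theta>_mem[OF assms] by auto
  define q where "q = (2 - \<alpha>) / 4"
  have pos: "0 < r (\<theta> \<tau>)" using r_\<theta>_pos assms by simp
  have "q * r (\<theta> \<tau>) powr (q - 2) * j (\<theta> \<tau>) * D (\<theta> \<tau>) = q * p (\<theta> \<tau>) * r (\<theta> \<tau>) powr q"
    using pos unfolding p_def r_powrs[OF less_imp_le[OF t(1)] t(2)]
    by (simp add: powr_diff power2_eq_square field_simps)
  with DERIV_chain2[OF deriv_r_powr[OF t, of q] deriv_\<theta>[OF assms]] show ?thesis
    unfolding \<rho>_eq[abs_def] q_def[symmetric] by simp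
qed

text \<open>The integral of \<open>\<rho> powr \<beta>\<close> in the second variation is the original time.\<close>

lemma integral_\<rho>:
  assumes "0 \<le> \<tau>"
  shows "integral {0..\<tau>} (\<lambda>\<sigma>. \<rho> \<sigma> powr (2 * (2 + \<alpha>) / (2 - \<alpha>))) = \<theta> \<tau>"
proof -
  have e: "(2 - \<alpha>) / 4 * (2 * (2 + \<alpha>) / (2 - \<alpha>)) = 1 + \<alpha> / 2"
    using alpha by (simp add: field_simps)
  have "((\<lambda>\<sigma>. D (\<theta> \<sigma>)) has_integral \<theta> \<tau> - \<theta> 0) {0..\<tau>}"
    by (rule fundamental_theorem_of_calculus_interior[OF assms continuous_\<theta>])
      (auto intro: deriv_\<theta> simp flip: has_real_derivative_iff_has_vector_derivative)
  moreover have "(\<lambda>\<sigma>. \<rho> \<sigma> powr (2 * (2 + \<alpha>) / (2 - \<alpha>))) = (\<lambda>\<sigma>. D (\<theta> \<sigma>))"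
    unfolding \<rho>_eq D_def powr_powr e ..
  ultimately show ?thesis by (simp add: \<theta>_0 integral_unique)
qed

text \<open>
  The second identity shows that the external term carries the vanishing factor \<open>r powr (2 + \<alpha>)\<close>
  relative to the internal one.
\<close>

lemma \<rho>_powrs:
  assumes "0 \<le> \<tau>"
  shows "\<rho> \<tau> powr (4 / (2 - \<alpha>)) *\<^sub>R s (\<theta> \<tau>) = y (\<theta> \<tau>)"
    and "\<rho> \<tau> powr (2 * ((6 + \<alpha>) / (2 - \<alpha>))) = (\<rho> \<tau>)\<^sup>2 * r (\<theta> \<tau>) powr (2 + \<alpha>)"
proof -
  have pos: "0 < r (\<theta> \<tau>)" using r_\<theta>_pos[OF assms] .
  have e1: "(2 - \<alpha>) / 4 * (4 / (2 - \<alpha>)) = 1" using alpha by simp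
  have "\<rho> \<tau> powr (4 / (2 - \<alpha>)) = r (\<theta> \<tau>) powr 1" unfolding \<rho>_eq powr_powr e1 ..
  then have "\<rho> \<tau> powr (4 / (2 - \<alpha>)) = r (\<theta> \<tau>)" using pos by simp
  then show "\<rho> \<tau> powr (4 / (2 - \<alpha>)) *\<^sub>R s (\<theta> \<tau>) = y (\<theta> \<tau>)" using pos by (simp add: s_def)
  have e: "(2 - \<alpha>) / 4 * (2 * ((6 + \<alpha>) / (2 - \<alpha>))) = (2 - \<alpha>) / 4 + (2 - \<alpha>) / 4 + (2 + \<alpha>)"
    using alpha by (simp add: field_simps)
  show "\<rho> \<tau> powr (2 * ((6 + \<alpha>) / (2 - \<alpha>))) = (\<rho> \<tau>)\<^sup>2 * r (\<theta> \<tau>) powr (2 + \<alpha>)"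
    unfolding \<rho>_eq powr_powr e powr_add power2_eq_square ..
qed

text \<open>
  The quadratic forms of the two Hessians in the second variation: of the restricted Hessian of \<open>U\<close>
  at \<open>q\<close>, and of the Hessian of the external potential at \<open>y t\<close>.
\<close>

definition U_form :: "real ^ 'd ^ 'n \<Rightarrow> real ^ 'd ^ 'n \<Rightarrow> real" where
  "U_form q u = (\<Sum>i\<in>K. \<Sum>k\<in>K - {i}.
    (m i * m k / 2) * powr_hess (- \<alpha>) (q $ i - q $ k) (u $ i - u $ k) (u $ i - u $ k)) +
    \<alpha> * U q * ip u u"

definition W_form :: "real \<Rightarrow> real ^ 'd ^ 'n \<Rightarrow> real" where
  "W_form t u = (\<Sum>i\<in>K. \<Sum>k\<in>- K.
    (m i * m k / 2) * powr_hess (- \<alpha>) (x t $ k - x t $ i) (u $ i) (u $ i))"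

lemma restricted_hessian_eq:
  "q \<notin> collision_set K \<Longrightarrow> restricted_hessian m \<alpha> K q u u = U_form q u"
  by (simp add: restricted_hessian_def hessian_potential U_form_def)

lemma external_hessian_eq:
  assumes "0 \<le> t" "t < 1"
  shows "hessian (external_potential m \<alpha> K (relative_path m K x) t) (y t) u u = W_form t u"
proof -
  have diff: "relative_path m K x t $ k - y t $ i = x t $ k - x t $ i" if "i \<in> K" for i k
    using that by (simp add: relative_path_def y_def centred_part_def)
  have "relative_path m K x t $ k \<noteq> y t $ i" if "i \<in> K" "k \<notin> K" for i k
  proof -
    have "k \<noteq> i" using that by blast
    then have "x t $ k \<noteq> x t $ i" using not_collisionD[OF no_collision[OF assms], of k i] by simp
    then show ?thesis using diff[OF that(1), of k] by auto
  qed
  then show ?thesis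
    by (subst hessian_external_potential) (simp_all add: W_form_def diff)
qed

lemma powr_hess_scaleR: "powr_hess q z (c *\<^sub>R u) (c *\<^sub>R u) = c\<^sup>2 * powr_hess q z u u"
  by (simp add: powr_hess_def power2_eq_square algebra_simps)

lemma U_form_scaleR: "U_form q (c *\<^sub>R u) = c\<^sup>2 * U_form q u"
proof -
  have "powr_hess (- \<alpha>) z ((c *\<^sub>R u) $ i - (c *\<^sub>R u) $ k) ((c *\<^sub>R u) $ i - (c *\<^sub>R u) $ k) =
      c\<^sup>2 * powr_hess (- \<alpha>) z (u $ i - u $ k) (u $ i - u $ k)" for z i k
    using powr_hess_scaleR[of _ z c "u $ i - u $ k"] by (simp add: scaleR_diff_right)
  then show ?thesis
    by (simp add: U_form_def sum_distrib_left mass_inner_simps power2_eq_square algebra_simps)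
qed

lemma W_form_scaleR: "W_form t (c *\<^sub>R u) = c\<^sup>2 * W_form t u"
  by (simp add: W_form_def powr_hess_scaleR sum_distrib_left mult_ac)

text \<open>The bound holds because the external bodies stay away from the cluster.\<close>

lemma W_form_bound: "\<exists>C. \<forall>t\<in>{0..1}. \<forall>u. \<bar>W_form t u\<bar> \<le> C * (norm u)\<^sup>2"
proof -
  obtain d where d: "0 < d"
    "\<And>t i k. 0 \<le> t \<Longrightarrow> t \<le> 1 \<Longrightarrow> i \<in> K \<Longrightarrow> k \<notin> K \<Longrightarrow> d \<le> norm (x t $ i - x t $ k)"
    using external_distance by force
  have m0: "0 \<le> m i" for i using mass_pos[of i] by simp
  define A where "A = \<bar>- \<alpha>\<bar> * (\<bar>- \<alpha> - 2\<bar> + 1) * d powr (- \<alpha> - 2)"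
  have "\<bar>W_form t u\<bar> \<le> (\<Sum>i\<in>K. \<Sum>k\<in>- K. m i * m k / 2 * A) * (norm u)\<^sup>2" if "t \<in> {0..1}" for t u
  proof -
    have "\<bar>(m i * m k / 2) * powr_hess (- \<alpha>) (x t $ k - x t $ i) (u $ i) (u $ i)\<bar>
        \<le> m i * m k / 2 * A * (norm u)\<^sup>2" if ik: "i \<in> K" "k \<in> - K" for i k
    proof -
      let ?z = "x t $ k - x t $ i"
      have dz: "d \<le> norm ?z"
        using d(2)[of t i k] ik \<open>t \<in> {0..1}\<close> by (simp add: norm_minus_commute)
      then have "?z \<noteq> 0" using d(1) by auto
      from powr_hess_bound[OF this]
      have "\<bar>powr_hess (- \<alpha>) ?z (u $ i) (u $ i)\<bar>
          \<le> \<bar>- \<alpha>\<bar> * (\<bar>- \<alpha> - 2\<bar> + 1) * norm ?z powr (- \<alpha> - 2) * (norm (u $ i))\<^sup>2" .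
      also have "\<dots> \<le> A * (norm u)\<^sup>2"
        unfolding A_def using d(1) dz alpha
        by (intro mult_mono powr_mono2' power_mono Finite_Cartesian_Product.norm_nth_le) auto
      finally have "(m i * m k / 2) * \<bar>powr_hess (- \<alpha>) ?z (u $ i) (u $ i)\<bar>
          \<le> (m i * m k / 2) * (A * (norm u)\<^sup>2)"
        using m0 by (intro mult_left_mono) auto
      then show ?thesis using m0[of i] m0[of k] by (simp add: abs_mult mult_ac)
    qed
    then have "\<bar>W_form t u\<bar> \<le> (\<Sum>i\<in>K. \<Sum>k\<in>- K. m i * m k / 2 * A * (norm u)\<^sup>2)"
      unfolding W_form_def by (intro order_trans[OF sum_abs] sum_mono)
    then show ?thesis by (simp only: sum_distrib_right)
  qed
  then show ?thesis by blast
qed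

section \<open>Negative directions near the collision\<close>

text \<open>
  From here on the collision is asymptotic to \<open>s0\<close>, and the restricted Hessian at \<open>s0\<close> is sufficiently
  negative on the tangent vector \<open>e\<close>.
\<close>

context
  fixes s0 e :: "real ^ 'd ^ 'n" and \<mu> :: real
  assumes s_var_tendsto: "(s_var m \<alpha> K x \<longlongrightarrow> s0) at_top"
    and s0: "s0 \<in> ellipsoid m K"
    and e: "e \<in> tangent_space m K s0" "e \<noteq> 0"
    and eigen: "restricted_hessian m \<alpha> K s0 e e = \<mu> * ip e e"
    and \<mu>: "\<mu> < - ((2 - \<alpha>)\<^sup>2 / 8) * U s0"
begin

lemma s_tendsto: "((\<lambda>\<tau>. s (\<theta> \<tau>)) \<longlongrightarrow> s0) at_top"
  using s_var_tendsto by (simp add: s_var_eq)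

lemma s0_no_collision: "s0 \<notin> collision_set K"
  using s0 by (simp add: ellipsoid_def)

text \<open>The tangential part of \<open>e\<close> along the motion, and its derivative.\<close>

definition E :: "real \<Rightarrow> real ^ 'd ^ 'n" where
  "E \<tau> = e - ip e (s (\<theta> \<tau>)) *\<^sub>R s (\<theta> \<tau>)"
definition E' :: "real \<Rightarrow> real ^ 'd ^ 'n" where
  "E' \<tau> = - (ip e (s_rate (\<theta> \<tau>)) *\<^sub>R s (\<theta> \<tau>) + ip e (s (\<theta> \<tau>)) *\<^sub>R s_rate (\<theta> \<tau>))"

lemma E_tangent:
  assumes "0 \<le> \<tau>"
  shows "E \<tau> \<in> tangent_space m K (s (\<theta> \<tau>))"
proof -
  have "s (\<theta> \<tau>) \<in> centred_space m K" "ip (s (\<theta> \<tau>)) (s (\<theta> \<tau>)) = 1"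
    using s_in_ellipsoid(1) s_unit \<theta>_range[OF assms] by auto
  moreover have "e \<in> centred_space m K" using e by (simp add: tangent_space_def)
  ultimately show ?thesis
    by (simp add: E_def tangent_space_def centred_space_diff centred_space_scaleR mass_inner_simps
        mass_inner_commute[of m e])
qed

lemma times_differentiable_E: "times_differentiable n {0<..} E"
  unfolding E_def[abs_def]
  by (intro times_differentiable_diff times_differentiable_scaleR times_differentiable_ip
      times_differentiable_const times_differentiable_\<theta>_compose times_differentiable_s
      open_greaterThan)

lemma deriv_E:
  assumes "0 < \<tau>"
  shows "(E has_vector_derivative E' \<tau>) (at \<tau>)"
proof -
  have t: "0 < \<theta> \<tau>" "\<theta> \<tau> < 1" using \<theta>_mem[OF assms] by auto
  have "((\<lambda>\<tau>. s (\<theta> \<tau>)) has_vector_derivative s_rate (\<theta> \<tau>)) (at \<tau>)"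
    using vector_diff_chain_at[OF deriv_\<theta>[OF assms, unfolded has_real_derivative_iff_has_vector_derivative]
        deriv_s[OF t]] D_pos[of "\<theta> \<tau>"] t by (simp add: o_def)
  note s = this
  have "((\<lambda>\<tau>. ip e (s (\<theta> \<tau>))) has_real_derivative ip e (s_rate (\<theta> \<tau>))) (at \<tau>)"
    using has_real_derivative_ip[OF has_vector_derivative_const s] by (simp add: mass_inner_simps)
  from has_vector_derivative_diff[OF has_vector_derivative_const has_vector_derivative_scaleR[OF this s]]
  show ?thesis unfolding E_def[abs_def] E'_def by (simp add: algebra_simps)
qed

lemma E_tendsto: "(E \<longlongrightarrow> e) at_top"
proof -
  have "(E \<longlongrightarrow> e - ip e s0 *\<^sub>R s0) at_top"
    unfolding E_def[abs_def] by (intro tendsto_intros s_tendsto)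
  moreover have "ip e s0 = 0" using e by (simp add: tangent_space_def mass_inner_commute)
  ultimately show ?thesis by simp
qed

lemma E'_tendsto: "(E' \<longlongrightarrow> 0) at_top"
proof -
  have "(E' \<longlongrightarrow> - (ip e 0 *\<^sub>R s0 + ip e s0 *\<^sub>R 0)) at_top"
    unfolding E'_def[abs_def]
    by (intro tendsto_intros s_tendsto s_rate_tendsto[OF s_tendsto s0_no_collision])
  then show ?thesis by (simp add: mass_inner_simps)
qed

text \<open>
  For a field \<open>(\<omega> / \<rho>) E\<close> the integrand of the second variation is a quadratic form in \<open>\<omega>\<close> and \<open>\<omega>'\<close>,
  with coefficients that converge as \<open>\<tau> \<rightarrow> \<infinity>\<close>. Here \<open>log_rate\<close> is the logarithmic derivative of \<open>\<rho>\<close>, and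
  \<open>V\<close> is the contribution of the two Hessians.
\<close>

definition log_rate :: "real \<Rightarrow> real" where "log_rate \<tau> = (2 - \<alpha>) / 4 * p (\<theta> \<tau>)"
definition V :: "real \<Rightarrow> real" where
  "V \<tau> = U_form (s (\<theta> \<tau>)) (E \<tau>) + r (\<theta> \<tau>) powr (2 + \<alpha>) * W_form (\<theta> \<tau>) (E \<tau>)"
definition quad :: "real \<Rightarrow> real \<Rightarrow> real \<Rightarrow> real" where
  "quad \<tau> \<omega> \<omega>' = \<omega>'\<^sup>2 * ip (E \<tau>) (E \<tau>) +
     \<omega> * \<omega>' * (2 * ip (E \<tau>) (E' \<tau>) - 2 * log_rate \<tau> * ip (E \<tau>) (E \<tau>)) +
     \<omega>\<^sup>2 * ((log_rate \<tau>)\<^sup>2 * ip (E \<tau>) (E \<tau>) - 2 * log_rate \<tau> * ip (E \<tau>) (E' \<tau>) + ip (E' \<tau>) (E' \<tau>) + V \<tau>)"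

text \<open>The limit of \<open>- \<rho>' / \<rho>\<close>, and the gap in the hypothesis on \<open>\<mu>\<close>.\<close>

definition \<kappa> :: real where "\<kappa> = (2 - \<alpha>) / 4 * sqrt (2 * U s0)"
definition \<delta> :: real where "\<delta> = - (\<kappa>\<^sup>2 + \<mu>)"

lemma \<delta>_pos: "0 < \<delta>"
proof -
  have "\<kappa>\<^sup>2 = (2 - \<alpha>)\<^sup>2 / 8 * U s0"
    using U_s0_pos[OF s_tendsto s0_no_collision] by (simp add: \<kappa>_def power_mult_distrib power_divide)
  with \<mu> show ?thesis by (simp add: \<delta>_def)
qed

lemma e_pos: "0 < ip e e"
  by (rule mass_inner_pos[of m, OF mass_pos e(2)])

lemma log_rate_tendsto: "(log_rate \<longlongrightarrow> - \<kappa>) at_top"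
  unfolding log_rate_def[abs_def] \<kappa>_def
  using tendsto_mult_left[OF p_tendsto[OF s_tendsto s0_no_collision], of "(2 - \<alpha>) / 4"] by simp

lemma V_tendsto: "(V \<longlongrightarrow> \<mu> * ip e e) at_top"
proof -
  have nz: "s0 $ i - s0 $ k \<noteq> 0" if "i \<in> K" "k \<in> K - {i}" for i k
    using not_collisionD[OF s0_no_collision, of i k] that by auto
  have "((\<lambda>\<tau>. U_form (s (\<theta> \<tau>)) (E \<tau>)) \<longlongrightarrow> U_form s0 e) at_top"
    unfolding U_form_def
    by (intro tendsto_intros tendsto_powr_hess nz s_tendsto E_tendsto
        U_lim[OF s_tendsto s0_no_collision])
  moreover have "((\<lambda>\<tau>. r (\<theta> \<tau>) powr (2 + \<alpha>) * W_form (\<theta> \<tau>) (E \<tau>)) \<longlongrightarrow> 0) at_top"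
  proof -
    obtain C where C: "\<forall>t\<in>{0..1}. \<forall>u. \<bar>W_form t u\<bar> \<le> C * (norm u)\<^sup>2" using W_form_bound by blast
    have "((\<lambda>\<tau>. r (\<theta> \<tau>) powr (2 + \<alpha>)) \<longlongrightarrow> 0 powr (2 + \<alpha>)) at_top"
      using r_\<theta>_tendsto alpha r_nonneg by (intro tendsto_powr2 tendsto_const) auto
    from tendsto_mult[OF this
        tendsto_mult_left[OF tendsto_power[OF tendsto_norm[OF E_tendsto]], of C 2]]
    have lim: "((\<lambda>\<tau>. r (\<theta> \<tau>) powr (2 + \<alpha>) * (C * (norm (E \<tau>))\<^sup>2)) \<longlongrightarrow> 0) at_top" by simp
    show ?thesis
    proof (rule Lim_null_comparison[OF _ lim])
      show "eventually (\<lambda>\<tau>. norm (r (\<theta> \<tau>) powr (2 + \<alpha>) * W_form (\<theta> \<tau>) (E \<tau>)) \<le>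
          r (\<theta> \<tau>) powr (2 + \<alpha>) * (C * (norm (E \<tau>))\<^sup>2)) at_top"
        using eventually_ge_at_top[of 0]
      proof eventually_elim
        case (elim \<tau>)
        then have "\<theta> \<tau> \<in> {0..1}" using \<theta>_range[of \<tau>] by auto
        with C have "\<bar>W_form (\<theta> \<tau>) (E \<tau>)\<bar> \<le> C * (norm (E \<tau>))\<^sup>2" by blast
        then show ?case by (simp add: abs_mult mult_left_mono)
      qed
    qed
  qed
  ultimately have "(V \<longlongrightarrow> U_form s0 e + 0) at_top" unfolding V_def[abs_def] by (rule tendsto_add)
  then show ?thesis using eigen restricted_hessian_eq[OF s0_no_collision] by simp
qed

lemma quad_eventually_le:
  "\<exists>T\<ge>1. \<forall>\<tau>\<ge>T. E \<tau> \<noteq> 0 \<and> (\<forall>\<omega> \<omega>'. quad \<tau> \<omega> \<omega>' \<le> ip e e * profile_form \<kappa> \<delta> \<omega> \<omega>')"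
proof -
  let ?c1 = "\<lambda>\<tau>. ip (E \<tau>) (E \<tau>)"
  let ?c2 = "\<lambda>\<tau>. 2 * ip (E \<tau>) (E' \<tau>) - 2 * log_rate \<tau> * ip (E \<tau>) (E \<tau>)"
  let ?c3 = "\<lambda>\<tau>. (log_rate \<tau>)\<^sup>2 * ip (E \<tau>) (E \<tau>) - 2 * log_rate \<tau> * ip (E \<tau>) (E' \<tau>) + ip (E' \<tau>) (E' \<tau>) + V \<tau>"
  \<comment> \<open>Small enough for errors of size \<open>\<epsilon>\<close> in the three coefficients to be absorbed in half of the gap \<open>\<delta>\<close>
    and in a doubled coefficient of \<open>\<omega>'\<^sup>2\<close>.\<close>
  define \<epsilon> where "\<epsilon> = min (1 / 2) (\<delta> / 4) * ip e e"
  have \<epsilon>: "0 < \<epsilon>" "\<epsilon> \<le> ip e e / 2" "\<epsilon> \<le> \<delta> / 4 * ip e e"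
    unfolding \<epsilon>_def using \<delta>_pos e_pos by (auto intro!: mult_right_mono mult_pos_pos simp: min_mult_distrib_right)
  have "(?c1 \<longlongrightarrow> ip e e) at_top" by (intro tendsto_intros E_tendsto)
  from tendstoD[OF this \<epsilon>(1)] have ev1: "eventually (\<lambda>\<tau>. \<bar>?c1 \<tau> - ip e e\<bar> < \<epsilon>) at_top"
    by (simp add: dist_real_def)
  have "(?c2 \<longlongrightarrow> 2 * ip e 0 - 2 * (- \<kappa>) * ip e e) at_top"
    by (intro tendsto_intros E_tendsto E'_tendsto log_rate_tendsto)
  from tendstoD[OF this \<epsilon>(1)] have ev2: "eventually (\<lambda>\<tau>. \<bar>?c2 \<tau> - 2 * \<kappa> * ip e e\<bar> < \<epsilon>) at_top"
    by (simp add: dist_real_def mass_inner_simps)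
  have "(?c3 \<longlongrightarrow> (- \<kappa>)\<^sup>2 * ip e e - 2 * (- \<kappa>) * ip e 0 + ip 0 0 + \<mu> * ip e e) at_top"
    by (intro tendsto_intros E_tendsto E'_tendsto log_rate_tendsto V_tendsto)
  moreover have "(- \<kappa>)\<^sup>2 * ip e e - 2 * (- \<kappa>) * ip e 0 + ip 0 0 + \<mu> * ip e e = - \<delta> * ip e e"
    by (simp add: mass_inner_simps \<delta>_def algebra_simps)
  ultimately have "(?c3 \<longlongrightarrow> - \<delta> * ip e e) at_top" by simp
  from tendstoD[OF this \<epsilon>(1)] have ev3: "eventually (\<lambda>\<tau>. \<bar>?c3 \<tau> + \<delta> * ip e e\<bar> < \<epsilon>) at_top"
    by (simp add: dist_real_def)
  have "eventually (\<lambda>\<tau>. E \<tau> \<noteq> 0 \<and> (\<forall>\<omega> \<omega>'. quad \<tau> \<omega> \<omega>' \<le> ip e e * profile_form \<kappa> \<delta> \<omega> \<omega>')) at_top"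
    using ev1 ev2 ev3
  proof eventually_elim
    case (elim \<tau>)
    have "?c1 \<tau> \<noteq> 0" using elim(1) \<epsilon>(2) e_pos by (auto simp: abs_less_iff)
    then have "E \<tau> \<noteq> 0" by (auto simp: mass_inner_simps)
    moreover have "quad \<tau> \<omega> \<omega>' \<le> ip e e * profile_form \<kappa> \<delta> \<omega> \<omega>'" for \<omega> \<omega>'
    proof -
      let ?n = "ip e e"
      have 1: "\<omega>'\<^sup>2 * ?c1 \<tau> \<le> \<omega>'\<^sup>2 * ?n + \<omega>'\<^sup>2 * \<epsilon>"
        unfolding distrib_left[symmetric] using elim(1) by (intro mult_left_mono) auto
      have "\<omega> * \<omega>' * ?c2 \<tau> - \<omega> * \<omega>' * (2 * \<kappa> * ?n) \<le> \<bar>\<omega> * \<omega>'\<bar> * \<bar>?c2 \<tau> - 2 * \<kappa> * ?n\<bar>"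
        unfolding abs_mult[symmetric] right_diff_distrib[symmetric] by (rule abs_ge_self)
      also have "\<dots> \<le> (\<omega>\<^sup>2 + \<omega>'\<^sup>2) / 2 * \<epsilon>"
      proof (rule mult_mono)
        show "\<bar>\<omega> * \<omega>'\<bar> \<le> (\<omega>\<^sup>2 + \<omega>'\<^sup>2) / 2"
          using sum_squares_bound[of "\<bar>\<omega>\<bar>" "\<bar>\<omega>'\<bar>"] by (simp add: abs_mult)
      qed (use elim(2) \<epsilon> in auto)
      also have "\<dots> = \<omega>\<^sup>2 * \<epsilon> / 2 + \<omega>'\<^sup>2 * \<epsilon> / 2" by (simp add: algebra_simps)
      finally have 2: "\<omega> * \<omega>' * ?c2 \<tau> \<le> \<omega> * \<omega>' * (2 * \<kappa> * ?n) + \<omega>\<^sup>2 * \<epsilon> / 2 + \<omega>'\<^sup>2 * \<epsilon> / 2" by linarith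
      have "\<omega>\<^sup>2 * ?c3 \<tau> \<le> \<omega>\<^sup>2 * (\<epsilon> - \<delta> * ?n)" using elim(3) by (intro mult_left_mono) auto
      then have 3: "\<omega>\<^sup>2 * ?c3 \<tau> \<le> \<omega>\<^sup>2 * \<epsilon> - \<omega>\<^sup>2 * (\<delta> * ?n)" by (simp only: right_diff_distrib)
      have 4: "\<omega>'\<^sup>2 * \<epsilon> \<le> \<omega>'\<^sup>2 * ?n / 2" "\<omega>\<^sup>2 * \<epsilon> \<le> \<omega>\<^sup>2 * (\<delta> * ?n) / 4"
        using mult_left_mono[OF \<epsilon>(2), of "\<omega>'\<^sup>2"] mult_left_mono[OF \<epsilon>(3), of "\<omega>\<^sup>2"] by simp_all
      have 5: "0 \<le> \<omega>'\<^sup>2 * ?n" "0 \<le> \<omega>\<^sup>2 * (\<delta> * ?n)" using e_pos \<delta>_pos by auto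
      have "?n * profile_form \<kappa> \<delta> \<omega> \<omega>' =
          2 * (\<omega>'\<^sup>2 * ?n) + \<omega> * \<omega>' * (2 * \<kappa> * ?n) - \<omega>\<^sup>2 * (\<delta> * ?n) / 2"
        by (simp add: profile_form_def algebra_simps)
      with 1 2 3 4 5 show ?thesis unfolding quad_def by linarith
    qed
    ultimately show ?case by blast
  qed
  then obtain T where "\<forall>\<tau>\<ge>T. E \<tau> \<noteq> 0 \<and> (\<forall>\<omega> \<omega>'. quad \<tau> \<omega> \<omega>' \<le> ip e e * profile_form \<kappa> \<delta> \<omega> \<omega>')"
    unfolding eventually_at_top_linorder by blast
  then show ?thesis by (intro exI[of _ "max 1 T"]) auto
qed

lemma continuous_quad:
  assumes "continuous_on S W" "continuous_on S W'" "S \<subseteq> {0<..}"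
  shows "continuous_on S (\<lambda>\<tau>. quad \<tau> (W \<tau>) (W' \<tau>))"
proof -
  have sub: "continuous_on S f" if "continuous_on {0<..} f" for f :: "real \<Rightarrow> 'c::topological_space"
    using that assms(3) by (rule continuous_on_subset)
  note conts = sub[OF continuous_\<theta>_compose[OF times_differentiable_s]]
    sub[OF continuous_\<theta>_compose[OF times_differentiable_s_rate]]
    sub[OF continuous_\<theta>_compose[OF times_differentiable_p]]
    sub[OF continuous_\<theta>_compose[OF times_differentiable_r_powr]]
    sub[OF continuous_\<theta>_compose[OF conjunct1[OF times_differentiable_x_v]]]
  have E: "continuous_on S E" "continuous_on S E'"
    unfolding E_def[abs_def] E'_def[abs_def] by (intro continuous_intros conts)+
  have pos: "0 \<le> \<theta> \<tau>" "\<theta> \<tau> < 1" if "\<tau> \<in> S" for \<tau> using \<theta>_range[of \<tau>] assms(3) that by force+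
  have pot: "continuous_on S (\<lambda>\<tau>. U (s (\<theta> \<tau>)))"
  proof (rule continuous_on_compose2[OF _ conts(1)])
    show "continuous_on (- collision_set K) U"
      by (rule continuous_at_imp_continuous_on)
        (auto intro: has_derivative_continuous[OF has_derivative_potential])
    show "(\<lambda>\<tau>. s (\<theta> \<tau>)) ` S \<subseteq> - collision_set K" using pos s_in_ellipsoid(2) by blast
  qed
  have nz: "s (\<theta> \<tau>) $ i - s (\<theta> \<tau>) $ k \<noteq> 0" if "i \<in> K" "k \<in> K - {i}" "\<tau> \<in> S" for i k \<tau>
    using not_collisionD[OF s_in_ellipsoid(2)[OF pos], of \<tau> i k] that by auto
  have nz': "x (\<theta> \<tau>) $ k - x (\<theta> \<tau>) $ i \<noteq> 0" if "i \<in> K" "k \<in> - K" "\<tau> \<in> S" for i k \<tau>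
  proof -
    have "k \<noteq> i" using that by blast
    then show ?thesis using not_collisionD[OF no_collision[OF pos], of \<tau> k i] that by auto
  qed
  have "continuous_on S (\<lambda>\<tau>. U_form (s (\<theta> \<tau>)) (E \<tau>))"
    unfolding U_form_def by (intro continuous_intros continuous_on_powr_hess conts E pot nz)
  moreover have "continuous_on S (\<lambda>\<tau>. W_form (\<theta> \<tau>) (E \<tau>))"
    unfolding W_form_def by (intro continuous_intros continuous_on_powr_hess conts E nz')
  ultimately have "continuous_on S V"
    unfolding V_def[abs_def] by (intro continuous_intros conts)
  then show ?thesis
    unfolding quad_def log_rate_def by (intro continuous_intros conts E assms)
qed

text \<open>The tangent field along \<open>s\<close> with profile \<open>W\<close>.\<close>

definition field :: "(real \<Rightarrow> real) \<Rightarrow> real \<Rightarrow> real ^ 'd ^ 'n" where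
  "field W \<tau> = (W \<tau> / \<rho> \<tau>) *\<^sub>R E \<tau>"

lemma deriv_field:
  assumes "0 < \<tau>" "(W has_real_derivative W') (at \<tau>)"
  shows "(field W has_vector_derivative
    inverse (\<rho> \<tau>) *\<^sub>R ((W' - log_rate \<tau> * W \<tau>) *\<^sub>R E \<tau> + W \<tau> *\<^sub>R E' \<tau>)) (at \<tau>)"
proof -
  have pos: "0 < \<rho> \<tau>" using \<rho>_pos assms by simp
  have "((\<lambda>\<tau>. W \<tau> / \<rho> \<tau>) has_real_derivative (W' - log_rate \<tau> * W \<tau>) / \<rho> \<tau>) (at \<tau>)"
    using DERIV_divide[OF assms(2) deriv_\<rho>[OF assms(1)]] pos
    by (auto simp: log_rate_def field_simps elim!: DERIV_cong)
  from has_vector_derivative_scaleR[OF this deriv_E[OF assms(1)]]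
  show ?thesis
    unfolding field_def[abs_def]
    by (rule has_vector_derivative_eq_rhs) (simp add: divide_inverse algebra_simps)
qed

lemma second_variation_integrand:
  assumes "0 < \<tau>" "(W has_real_derivative W') (at \<tau>)"
  shows "(\<rho> \<tau>)\<^sup>2 * ((mass_norm m (vector_derivative (field W) (at \<tau>)))\<^sup>2 +
        restricted_hessian m \<alpha> K (s (\<theta> \<tau>)) (field W \<tau>) (field W \<tau>)) +
      \<rho> \<tau> powr (2 * ((6 + \<alpha>) / (2 - \<alpha>))) *
        hessian (external_potential m \<alpha> K (relative_path m K x) (\<theta> \<tau>)) (y (\<theta> \<tau>)) (field W \<tau>) (field W \<tau>)
    = quad \<tau> (W \<tau>) W'"
proof -
  have pos: "0 < \<rho> \<tau>" using \<rho>_pos assms by simp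
  have t: "0 \<le> \<theta> \<tau>" "\<theta> \<tau> < 1" using \<theta>_range[of \<tau>] assms(1) by auto
  define z where "z = (W' - log_rate \<tau> * W \<tau>) *\<^sub>R E \<tau> + W \<tau> *\<^sub>R E' \<tau>"
  have "vector_derivative (field W) (at \<tau>) = inverse (\<rho> \<tau>) *\<^sub>R z"
    unfolding z_def by (rule vector_derivative_at[OF deriv_field[OF assms]])
  note vd = this
  have kin: "(\<rho> \<tau>)\<^sup>2 * (mass_norm m (vector_derivative (field W) (at \<tau>)))\<^sup>2 = ip z z"
    using pos unfolding mass_norm_power2[of m, OF mass_pos] vd mass_inner_simps
    by (simp add: power2_eq_square field_simps)
  have pot: "(\<rho> \<tau>)\<^sup>2 * restricted_hessian m \<alpha> K (s (\<theta> \<tau>)) (field W \<tau>) (field W \<tau>) =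
      (W \<tau>)\<^sup>2 * U_form (s (\<theta> \<tau>)) (E \<tau>)"
    using pos unfolding restricted_hessian_eq[OF s_in_ellipsoid(2)[OF t]] field_def U_form_scaleR
    by (simp add: power_divide)
  have ext: "\<rho> \<tau> powr (2 * ((6 + \<alpha>) / (2 - \<alpha>))) *
        hessian (external_potential m \<alpha> K (relative_path m K x) (\<theta> \<tau>)) (y (\<theta> \<tau>)) (field W \<tau>) (field W \<tau>) =
      (W \<tau>)\<^sup>2 * (r (\<theta> \<tau>) powr (2 + \<alpha>) * W_form (\<theta> \<tau>) (E \<tau>))"
    using pos unfolding external_hessian_eq[OF t] \<rho>_powrs(2)[OF less_imp_le[OF assms(1)]] field_def W_form_scaleR
    by (simp add: power_divide)
  have "ip z z = W'\<^sup>2 * ip (E \<tau>) (E \<tau>) +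
     W \<tau> * W' * (2 * ip (E \<tau>) (E' \<tau>) - 2 * log_rate \<tau> * ip (E \<tau>) (E \<tau>)) +
     (W \<tau>)\<^sup>2 * ((log_rate \<tau>)\<^sup>2 * ip (E \<tau>) (E \<tau>) - 2 * log_rate \<tau> * ip (E \<tau>) (E' \<tau>) + ip (E' \<tau>) (E' \<tau>))"
    by (simp add: z_def mass_inner_simps mass_inner_commute[of m "E' \<tau>" "E \<tau>"] power2_eq_square
        algebra_simps)
  then show ?thesis
    unfolding distrib_left[of "(\<rho> \<tau>)\<^sup>2"] kin pot ext quad_def V_def by (simp add: algebra_simps)
qed

text \<open>
  The integral starts at \<open>\<tau> = 0\<close>, where the motion need not be differentiable, but the field vanishes
  around this point.
\<close>

lemma second_variation_le:
  assumes "0 < T" and W: "\<And>\<tau>. (W has_real_derivative W' \<tau>) (at \<tau>)"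
    and support: "\<And>\<tau>. \<tau> \<notin> {T..b} \<Longrightarrow> W \<tau> = 0 \<and> W' \<tau> = 0"
    and "continuous_on {T..b} W'"
    and G: "integrable lborel G" "\<And>\<tau>. \<tau> \<notin> {T..b} \<Longrightarrow> G \<tau> = 0"
    and le: "\<And>\<tau>. T \<le> \<tau> \<Longrightarrow> quad \<tau> (W \<tau>) (W' \<tau>) \<le> G \<tau>"
  shows "second_variation m \<alpha> K (relative_path m K x) \<rho> (s_var m \<alpha> K x) (field W) \<le> (\<integral>\<tau>. G \<tau> \<partial>lborel)"
proof -
  define F where "F \<tau> = (\<rho> \<tau>)\<^sup>2 * ((mass_norm m (vector_derivative (field W) (at \<tau>)))\<^sup>2 +
        restricted_hessian m \<alpha> K (s (\<theta> \<tau>)) (field W \<tau>) (field W \<tau>)) +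
      \<rho> \<tau> powr (2 * ((6 + \<alpha>) / (2 - \<alpha>))) *
        hessian (external_potential m \<alpha> K (relative_path m K x)
            (integral {0..\<tau>} (\<lambda>\<sigma>. \<rho> \<sigma> powr (2 * (2 + \<alpha>) / (2 - \<alpha>)))))
          (\<rho> \<tau> powr (4 / (2 - \<alpha>)) *\<^sub>R s (\<theta> \<tau>)) (field W \<tau>) (field W \<tau>)" for \<tau>
  have F_pos: "F \<tau> = quad \<tau> (W \<tau>) (W' \<tau>)" if "0 < \<tau>" for \<tau>
    using second_variation_integrand[OF that W]
    unfolding F_def integral_\<rho>[OF less_imp_le[OF that]] \<rho>_powrs(1)[OF less_imp_le[OF that]] .
  \<comment> \<open>The formula for the derivative of \<open>field W\<close> covers only \<open>\<tau> > 0\<close>.\<close>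
  have F_0: "F 0 = 0"
  proof -
    have t: "0 \<le> \<theta> 0" "\<theta> 0 < 1" using \<theta>_range[of 0] by auto
    have f0: "field W \<tau> = 0 *\<^sub>R 0" if "\<tau> \<in> {..<T}" for \<tau> using support[of \<tau>] that by (simp add: field_def)
    have "vector_derivative (field W) (at 0) = vector_derivative (\<lambda>_. 0) (at 0)"
      by (rule vector_derivative_eq_on_open[of "{..<T}"]) (use f0 assms(1) in auto)
    moreover have z0: "field W 0 = 0 *\<^sub>R 0" by (rule f0) (use assms(1) in simp)
    have "restricted_hessian m \<alpha> K (s (\<theta> 0)) (field W 0) (field W 0) = 0"
      unfolding restricted_hessian_eq[OF s_in_ellipsoid(2)[OF t]] z0 U_form_scaleR by simp
    moreover have "hessian (external_potential m \<alpha> K (relative_path m K x) (\<theta> 0)) (y (\<theta> 0))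
        (field W 0) (field W 0) = 0"
      unfolding external_hessian_eq[OF t] z0 W_form_scaleR by simp
    ultimately show ?thesis
      by (simp only: F_def integral_\<rho>[OF order_refl] \<rho>_powrs(1)[OF order_refl])
        (simp add: mass_norm_def inertia_def mass_inner_simps)
  qed
  have F_eq: "F \<tau> = indicator {T..b} \<tau> *\<^sub>R quad \<tau> (W \<tau>) (W' \<tau>)" if "0 \<le> \<tau>" for \<tau>
  proof (cases "\<tau> \<in> {T..b}")
    case True
    then show ?thesis using F_pos[of \<tau>] assms(1) by simp
  next
    case False
    then have "quad \<tau> (W \<tau>) (W' \<tau>) = 0" using support[OF False] by (simp add: quad_def)
    then show ?thesis using F_pos[of \<tau>] F_0 that by (cases "\<tau> = 0") auto
  qed
  have cont_W: "continuous_on {T..b} W"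
    by (rule DERIV_continuous_on[of _ _ W']) (use W in \<open>auto intro: has_field_derivative_at_within\<close>)
  have "set_integrable lborel {T..b} (\<lambda>\<tau>. quad \<tau> (W \<tau>) (W' \<tau>))"
    using assms(1,4) cont_W by (intro borel_integrable_atLeastAtMost' continuous_quad) auto
  then have int: "integrable lborel (\<lambda>\<tau>. indicator {T..b} \<tau> *\<^sub>R quad \<tau> (W \<tau>) (W' \<tau>))"
    by (simp add: set_integrable_def)
  have "second_variation m \<alpha> K (relative_path m K x) \<rho> (s_var m \<alpha> K x) (field W) =
      (\<integral>\<tau>. indicator {0..} \<tau> *\<^sub>R F \<tau> \<partial>lborel)"
    unfolding second_variation_def set_lebesgue_integral_def s_var_eq F_def ..
  also have "\<dots> = (\<integral>\<tau>. indicator {T..b} \<tau> *\<^sub>R quad \<tau> (W \<tau>) (W' \<tau>) \<partial>lborel)"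
    by (rule Bochner_Integration.integral_cong) (use F_eq assms(1) in \<open>auto simp: indicator_def\<close>)
  also have "\<dots> \<le> (\<integral>\<tau>. G \<tau> \<partial>lborel)"
    by (rule integral_mono[OF int G(1)]) (use G(2) le in \<open>auto simp: indicator_def\<close>)
  finally show ?thesis .
qed

lemma times_differentiable_field:
  assumes "0 < T" "\<And>n. times_differentiable n UNIV W" "\<And>\<tau>. \<tau> \<notin> {T..b} \<Longrightarrow> W \<tau> = 0"
  shows "times_differentiable n UNIV (field W)"
proof -
  have "times_differentiable n {0<..} (\<lambda>\<tau>. (W \<tau> * \<rho> \<tau> powr (- 1)) *\<^sub>R E \<tau>)"
    using times_differentiable_compose[OF open_greaterThan UNIV_I
        times_differentiable_ident[OF open_greaterThan] assms(2)]
    by (intro times_differentiable_scaleR times_differentiable_mult times_differentiable_\<rho>_powr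
        times_differentiable_E open_greaterThan)
  then have "times_differentiable n {0<..} (field W)"
    by (rule times_differentiable_cong[OF open_greaterThan, rotated])
      (use \<rho>_pos in \<open>simp add: field_def powr_minus divide_inverse less_imp_le\<close>)
  moreover have "times_differentiable n (- {T..b}) (\<lambda>\<tau>. 0 :: real ^ 'd ^ 'n)"
    by (intro times_differentiable_const) auto
  then have "times_differentiable n (- {T..b}) (field W)"
    by (rule times_differentiable_cong[rotated 2]) (auto simp: field_def assms(3))
  ultimately have "times_differentiable n ({0<..} \<union> - {T..b}) (field W)"
    by (rule times_differentiable_Un)
  moreover have "{0<..} \<union> - {T..b} = UNIV" using assms(1) by auto
  ultimately show ?thesis by simp
qed

text \<open>
  The profiles are bumps on \<open>n\<close> consecutive intervals of length \<open>L\<close>, the first of which begins at a time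
  \<open>T\<close> after which the quadratic form is close to its limit.
\<close>

lemma morse_index_ge: "enat n \<le> collision_morse_index m \<alpha> K (relative_path m K x) \<rho> (s_var m \<alpha> K x)"
proof -
  obtain T where T: "1 \<le> T" "\<And>\<tau>. T \<le> \<tau> \<Longrightarrow> E \<tau> \<noteq> 0"
    "\<And>\<tau> \<omega> \<omega>'. T \<le> \<tau> \<Longrightarrow> quad \<tau> \<omega> \<omega>' \<le> ip e e * profile_form \<kappa> \<delta> \<omega> \<omega>'"
    using quad_eventually_le by blast
  obtain L I where L: "1 \<le> L" "I < 0" and profile: "\<And>t. has_bochner_integral lborel
      (\<lambda>\<tau>. profile_form \<kappa> \<delta> (bump (t + \<tau> / L)) (bump' (t + \<tau> / L) / L)) I"
    using profile_form_bump_negative[OF \<delta>_pos] by blast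
  define b where "b = T + L * real n"
  define u where "u \<tau> = (\<tau> - T) / L" for \<tau>
  define f where "f i \<tau> = bump (u \<tau> - real i)" for i \<tau>
  define f' where "f' i \<tau> = bump' (u \<tau> - real i) / L" for i \<tau>
  have u_eq: "u \<tau> - real i = (- T / L - real i) + \<tau> / L" for \<tau> i
    by (simp add: u_def diff_divide_distrib)
  have outside: "u \<tau> - real i \<notin> {0<..<1}" if "\<tau> \<notin> {T..b}" "i < n" for \<tau> i
  proof
    assume a: "u \<tau> - real i \<in> {0<..<1}"
    then have "0 < u \<tau>" "u \<tau> < real n" using that(2) by auto
    then have "T < \<tau>" "\<tau> < b" using L by (auto simp: u_def b_def field_simps)
    with that(1) show False by simp
  qed
  have f_0: "f i \<tau> = 0" "f' i \<tau> = 0" if "\<tau> \<notin> {T..b}" "i < n" for \<tau> i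
    using outside[OF that] by (simp_all add: f_def f'_def bump_eq_0 bump'_eq_0)
  have deriv_f: "(f i has_real_derivative f' i \<tau>) (at \<tau>)" for i \<tau>
  proof -
    have "((\<lambda>\<tau>. u \<tau> - real i) has_real_derivative 1 / L) (at \<tau>)"
      unfolding u_def using L by (auto intro!: derivative_eq_intros)
    from DERIV_chain2[OF deriv_bump this] show ?thesis unfolding f_def[abs_def] f'_def by simp
  qed
  have cont_f': "continuous_on UNIV (f' i)" for i
    unfolding f'_def[abs_def] u_def using L
    by (intro continuous_intros continuous_on_compose2[OF continuous_bump(2)[of UNIV]]) auto
  have td_f: "times_differentiable k UNIV (f i)" for k i
    unfolding f_def[abs_def] u_eq
    by (rule times_differentiable_compose[OF open_UNIV UNIV_I _ times_differentiable_bump])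
      (use times_differentiable_add[OF open_UNIV times_differentiable_const[OF open_UNIV]
         times_differentiable_mult[OF open_UNIV times_differentiable_const[OF open_UNIV, of _ "1 / L"]
           times_differentiable_ident[OF open_UNIV]]] in simp)
  have combination: "(\<lambda>\<tau>. \<Sum>i<n. c i *\<^sub>R field (f i) \<tau>) = field (\<lambda>\<tau>. \<Sum>i<n. c i * f i \<tau>)" for c
    by (simp add: fun_eq_iff field_def sum_divide_distrib scaleR_sum_left)
  have test: "test_function {0<..} (field (f i))" if "i < n" for i
    unfolding test_function_def
  proof
    show "smooth (field (f i))"
      using T(1) f_0(1) that
      by (intro smooth_if_times_differentiable times_differentiable_field[of T _ b] td_f) auto
    show "\<exists>C. compact C \<and> C \<subseteq> {0<..} \<and> (\<forall>t. t \<notin> C \<longrightarrow> field (f i) t = 0)"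
      using T(1) f_0(1) that by (intro exI[of _ "{T..b}"]) (auto simp: field_def)
  qed
  have tangent: "field (f i) \<tau> \<in> tangent_space m K (s_var m \<alpha> K x \<tau>)" if "0 < \<tau>" for i \<tau>
    using E_tangent[of \<tau>] that
    by (simp add: field_def s_var_eq tangent_space_scaleR)
  have independent: "c i = 0"
    if "(\<lambda>\<tau>. \<Sum>i<n. c i *\<^sub>R field (f i) \<tau>) = (\<lambda>\<tau>. 0)" "i < n" for c :: "nat \<Rightarrow> real" and i
  proof -
    \<comment> \<open>The midpoint of the support of the profile \<open>f i\<close>, where all the others vanish.\<close>
    define \<tau> where "\<tau> = T + L * (real i + 1 / 2)"
    have u: "u \<tau> = real i + 1 / 2" using L by (simp add: u_def \<tau>_def)
    have \<tau>: "T \<le> \<tau>" using L by (simp add: \<tau>_def)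
    have "f k \<tau> = 0" if "k \<noteq> i" for k
      using disjoint_translates[of i k bump bump "u \<tau>"] bump_pos[of "1 / 2"] that
      by (simp add: f_def u)
    then have "(\<Sum>k<n. c k * f k \<tau>) = c i * f i \<tau>"
      using that(2) by (subst sum.remove[of _ i]) auto
    moreover have "0 < f i \<tau>" using bump_pos[of "1 / 2"] by (simp add: f_def u)
    moreover have "field (\<lambda>\<tau>. \<Sum>i<n. c i * f i \<tau>) \<tau> = 0"
      using fun_cong[OF that(1)[unfolded combination], of \<tau>] by simp
    then have "(\<Sum>k<n. c k * f k \<tau>) = 0"
      using T(1,2) \<tau> \<rho>_pos[of \<tau>] by (simp add: field_def)
    ultimately show ?thesis by simp
  qed
  have negative: "second_variation m \<alpha> K (relative_path m K x) \<rho> (s_var m \<alpha> K x)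
      (\<lambda>\<tau>. \<Sum>i<n. c i *\<^sub>R field (f i) \<tau>) < 0"
    if nonzero: "(\<lambda>\<tau>. \<Sum>i<n. c i *\<^sub>R field (f i) \<tau>) \<noteq> (\<lambda>\<tau>. 0)" for c :: "nat \<Rightarrow> real"
  proof -
    define G where "G \<tau> = ip e e * (\<Sum>i<n. (c i)\<^sup>2 * profile_form \<kappa> \<delta> (f i \<tau>) (f' i \<tau>))" for \<tau>
    have diagonal: "profile_form \<kappa> \<delta> (\<Sum>i<n. c i * f i \<tau>) (\<Sum>i<n. c i * f' i \<tau>) =
        (\<Sum>i<n. (c i)\<^sup>2 * profile_form \<kappa> \<delta> (f i \<tau>) (f' i \<tau>))" for \<tau>
    proof -
      have "f i \<tau> * f k \<tau> = 0 \<and> f i \<tau> * f' k \<tau> = 0 \<and> f' i \<tau> * f' k \<tau> = 0" if "i \<noteq> k" for i k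
        using disjoint_translates[OF that, of bump bump "u \<tau>"]
          disjoint_translates[OF that, of bump bump' "u \<tau>"]
          disjoint_translates[OF that, of bump' bump' "u \<tau>"] by (auto simp: f_def f'_def)
      note disj = this
      have "(\<Sum>i<n. c i * f i \<tau>)\<^sup>2 = (\<Sum>i<n. (c i)\<^sup>2 * (f i \<tau>)\<^sup>2)"
        "(\<Sum>i<n. c i * f i \<tau>) * (\<Sum>i<n. c i * f' i \<tau>) = (\<Sum>i<n. (c i)\<^sup>2 * (f i \<tau> * f' i \<tau>))"
        "(\<Sum>i<n. c i * f' i \<tau>)\<^sup>2 = (\<Sum>i<n. (c i)\<^sup>2 * (f' i \<tau>)\<^sup>2)"
        unfolding power2_eq_square[of "sum _ _"] power2_eq_square[of "f _ _"]
          power2_eq_square[of "f' _ _"]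
        by (rule sum_mult_disjoint, use disj in blast)+
      then show ?thesis
        unfolding profile_form_def
        by (simp add: sum_distrib_left sum_subtractf sum.distrib algebra_simps)
    qed
    have hb: "has_bochner_integral lborel G (ip e e * (\<Sum>i<n. (c i)\<^sup>2 * I))"
      unfolding G_def[abs_def] f_def f'_def u_eq
      by (intro has_bochner_integral_mult_right has_bochner_integral_sum profile)
    have "second_variation m \<alpha> K (relative_path m K x) \<rho> (s_var m \<alpha> K x)
        (field (\<lambda>\<tau>. \<Sum>i<n. c i * f i \<tau>)) \<le> (\<integral>\<tau>. G \<tau> \<partial>lborel)"
    proof (rule second_variation_le[where T = T and b = b and W' = "\<lambda>\<tau>. \<Sum>i<n. c i * f' i \<tau>"])
      show "((\<lambda>\<tau>. \<Sum>i<n. c i * f i \<tau>) has_real_derivative (\<Sum>i<n. c i * f' i \<tau>)) (at \<tau>)" for \<tau>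
        by (intro DERIV_sum DERIV_cmult deriv_f)
      show "continuous_on {T..b} (\<lambda>\<tau>. \<Sum>i<n. c i * f' i \<tau>)"
        by (intro continuous_intros continuous_on_subset[OF cont_f']) auto
      show "integrable lborel G" using hb by (rule integrable.intros)
      show "quad \<tau> (\<Sum>i<n. c i * f i \<tau>) (\<Sum>i<n. c i * f' i \<tau>) \<le> G \<tau>" if "T \<le> \<tau>" for \<tau>
        using T(3)[OF that] unfolding G_def diagonal[symmetric] .
    qed (use T(1) f_0 in \<open>auto simp: G_def profile_form_def\<close>)
    also have "(\<integral>\<tau>. G \<tau> \<partial>lborel) = ip e e * ((\<Sum>i<n. (c i)\<^sup>2) * I)"
      using has_bochner_integral_integral_eq[OF hb] by (simp add: sum_distrib_right)
    also have "\<dots> < 0"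
    proof -
      have "\<exists>i<n. c i \<noteq> 0"
      proof (rule ccontr)
        assume "\<not> ?thesis"
        then have "(\<lambda>\<tau>. \<Sum>i<n. c i *\<^sub>R field (f i) \<tau>) = (\<lambda>\<tau>. 0)" by simp
        with nonzero show False by contradiction
      qed
      then obtain i where "i < n" "c i \<noteq> 0" by blast
      then have "0 < (\<Sum>i<n. (c i)\<^sup>2)" by (intro sum_pos2[of _ i]) auto
      then show ?thesis using e_pos L(2) by (simp add: mult_pos_neg)
    qed
    finally show ?thesis unfolding combination .
  qed
  show ?thesis
    unfolding collision_morse_index_def
  proof (rule Sup_upper, intro CollectI exI conjI allI impI, rule refl)
    show "test_function {0<..} (field (f i))" if "i < n" for i by (rule test[OF that])
    show "field (f i) \<tau> \<in> tangent_space m K (s_var m \<alpha> K x \<tau>)" if "0 < \<tau>" for i \<tau>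
      by (rule tangent[OF that])
    show "c i = 0" if "(\<lambda>\<tau>. \<Sum>i<n. c i *\<^sub>R field (f i) \<tau>) = (\<lambda>\<tau>. 0)" "i < n" for c i
      by (rule independent[OF that])
    show "second_variation m \<alpha> K (relative_path m K x) \<rho> (s_var m \<alpha> K x)
      (\<lambda>\<tau>. \<Sum>i<n. c i *\<^sub>R field (f i) \<tau>) < 0"
      if "(\<lambda>\<tau>. \<Sum>i<n. c i *\<^sub>R field (f i) \<tau>) \<noteq> (\<lambda>\<tau>. 0)" for c
      by (rule negative[OF that])
  qed
qed

end

end

theorem theorem4p3:
  fixes m :: "'n::finite \<Rightarrow> real" and \<alpha> :: real
    and x :: "real \<Rightarrow> real ^ 'd::finite ^ 'n"
    and K :: "'n set" and s0 :: "real ^ 'd ^ 'n" and \<mu>1 :: real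
  assumes "2 \<le> CARD('d)" and "2 \<le> CARD('n)"
    and "0 < \<alpha>" and "\<alpha> < 2" and "\<And>i. 0 < m i"
    and "H1_path (centred_space m UNIV) x"
    and "one_collision_solution m \<alpha> x"
    and "colliding_cluster x K"
    and "central_configuration m \<alpha> K s0"
    and "(s_var m \<alpha> K x \<longlongrightarrow> s0) at_top"
    and "smallest_restricted_eigenvalue m \<alpha> K s0 \<mu>1"
    and "\<mu>1 < - ((2 - \<alpha>)\<^sup>2 / 8) * potential m \<alpha> K s0"
  shows "collision_morse_index m \<alpha> K (relative_path m K x)
           (rho_var m \<alpha> K x) (s_var m \<alpha> K x) = \<infinity>"
proof -
  obtain v a where motion: "continuous_on {0..1} x" "\<forall>t\<in>{0..1}. x t \<in> collision_set UNIV \<longleftrightarrow> t = 1"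
    "\<forall>t\<in>{0<..<1}. (x has_vector_derivative v t) (at t) \<and> (v has_vector_derivative a t) (at t) \<and>
        GDERIV (potential m \<alpha> UNIV) (x t) :> mass_mult m (a t)"
    "action m \<alpha> x < \<infinity>"
    using assms(7) unfolding one_collision_solution_def by auto
  obtain e where e: "e \<in> tangent_space m K s0" "e \<noteq> 0"
    "restricted_hessian m \<alpha> K s0 e e = \<mu>1 * mass_inner m e e"
    using assms(11) unfolding smallest_restricted_eigenvalue_def restricted_eigenvalue_def by blast
  have "cluster_collision m \<alpha> x v a K"
    by standard (use assms motion in auto)
  moreover have "s0 \<in> ellipsoid m K" using assms(9) by (simp add: central_configuration_def)
  ultimately have ge: "enat n \<le> collision_morse_index m \<alpha> K (relative_path m K x)
      (rho_var m \<alpha> K x) (s_var m \<alpha> K x)" for n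
    using assms(10,12) e by (intro cluster_collision.morse_index_ge)
  show ?thesis
  proof (cases "collision_morse_index m \<alpha> K (relative_path m K x) (rho_var m \<alpha> K x) (s_var m \<alpha> K x)")
    case (enat n)
    then show ?thesis using ge[of "Suc n"] by simp
  qed
qed

end
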